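(* Let $k\in\mathbb N$, $f=\lambda z+\mathrm{h.o.t.}\in\mathcal L_k$ with $0<\lambda<1$, and let $f_0$ be its normal form (defined in the context). Then $f_0$ is minimal with respect to inclusion of supports within the conjugacy class of $f$ under parabolic transformations in $\mathfrak L^0$, and the coefficients of $f_0$ are invariants of this conjugacy class: for every $\psi\in\mathfrak L^0$, the transseries $r:=\psi\circ f\circ\psi^{-1}$ satisfies $\mathrm{ord}(r-f_0)>\mathbf 1_{k+1}$ (in particular $\mathrm{Supp}(f_0)\subseteq\mathrm{Supp}(r)$ and $r$ and $f_0$ have the same coefficients at all elements of $\mathrm{Supp}(f_0)$). In particular, there exists $\psi\in\mathfrak L^0$ with $\psi\circ f\circ\psi^{-1}=\lambda z$ if and only if $\mathrm{ord}(f-\lambda\,\mathrm{id})>\mathbf 1_{k+1}$.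
   Context: $z$ is an infinitesimal variable; $\boldsymbol\ell_1:=-1/\ln z$, $\boldsymbol\ell_{j+1}:=\boldsymbol\ell_j\circ\boldsymbol\ell_1$. $\mathcal L_k$ is the set of formal sums $\sum a_{\alpha,n_1,\dots,n_k}z^\alpha\boldsymbol\ell_1^{n_1}\cdots\boldsymbol\ell_k^{n_k}$ with real coefficients and well-ordered support in $\mathbb R_{\ge0}\times\mathbb Z^k$ (lexicographic order); $\mathcal L_m\subseteq\mathcal L_k$ for $m\le k$, $\mathfrak L=\bigcup_k\mathcal L_k$. $\mathrm{ord}(f)=\min\mathrm{Supp}(f)$; orders of elements of different $\mathcal L_m$ are compared after padding with zeros, so $\mathbf 1_{k+1}=(1,\dots,1)\in\mathbb R\times\mathbb Z^k$ is identified with $(1,\dots,1,0,\dots,0)$ in larger depth. Parabolic means leading term $z$; $\mathfrak L^0$ is the group (under composition) of parabolic elements of $\mathfrak L$. Normal form: writing $f=\lambda z+\sum_{\mathbf 0_k<\boldsymbol m\le\mathbf 1_k}a_{\boldsymbol m}z\boldsymbol\ell_1^{m_1}\cdots\boldsymbol\ell_k^{m_k}+\mathrm{h.o.t.}$, one sets $f_0:=\lambda z+\sum_{\mathbf 0_k<\boldsymbol m\le\mathbf 1_k}a_{\boldsymbol m}z\boldsymbol\ell_1^{m_1}\cdots\boldsymbol\ell_k^{m_k}$ (lexicographic comparison in $\mathbb Z^k$). *)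

theory Defs
  imports Complex_Main
begin

text \<open>
  Formal logarithmic transseries.  A monomial z^a * l_1^(n_0) * l_2^(n_1) * ... is
  represented by the pair (a, n) with n :: nat => int, where n j is the exponent of
  the iterated logarithm l_(j+1).  Representing exponents as functions on all of nat
  realises the identification "pad with zeros" between different depths.
  A transseries is its coefficient function.
\<close>

type_synonym mon = "real \<times> (nat \<Rightarrow> int)"
type_synonym ts = "mon \<Rightarrow> real"

definition lexless :: "(nat \<Rightarrow> int) \<Rightarrow> (nat \<Rightarrow> int) \<Rightarrow> bool" where
  "lexless n m \<longleftrightarrow> (\<exists>i. (\<forall>j<i. n j = m j) \<and> n i < m i)"

definition mless :: "mon \<Rightarrow> mon \<Rightarrow> bool" where
  "mless a b \<longleftrightarrow> fst a < fst b \<or> (fst a = fst b \<and> lexless (snd a) (snd b))"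

definition supp :: "ts \<Rightarrow> mon set" where
  "supp f = {m. f m \<noteq> 0}"

definition well_ordered_mon :: "mon set \<Rightarrow> bool" where
  "well_ordered_mon S \<longleftrightarrow> (\<forall>T\<subseteq>S. T \<noteq> {} \<longrightarrow> (\<exists>x\<in>T. \<forall>y\<in>T. \<not> mless y x))"

definition depth_le :: "nat \<Rightarrow> mon \<Rightarrow> bool" where
  "depth_le k m \<longleftrightarrow> (\<forall>j\<ge>k. snd m j = 0)"

definition Lk :: "nat \<Rightarrow> ts set" where
  "Lk k = {f. well_ordered_mon (supp f) \<and> (\<forall>m\<in>supp f. fst m \<ge> 0 \<and> depth_le k m)}"

definition Lfrak :: "ts set" where
  "Lfrak = (\<Union>k. Lk k)"

definition zero_exp :: "nat \<Rightarrow> int" where "zero_exp = (\<lambda>_. 0)"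

definition monom :: "mon \<Rightarrow> real \<Rightarrow> ts" where
  "monom m c = (\<lambda>x. if x = m then c else 0)"

definition tone :: ts where "tone = monom (0, zero_exp) 1"

fun ell :: "nat \<Rightarrow> ts" where
  "ell 0 = monom (1, zero_exp) 1"
| "ell (Suc j) = monom (0, \<lambda>i. if i = j then 1 else 0) 1"

abbreviation tz :: ts where "tz \<equiv> ell 0"

definition tadd :: "ts \<Rightarrow> ts \<Rightarrow> ts" where "tadd f g = (\<lambda>m. f m + g m)"
definition tneg :: "ts \<Rightarrow> ts" where "tneg f = (\<lambda>m. - f m)"
definition tsub :: "ts \<Rightarrow> ts \<Rightarrow> ts" where "tsub f g = (\<lambda>m. f m - g m)"
definition tscale :: "real \<Rightarrow> ts \<Rightarrow> ts" where "tscale c f = (\<lambda>m. c * f m)"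

definition mmul :: "mon \<Rightarrow> mon \<Rightarrow> mon" where
  "mmul a b = (fst a + fst b, \<lambda>i. snd a i + snd b i)"

text \<open>Cauchy product (the index set is finite for well-ordered supports).\<close>
definition tmul :: "ts \<Rightarrow> ts \<Rightarrow> ts" where
  "tmul f g = (\<lambda>m. \<Sum>p\<in>{p. p \<in> supp f \<times> supp g \<and> mmul (fst p) (snd p) = m}.
                    f (fst p) * g (snd p))"

definition tpow :: "ts \<Rightarrow> nat \<Rightarrow> ts" where
  "tpow f i = (tmul f ^^ i) tone"

text \<open>Sum of a summable family (each monomial occurs in finitely many members).\<close>
definition tsumN :: "(nat \<Rightarrow> ts) \<Rightarrow> ts" where
  "tsumN F = (\<lambda>m. \<Sum>i\<in>{i. F i m \<noteq> 0}. F i m)"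

text \<open>(1+x)^a and log(1+x) for infinitesimal x.\<close>
definition binser :: "real \<Rightarrow> ts \<Rightarrow> ts" where
  "binser a x = tsumN (\<lambda>i. tscale (a gchoose i) (tpow x i))"

definition log1p :: "ts \<Rightarrow> ts" where
  "log1p x = tsumN (\<lambda>i. if i = 0 then (\<lambda>_. 0)
                        else tscale ((-1) ^ (i + 1) / real i) (tpow x i))"

text \<open>For g with leading term c z (c > 0): g = c z (1 + eps g).\<close>
definition zmon :: mon where "zmon = (1, zero_exp)"

definition eps :: "ts \<Rightarrow> ts" where
  "eps g = (\<lambda>m. if m = (0, zero_exp) then 0 else g (fst m + 1, snd m) / g zmon)"

text \<open>Lam g j = log((l_j o g) / l_j), with l_0 = z; recursively
  l_(j+1) o g = l_(j+1) * (1 - l_(j+1) * Lam g j)^(-1).\<close>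
fun Lam :: "ts \<Rightarrow> nat \<Rightarrow> ts" where
  "Lam g 0 = tadd (monom (0, zero_exp) (ln (g zmon))) (log1p (eps g))"
| "Lam g (Suc j) = tneg (log1p (tneg (tmul (ell (Suc j)) (Lam g j))))"

definition depth_of :: "mon \<Rightarrow> nat" where
  "depth_of m = (LEAST K. depth_le K m)"

text \<open>Composition of a monomial with g:
  (z^a prod l_(j+1)^(n j)) o g = c^a z^a (1+eps)^a * prod l_(j+1)^(n j) (1 - l_(j+1) Lam g j)^(-(n j)).\<close>
definition mon_comp :: "ts \<Rightarrow> mon \<Rightarrow> ts" where
  "mon_comp g m =
     tscale (g zmon powr fst m)
       (tmul (monom m 1)
         (tmul (binser (fst m) (eps g))
           (foldr (\<lambda>j acc. tmul (binser (- of_int (snd m j))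
                                        (tneg (tmul (ell (Suc j)) (Lam g j)))) acc)
                  [0..<depth_of m] tone)))"

text \<open>Composition f o g, by strong linearity in f.\<close>
definition comp :: "ts \<Rightarrow> ts \<Rightarrow> ts" where
  "comp f g = (\<lambda>m. \<Sum>b\<in>{b \<in> supp f. mon_comp g b m \<noteq> 0}. f b * mon_comp g b m)"

definition leading :: "ts \<Rightarrow> mon \<Rightarrow> real \<Rightarrow> bool" where
  "leading f m c \<longleftrightarrow> f m = c \<and> (\<forall>x\<in>supp f. x = m \<or> mless m x)"

definition Lfrak0 :: "ts set" where
  "Lfrak0 = {f \<in> Lfrak. leading f zmon 1}"

definition inverse_pair :: "ts \<Rightarrow> ts \<Rightarrow> bool" where
  "inverse_pair \<psi> \<phi> \<longleftrightarrow> comp \<psi> \<phi> = tz \<and> comp \<phi> \<psi> = tz"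

text \<open>ord h > m (with ord 0 = +infinity), i.e. the minimum of the support exceeds m.\<close>
definition ord_gt :: "ts \<Rightarrow> mon \<Rightarrow> bool" where
  "ord_gt h m \<longleftrightarrow> (\<forall>x\<in>supp h. mless m x)"

text \<open>1_(k+1) = (1,1,...,1) (k ones in the log exponents), padded with zeros.\<close>
definition ones_exp :: "nat \<Rightarrow> nat \<Rightarrow> int" where
  "ones_exp k = (\<lambda>i. if i < k then 1 else 0)"

definition ones_mon :: "nat \<Rightarrow> mon" where
  "ones_mon k = (1, ones_exp k)"

definition normal_form :: "nat \<Rightarrow> ts \<Rightarrow> ts" where
  "normal_form k f = (\<lambda>m. if fst m = 1 \<and> depth_le k m \<and>
        (snd m = zero_exp \<or> (lexless zero_exp (snd m) \<and>
                              (snd m = ones_exp k \<or> lexless (snd m) (ones_exp k))))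
      then f m else 0)"

end

theory Submission
  imports "HOL-Library.Groups_Big_Fun" "HOL-Computational_Algebra.Formal_Power_Series" Defs
begin

text \<open>
  Write every series with leading term c z (c > 0) as c z exp(w) with w infinitesimal. Composition with
  c z exp(w) is a strongly linear ring homomorphism C, and the logarithm of a composition is
  w + C(w'); so all questions become additive ones about w.

  For an infinitesimal monomial b, the difference C(b) - b has order tau(b), where tau(b) = b if b
  contains a power of z, and tau(b) = b l_1 ... l_j if b is purely logarithmic with first logarithm
  l_j. All these orders exceed l_1 ... l_k, so modulo terms of higher order than l_1 ... l_k
  composition acts trivially on infinitesimals and conjugation leaves w unchanged: this is the
  invariance. Conversely tau maps the positive exponents of depth k strictly increasingly onto the
  exponents beyond l_1 ... l_k, and for 0 < c < 1 the leading coefficient of C(b) - b does not vanish,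
  so every such term can be removed; Zorn's lemma (spherical completeness of Hahn series) carries
  this removal to the end. The same completeness principle provides compositional inverses
  and Neumann's lemma on sums of positive well-ordered sets.
\<close>

section \<open>Hahn series\<close>

text \<open>For f = lam z exp(w) and f_0 = lam z exp(w_0), the conjugacy f o phi = phi o f_0 with
  phi = z exp(s) reads s + C_s(w) = w_0 + C(s), where C_s and C denote composition with phi and f_0.
  It is solved as a perturbation of the linear operator C - id: a change of s of order b moves
  C_s(w) only at orders tau(a) b with a in the support of w, and in depth k these lie strictly
  beyond tau(b), because tau(a) > l_1 ... l_k while tau(b) <= b l_1 ... l_k. Depth is the other
  obstacle. A conjugating series may contain more logarithms than f, so invariance is needed at an
  arbitrary depth K while the bound stays at l_1 ... l_k. A fixed finite K is in turn what makes
  composition strongly linear: the logarithms of all images of monomials are combinations of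
  finitely many series, so one well-ordered set controls them. The operations of the statement are
  sums over index sets, which default to 0 when infinite. All computations therefore take place in a
  type of Hahn series and are transferred at the end.\<close>

definition wo :: "'a::linorder set \<Rightarrow> bool" where
  "wo S \<longleftrightarrow> (\<forall>T\<subseteq>S. T \<noteq> {} \<longrightarrow> (\<exists>x\<in>T. \<forall>y\<in>T. x \<le> y))"

lemma wo_subset: "wo S \<Longrightarrow> T \<subseteq> S \<Longrightarrow> wo T"
  unfolding wo_def by blast

lemma wo_empty [simp]: "wo {}"
  by (simp add: wo_def)

lemma wo_singleton [simp]: "wo {a}"
  unfolding wo_def by blast

lemma wo_min:
  assumes "wo S" "a \<in> S"
  obtains m where "m \<in> S" "\<And>y. y \<in> S \<Longrightarrow> m \<le> y"
proof -
  have "\<exists>x\<in>S. \<forall>y\<in>S. x \<le> y"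
    using assms(1)[unfolded wo_def, rule_format, OF subset_refl] assms(2) by blast
  then show ?thesis using that by blast
qed

lemma wo_Un:
  assumes "wo A" "wo B" shows "wo (A \<union> B)"
  unfolding wo_def
proof (intro allI impI)
  fix T assume T: "T \<subseteq> A \<union> B" "T \<noteq> {}"
  have A: "wo (T \<inter> A)" and B: "wo (T \<inter> B)"
    using assms by (auto intro: wo_subset)
  consider "T \<inter> A = {}" | "T \<inter> B = {}" | a b where "a \<in> T \<inter> A" "b \<in> T \<inter> B" by blast
  then show "\<exists>x\<in>T. \<forall>y\<in>T. x \<le> y"
  proof cases
    case 1
    then have "T \<subseteq> B" using T by blast
    then show ?thesis using assms(2) T(2) unfolding wo_def by blast
  next
    case 2
    then have "T \<subseteq> A" using T by blast
    then show ?thesis using assms(1) T(2) unfolding wo_def by blast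
  next
    case 3
    obtain m where m: "m \<in> T \<inter> A" "\<And>y. y \<in> T \<inter> A \<Longrightarrow> m \<le> y" by (rule wo_min[OF A 3(1)]) auto
    obtain n where n: "n \<in> T \<inter> B" "\<And>y. y \<in> T \<inter> B \<Longrightarrow> n \<le> y" by (rule wo_min[OF B 3(2)]) auto
    have "min m n \<le> y" if "y \<in> T" for y
      using that m(2)[of y] n(2)[of y] T(1) by (auto simp: min_le_iff_disj)
    moreover have "min m n \<in> T" using m(1) n(1) by (simp add: min_def)
    ultimately show ?thesis by blast
  qed
qed

lemma wo_UN_finite: "finite I \<Longrightarrow> (\<And>i. i \<in> I \<Longrightarrow> wo (A i)) \<Longrightarrow> wo (\<Union>i\<in>I. A i)"
  by (induction I rule: finite_induct) (simp_all add: wo_Un)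

lemma wo_no_descent:
  fixes s :: "nat \<Rightarrow> 'a::linorder"
  assumes "wo S" "\<And>i. s i \<in> S" shows "\<exists>i. s i \<le> s (Suc i)"
proof -
  have "range s \<subseteq> S" "range s \<noteq> {}" using assms(2) by auto
  then obtain x where "x \<in> range s" "\<forall>y\<in>range s. x \<le> y" using assms(1) unfolding wo_def by blast
  then show ?thesis by auto
qed

lemma woI_seq:
  assumes "\<And>s :: nat \<Rightarrow> 'a::linorder. (\<And>i. s i \<in> S) \<Longrightarrow> \<exists>i. s i \<le> s (Suc i)"
  shows "wo S"
  unfolding wo_def
proof (intro allI impI, rule ccontr)
  fix T assume T: "T \<subseteq> S" "T \<noteq> {}" "\<not> (\<exists>x\<in>T. \<forall>y\<in>T. x \<le> y)"
  have "\<exists>s::nat \<Rightarrow> 'a. \<forall>n. s n \<in> T \<and> s (Suc n) < s n"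
    by (rule dependent_nat_choice[of "\<lambda>_ x. x \<in> T" "\<lambda>_ x y. y < x"]) (use T in \<open>auto simp: not_le\<close>)
  then obtain s :: "nat \<Rightarrow> 'a" where s: "\<And>n. s n \<in> T" "\<And>n. s (Suc n) < s n" by blast
  have "\<exists>i. s i \<le> s (Suc i)" by (rule assms) (use s(1) T(1) in blast)
  then show False using s(2) by (auto simp: not_le[symmetric])
qed

text \<open>In a strictly descending sequence of sums, some subsequence has monotone first summands.
  Well-ordering makes them eventually nondecreasing, so the second summands would have to descend
  forever.\<close>

lemma wo_plus:
  fixes A B :: "'a::linordered_ab_group_add set"
  assumes "wo A" "wo B"
  shows "wo {a + b | a b. a \<in> A \<and> b \<in> B}"
proof (rule woI_seq, rule ccontr)
  fix s :: "nat \<Rightarrow> 'a"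
  assume s: "\<And>i. s i \<in> {a + b | a b. a \<in> A \<and> b \<in> B}" and "\<not> (\<exists>i. s i \<le> s (Suc i))"
  then have dec: "\<And>i. s (Suc i) < s i" by (simp add: not_le)
  have dec': "s j < s i" if "i < j" for i j
    using that
  proof (induction j)
    case (Suc j)
    then show ?case using dec[of j] by (cases "i = j") auto
  qed simp
  from s obtain a b where ab: "\<And>i. s i = a i + b i" "\<And>i. a i \<in> A" "\<And>i. b i \<in> B"
    by (simp only: mem_Collect_eq) metis
  obtain r :: "nat \<Rightarrow> nat" where r: "strict_mono r" "monoseq (\<lambda>n. a (r n))"
    using seq_monosub[of a] by blast
  have "\<exists>N. \<forall>n\<ge>N. a (r n) \<le> a (r (Suc n))"
  proof (cases "\<forall>n. a (r n) \<le> a (r (Suc n))")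
    case False
    then have d: "\<And>m n. m \<le> n \<Longrightarrow> a (r n) \<le> a (r m)"
      using r(2) unfolding monoseq_def by (meson le_SucI order_refl)
    have "wo (range (\<lambda>n. a (r n)))" using ab by (intro wo_subset[OF assms(1)]) auto
    then obtain m where "m \<in> range (\<lambda>n. a (r n))" "\<And>y. y \<in> range (\<lambda>n. a (r n)) \<Longrightarrow> m \<le> y"
      by (rule wo_min) auto
    then obtain N where "\<And>n. a (r N) \<le> a (r n)" by auto
    then show ?thesis using d by (meson order_trans)
  qed auto
  then obtain N where N: "\<And>n. n \<ge> N \<Longrightarrow> a (r n) \<le> a (r (Suc n))" by blast
  have "\<exists>i. b (r (N + i)) \<le> b (r (N + Suc i))"
    by (rule wo_no_descent[OF assms(2)]) (rule ab(3))
  then obtain i where "b (r (N + i)) \<le> b (r (N + Suc i))" by blast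
  moreover have "a (r (N + i)) \<le> a (r (N + Suc i))" using N[of "N + i"] by simp
  ultimately have "s (r (N + i)) \<le> s (r (N + Suc i))" by (simp add: ab add_mono)
  moreover have "r (N + i) < r (N + Suc i)" using r(1) by (simp add: strict_mono_less)
  ultimately show False using dec' by (meson leD)
qed

text \<open>Otherwise take the least \<open>a\<close> with infinitely many elements below it. The
  elements strictly below \<open>a\<close> have a maximum \<open>c\<close>, and below
  \<open>c\<close> there are still infinitely many, against the choice of \<open>a\<close>.\<close>

lemma finite_if_min_max:
  fixes T :: "'a::linorder set"
  assumes "wo T" and max: "\<And>U. U \<subseteq> T \<Longrightarrow> U \<noteq> {} \<Longrightarrow> \<exists>x\<in>U. \<forall>y\<in>U. y \<le> x"
  shows "finite T"
proof (rule ccontr)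
  assume inf: "infinite T"
  let ?U = "{a\<in>T. infinite {b\<in>T. b \<le> a}}"
  from inf max[of T] obtain x where "x \<in> T" "\<forall>y\<in>T. y \<le> x" by fastforce
  then have "{b\<in>T. b \<le> x} = T" by auto
  then have "x \<in> ?U" using inf \<open>x \<in> T\<close> by simp
  moreover have "wo ?U" using assms(1) by (rule wo_subset) auto
  ultimately obtain a where a: "a \<in> ?U" "\<And>y. y \<in> ?U \<Longrightarrow> a \<le> y" by (elim wo_min) auto
  have "{b\<in>T. b \<le> a} \<subseteq> insert a {b\<in>T. b < a}" by auto
  then have inf': "infinite {b\<in>T. b < a}" using a(1) by (auto dest: finite_subset)
  then have "{b\<in>T. b < a} \<noteq> {}" by (metis finite.emptyI)
  then obtain c where c: "c \<in> {b\<in>T. b < a}" "\<forall>y\<in>{b\<in>T. b < a}. y \<le> c"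
    using max[of "{b\<in>T. b < a}"] by blast
  have "{b\<in>T. b < a} \<subseteq> {b\<in>T. b \<le> c}" using c by auto
  then have "c \<in> ?U" using inf' c(1) by (auto dest: finite_subset)
  then show False using a(2)[of c] c(1) by auto
qed

text \<open>The reflection of \<open>a\<close> to \<open>m - a\<close> reverses the order, so minima
  in \<open>B\<close> become maxima in the fibre. This finiteness makes Cauchy products and kernel
  sums meaningful.\<close>

lemma finite_wo_fiber:
  fixes A B :: "'a::linordered_ab_group_add set"
  assumes "wo A" "wo B"
  shows "finite {a \<in> A. m - a \<in> B}"
proof (rule finite_if_min_max)
  show "wo {a \<in> A. m - a \<in> B}" by (rule wo_subset[OF assms(1)]) auto
  fix U assume U: "U \<subseteq> {a \<in> A. m - a \<in> B}" "U \<noteq> {}"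
  then have "(\<lambda>a. m - a) ` U \<subseteq> B" "(\<lambda>a. m - a) ` U \<noteq> {}" by auto
  then obtain y where "y \<in> (\<lambda>a. m - a) ` U" "\<forall>z\<in>(\<lambda>a. m - a) ` U. y \<le> z"
    using assms(2) unfolding wo_def by blast
  then obtain a where "a \<in> U" "\<forall>x\<in>U. x \<le> a" by auto
  then show "\<exists>x\<in>U. \<forall>y\<in>U. y \<le> x" by blast
qed

section \<open>The ring of Hahn series over an ordered abelian group\<close>

typedef (overloaded) ('a::linordered_ab_group_add) hahn = "{f :: 'a \<Rightarrow> real. wo {m. f m \<noteq> 0}}"
  morphisms coef Abs_hahn
  by (rule exI[of _ "\<lambda>_. 0"]) simp

definition hsupp :: "'a::linordered_ab_group_add hahn \<Rightarrow> 'a set" where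
  "hsupp x = {m. coef x m \<noteq> 0}"

lemma wo_hsupp [simp]: "wo (hsupp x)"
  using coef[of x] by (simp add: hsupp_def)

lemma in_hsupp: "m \<in> hsupp x \<longleftrightarrow> coef x m \<noteq> 0"
  by (simp add: hsupp_def)

lemma coef_Abs: "wo {m. f m \<noteq> 0} \<Longrightarrow> coef (Abs_hahn f) = f"
  by (simp add: Abs_hahn_inverse)

lemma hahn_eqI: "(\<And>m. coef x m = coef y m) \<Longrightarrow> x = y"
  by (metis coef_inject ext)

instantiation hahn :: (linordered_ab_group_add) "{comm_ring_1, real_algebra_1}"
begin

definition "0 = Abs_hahn (\<lambda>_. 0)"
definition "1 = Abs_hahn (\<lambda>m. if m = 0 then 1 else 0)"
definition "x + y = Abs_hahn (\<lambda>m. coef x m + coef y m)"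
definition "x - y = Abs_hahn (\<lambda>m. coef x m - coef y m)"
definition "- x = Abs_hahn (\<lambda>m. - coef x m)"
definition "c *\<^sub>R x = Abs_hahn (\<lambda>m. c * coef x m)"
definition "x * y = Abs_hahn (\<lambda>m. Sum_any (\<lambda>a. coef x a * coef y (m - a)))"

lemma coef_zero [simp]: "coef 0 m = 0"
  by (simp add: zero_hahn_def coef_Abs)

lemma coef_one: "coef 1 m = (if m = 0 then 1 else 0)"
  unfolding one_hahn_def by (subst coef_Abs) (auto intro: wo_subset[of "{0}"])

lemma coef_add [simp]: "coef (x + y) m = coef x m + coef y m"
  unfolding plus_hahn_def
  by (subst coef_Abs, rule wo_subset[OF wo_Un[OF wo_hsupp[of x] wo_hsupp[of y]]]) (auto simp: in_hsupp)

lemma coef_diff [simp]: "coef (x - y) m = coef x m - coef y m"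
  unfolding minus_hahn_def
  by (subst coef_Abs, rule wo_subset[OF wo_Un[OF wo_hsupp[of x] wo_hsupp[of y]]]) (auto simp: in_hsupp)

lemma coef_minus [simp]: "coef (- x) m = - coef x m"
  unfolding uminus_hahn_def
  by (subst coef_Abs, rule wo_subset[OF wo_hsupp[of x]]) (auto simp: in_hsupp)

lemma coef_scaleR [simp]: "coef (c *\<^sub>R x) m = c * coef x m"
  unfolding scaleR_hahn_def
  by (subst coef_Abs, rule wo_subset[OF wo_hsupp[of x]]) (auto simp: in_hsupp)

lemma finite_mult_index: "finite {a. coef x a * coef y (m - a) \<noteq> 0}"
  using finite_wo_fiber[OF wo_hsupp[of x] wo_hsupp[of y], of m]
  by (rule finite_subset[rotated]) (auto simp: in_hsupp)

lemma coef_mult: "coef (x * y) m = Sum_any (\<lambda>a. coef x a * coef y (m - a))"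
  unfolding times_hahn_def
proof (subst coef_Abs, rule wo_subset[OF wo_plus[OF wo_hsupp[of x] wo_hsupp[of y]]])
  show "{m. Sum_any (\<lambda>a. coef x a * coef y (m - a)) \<noteq> 0} \<subseteq> {a + b |a b. a \<in> hsupp x \<and> b \<in> hsupp y}"
  proof clarify
    fix m assume "Sum_any (\<lambda>a. coef x a * coef y (m - a)) \<noteq> 0"
    then obtain a where "coef x a * coef y (m - a) \<noteq> 0" by (rule Sum_any.not_neutral_obtains_not_neutral)
    then show "\<exists>a b. m = a + b \<and> a \<in> hsupp x \<and> b \<in> hsupp y"
      by (intro exI[of _ a] exI[of _ "m - a"]) (simp add: in_hsupp)
  qed
qed simp

lemma hsupp_mult: "hsupp (x * y) \<subseteq> {a + b |a b. a \<in> hsupp x \<and> b \<in> hsupp y}"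
proof
  fix m assume "m \<in> hsupp (x * y)"
  then have "Sum_any (\<lambda>a. coef x a * coef y (m - a)) \<noteq> 0" by (simp add: in_hsupp coef_mult)
  then obtain a where "coef x a * coef y (m - a) \<noteq> 0" by (rule Sum_any.not_neutral_obtains_not_neutral)
  then show "m \<in> {a + b |a b. a \<in> hsupp x \<and> b \<in> hsupp y}"
    by (simp, intro exI[of _ a] exI[of _ "m - a"]) (simp add: in_hsupp)
qed

lemma hahn_mult_commute: "x * y = y * (x :: 'a hahn)"
proof (rule hahn_eqI)
  fix m :: 'a
  have b: "bij (\<lambda>a. m - a)" by (rule o_bij[of "\<lambda>a. m - a"]) (auto simp: fun_eq_iff)
  show "coef (x * y) m = coef (y * x) m"
    unfolding coef_mult by (rule Sum_any.reindex_cong[OF b]) (simp add: fun_eq_iff mult.commute)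
qed

lemma hahn_mult_1: "1 * x = (x :: 'a hahn)"
proof (rule hahn_eqI)
  fix m :: 'a
  have "(\<lambda>a. coef 1 a * coef x (m - a)) = (\<lambda>a. if a = 0 then coef x (m - a) else 0)"
    by (auto simp: coef_one)
  then show "coef (1 * x) m = coef x m" by (simp only: coef_mult Sum_any.delta diff_zero)
qed

lemma hahn_distrib: "(x + y) * z = x * z + y * (z :: 'a hahn)"
proof (rule hahn_eqI)
  fix m
  show "coef ((x + y) * z) m = coef (x * z + y * z) m"
    unfolding coef_mult coef_add distrib_right
    by (rule Sum_any.distrib[OF finite_mult_index finite_mult_index])
qed

lemma hahn_scale_mult: "c *\<^sub>R x * y = c *\<^sub>R (x * y :: 'a hahn)"
proof (rule hahn_eqI)
  fix m
  show "coef (c *\<^sub>R x * y) m = coef (c *\<^sub>R (x * y)) m"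
    unfolding coef_mult coef_scaleR mult.assoc
    by (rule Sum_any_right_distrib[OF finite_mult_index, symmetric])
qed

lemma hahn_mult_assoc: "x * y * z = x * (y * (z :: 'a hahn))"
proof (rule hahn_eqI)
  fix m :: 'a
  define g where "g = (\<lambda>b a. coef x a * coef y (b - a) * coef z (m - b))"
  \<comment> \<open>Exchanging the two \<open>Sum_any\<close> needs a finite rectangle around the
    support of the double sum; each side is a fibre over a sum of two supports.\<close>
  let ?B = "{b \<in> {a + b |a b. a \<in> hsupp x \<and> b \<in> hsupp y}. m - b \<in> hsupp z}"
  let ?A = "{a \<in> hsupp x. m - a \<in> {a + b |a b. a \<in> hsupp y \<and> b \<in> hsupp z}}"
  have fin: "finite (?B \<times> ?A)"
    by (intro finite_cartesian_product finite_wo_fiber wo_plus wo_hsupp)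
  have A: "a \<in> ?A" "b \<in> ?B" if "g b a \<noteq> 0" for a b
  proof -
    have "a \<in> hsupp x" "b - a \<in> hsupp y" "m - b \<in> hsupp z" using that by (auto simp: g_def in_hsupp)
    moreover have "b = a + (b - a)" "m - a = (b - a) + (m - b)" by auto
    ultimately show "a \<in> ?A" "b \<in> ?B" by blast+
  qed
  have "coef (x * y * z) m = Sum_any (\<lambda>b. Sum_any (\<lambda>a. g b a))"
    unfolding coef_mult[of "x * y"] coef_mult[of x] g_def
    by (subst Sum_any_left_distrib[OF finite_mult_index]) (rule refl)
  also have "\<dots> = Sum_any (\<lambda>a. Sum_any (\<lambda>b. g b a))"
    by (rule Sum_any.swap[OF fin]) (use A in blast)
  also have "\<dots> = Sum_any (\<lambda>a. coef x a * coef (y * z) (m - a))"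
  proof (rule Sum_any.cong)
    fix a :: 'a
    have b: "bij (\<lambda>c. c + a)" by (rule o_bij[of "\<lambda>c. c - a"]) (auto simp: fun_eq_iff)
    have "Sum_any (\<lambda>b. g b a) = Sum_any (\<lambda>c. coef x a * (coef y c * coef z (m - a - c)))"
      by (rule Sum_any.reindex_cong[OF b]) (auto simp: g_def fun_eq_iff algebra_simps)
    then show "Sum_any (\<lambda>b. g b a) = coef x a * coef (y * z) (m - a)"
      unfolding coef_mult[of y] by (subst Sum_any_right_distrib[OF finite_mult_index])
  qed
  also have "\<dots> = coef (x * (y * z)) m" by (simp only: coef_mult[of x])
  finally show "coef (x * y * z) m = coef (x * (y * z)) m" .
qed

instance
proof
  fix x y z :: "'a hahn" and c d :: real
  show "x + y + z = x + (y + z)" "x + y = y + x" "0 + x = x" "- x + x = 0" "x - y = x + - y"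
    "c *\<^sub>R (x + y) = c *\<^sub>R x + c *\<^sub>R y" "(c + d) *\<^sub>R x = c *\<^sub>R x + d *\<^sub>R x"
    "c *\<^sub>R d *\<^sub>R x = (c * d) *\<^sub>R x" "1 *\<^sub>R x = x"
    by (rule hahn_eqI; simp add: algebra_simps)+
  show "(0::'a hahn) \<noteq> 1"
    by (metis coef_one coef_zero zero_neq_one)
  show "x * y = y * x" by (rule hahn_mult_commute)
  show "1 * x = x" by (rule hahn_mult_1)
  show "x * 1 = x" by (subst hahn_mult_commute) (rule hahn_mult_1)
  show "(x + y) * z = x * z + y * z" by (rule hahn_distrib)
  show "x * (y + z) = x * y + x * z"
    unfolding hahn_mult_commute[of x] by (rule hahn_distrib)
  show "c *\<^sub>R x * y = c *\<^sub>R (x * y)" by (rule hahn_scale_mult)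
  show "x * c *\<^sub>R y = c *\<^sub>R (x * y)"
    unfolding hahn_mult_commute[of x] by (rule hahn_scale_mult)
  show "x * y * z = x * (y * z)" by (rule hahn_mult_assoc)
qed

end

section \<open>Summable families and strongly linear operators\<close>

definition hmon :: "'a::linordered_ab_group_add \<Rightarrow> 'a hahn" where
  "hmon a = Abs_hahn (\<lambda>m. if m = a then 1 else 0)"

lemma coef_hmon: "coef (hmon a) m = (if m = a then 1 else 0)"
  unfolding hmon_def by (subst coef_Abs) (auto intro: wo_subset[of "{a}"])

lemma hmon_0 [simp]: "hmon 0 = 1"
  by (rule hahn_eqI) (simp add: coef_hmon coef_one)

lemma coef_hmon_mult: "coef (hmon a * x) m = coef x (m - a)"
proof -
  have "(\<lambda>b. coef (hmon a) b * coef x (m - b)) = (\<lambda>b. if b = a then coef x (m - b) else 0)"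
    by (auto simp: coef_hmon)
  then show ?thesis by (simp only: coef_mult Sum_any.delta)
qed

lemma hmon_add: "hmon (a + b) = hmon a * hmon b"
  by (rule hahn_eqI) (auto simp: coef_hmon_mult coef_hmon)

lemma hsupp_zero [simp]: "hsupp 0 = {}" and hsupp_one [simp]: "hsupp 1 = {0}"
  and hsupp_hmon [simp]: "hsupp (hmon a) = {a}"
  by (auto simp: hsupp_def coef_one coef_hmon)

lemma hsupp_minus [simp]: "hsupp (- x) = hsupp x"
  by (simp add: hsupp_def)

lemma hsupp_add: "hsupp x \<subseteq> A \<Longrightarrow> hsupp y \<subseteq> A \<Longrightarrow> hsupp (x + y) \<subseteq> A"
  by (force simp: hsupp_def)

lemma hsupp_diff: "hsupp x \<subseteq> A \<Longrightarrow> hsupp y \<subseteq> A \<Longrightarrow> hsupp (x - y) \<subseteq> A"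
  by (force simp: hsupp_def)

lemma hsupp_diff_commute: "hsupp (x - y) = hsupp (y - x)"
  using hsupp_minus[of "x - y"] by (simp only: minus_diff_eq)

lemma hsupp_scaleR: "hsupp x \<subseteq> A \<Longrightarrow> hsupp (c *\<^sub>R x) \<subseteq> A"
  by (force simp: hsupp_def)

lemma hsupp_sum: "(\<And>i. i \<in> I \<Longrightarrow> hsupp (f i) \<subseteq> A) \<Longrightarrow> hsupp (sum f I) \<subseteq> A"
  by (induction I rule: infinite_finite_induct) (simp_all add: hsupp_add)

lemma hsupp_mult_subset:
  assumes "hsupp x \<subseteq> A" "hsupp y \<subseteq> B" "\<And>a b. a \<in> A \<Longrightarrow> b \<in> B \<Longrightarrow> a + b \<in> C"
  shows "hsupp (x * y) \<subseteq> C"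
  using hsupp_mult[of x y] assms by blast

lemma hsupp_power_subset:
  assumes "hsupp x \<subseteq> A" "0 \<in> A" "\<And>a b. a \<in> A \<Longrightarrow> b \<in> A \<Longrightarrow> a + b \<in> A"
  shows "hsupp (x ^ i) \<subseteq> A"
proof (induction i)
  case (Suc i)
  then show ?case unfolding power_Suc by (rule hsupp_mult_subset[OF assms(1)]) (rule assms(3))
qed (use assms(2) in simp)

text \<open>Well-ordering of the union is demanded besides pointwise finiteness, since otherwise the
  coefficientwise sum need not be a Hahn series.\<close>

definition hsummable :: "('i \<Rightarrow> 'a::linordered_ab_group_add hahn) \<Rightarrow> bool" where
  "hsummable F \<longleftrightarrow> wo (\<Union>i. hsupp (F i)) \<and> (\<forall>m. finite {i. coef (F i) m \<noteq> 0})"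

definition hsum :: "('i \<Rightarrow> 'a::linordered_ab_group_add hahn) \<Rightarrow> 'a hahn" where
  "hsum F = Abs_hahn (\<lambda>m. Sum_any (\<lambda>i. coef (F i) m))"

lemma hsummableI:
  assumes "wo S" "\<And>i. hsupp (F i) \<subseteq> S" "\<And>m. finite {i. coef (F i) m \<noteq> 0}"
  shows "hsummable F"
  unfolding hsummable_def using assms by (auto intro: wo_subset)

lemma coef_hsum:
  assumes "hsummable F"
  shows "coef (hsum F) m = Sum_any (\<lambda>i. coef (F i) m)"
  unfolding hsum_def
proof (subst coef_Abs, rule wo_subset[of "\<Union>i. hsupp (F i)"])
  show "{m. Sum_any (\<lambda>i. coef (F i) m) \<noteq> 0} \<subseteq> (\<Union>i. hsupp (F i))"
  proof clarify
    fix m assume "Sum_any (\<lambda>i. coef (F i) m) \<noteq> 0"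
    then obtain i where "coef (F i) m \<noteq> 0" by (rule Sum_any.not_neutral_obtains_not_neutral)
    then show "m \<in> (\<Union>i. hsupp (F i))" by (auto simp: in_hsupp)
  qed
qed (use assms in \<open>simp_all add: hsummable_def\<close>)

lemma hsupp_hsum:
  assumes "hsummable F" shows "hsupp (hsum F) \<subseteq> (\<Union>i. hsupp (F i))"
proof
  fix m assume "m \<in> hsupp (hsum F)"
  then have "Sum_any (\<lambda>i. coef (F i) m) \<noteq> 0" by (simp only: in_hsupp coef_hsum[OF assms] not_False_eq_True)
  then obtain i where "coef (F i) m \<noteq> 0" by (rule Sum_any.not_neutral_obtains_not_neutral)
  then show "m \<in> (\<Union>i. hsupp (F i))" by (auto simp: in_hsupp)
qed

lemma hsummable_diff:
  assumes "hsummable F" "hsummable G"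
  shows "hsummable (\<lambda>i. F i - G i)" "hsum (\<lambda>i. F i - G i) = hsum F - hsum G"
proof -
  have fin: "finite {i. coef (F i) m \<noteq> 0}" "finite {i. coef (G i) m \<noteq> 0}" for m
    using assms by (auto simp: hsummable_def)
  show s: "hsummable (\<lambda>i. F i - G i)"
  proof (rule hsummableI)
    show "wo ((\<Union>i. hsupp (F i)) \<union> (\<Union>i. hsupp (G i)))"
      using assms by (auto simp: hsummable_def intro: wo_Un)
    show "hsupp (F i - G i) \<subseteq> (\<Union>i. hsupp (F i)) \<union> (\<Union>i. hsupp (G i))" for i
      by (rule hsupp_diff) auto
    show "finite {i. coef (F i - G i) m \<noteq> 0}" for m
      by (rule finite_subset[OF _ finite_UnI[OF fin[of m]]]) auto
  qed
  show "hsum (\<lambda>i. F i - G i) = hsum F - hsum G"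
  proof (rule hahn_eqI)
    fix m
    let ?A = "{i. coef (F i) m \<noteq> 0} \<union> {i. coef (G i) m \<noteq> 0}"
    have A: "finite ?A" using fin by simp
    have "Sum_any (\<lambda>i. coef (F i - G i) m) = (\<Sum>i\<in>?A. coef (F i - G i) m)"
      "Sum_any (\<lambda>i. coef (F i) m) = (\<Sum>i\<in>?A. coef (F i) m)"
      "Sum_any (\<lambda>i. coef (G i) m) = (\<Sum>i\<in>?A. coef (G i) m)"
      by (rule Sum_any.expand_superset[OF A], force)+
    then show "coef (hsum (\<lambda>i. F i - G i)) m = coef (hsum F - hsum G) m"
      by (simp only: coef_hsum[OF s] coef_hsum[OF assms(1)] coef_hsum[OF assms(2)] coef_diff sum_subtractf)
  qed
qed

text \<open>Strong linearity is encoded by a kernel: the values on monomials determine the operator,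
  and one well-ordered set \<open>S\<close>, independent of \<open>b\<close>, bounds all shifts of
  exponents. This uniformity makes the images of the monomials of any series summable.\<close>

definition strong :: "('a::linordered_ab_group_add hahn \<Rightarrow> 'a hahn) \<Rightarrow> bool" where
  "strong T \<longleftrightarrow> (\<exists>S. wo S \<and> (\<forall>b. hsupp (T (hmon b)) \<subseteq> (+) b ` S)) \<and>
     (\<forall>x. T x = hsum (\<lambda>b. coef x b *\<^sub>R T (hmon b)))"

text \<open>Only exponents \<open>b\<close> of some \<open>F i\<close> with \<open>m - b\<close> in
  \<open>S\<close> contribute, and each of them occurs in finitely many members. The two projections
  together give the finite rectangle for interchanging the sums over \<open>i\<close> and
  \<open>b\<close>.\<close>

lemma kernel_summable:
  fixes F :: "'i \<Rightarrow> 'a::linordered_ab_group_add hahn"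
  assumes "wo S" "\<And>b. hsupp (Q b) \<subseteq> (+) b ` S" "hsummable F"
  shows "finite {i. \<exists>b. coef (F i) b * coef (Q b) m \<noteq> 0}" (is ?A)
    and "finite {b. \<exists>i. coef (F i) b * coef (Q b) m \<noteq> 0}" (is ?B)
proof -
  let ?W = "\<Union>i. hsupp (F i)"
  let ?B' = "{b \<in> ?W. m - b \<in> S}"
  have fB: "finite ?B'" using assms by (intro finite_wo_fiber) (auto simp: hsummable_def)
  have sub: "b \<in> ?B'" if "coef (F i) b * coef (Q b) m \<noteq> 0" for i b
  proof -
    have "b \<in> ?W" "m \<in> hsupp (Q b)" using that by (auto simp: in_hsupp)
    then show ?thesis using assms(2)[of b] by auto
  qed
  show ?B by (rule finite_subset[OF _ fB]) (use sub in blast)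
  have "finite (\<Union>b\<in>?B'. {i. coef (F i) b \<noteq> 0})"
    using fB assms(3) by (intro finite_UN_I) (auto simp: hsummable_def)
  then show ?A by (rule finite_subset[rotated]) (use sub in fastforce)
qed

lemma kernel_hsummable:
  assumes "wo S" "\<And>b. hsupp (Q b) \<subseteq> (+) b ` S"
  shows "hsummable (\<lambda>b. coef x b *\<^sub>R Q b)"
proof (rule hsummableI)
  show "wo {a + b |a b. a \<in> hsupp x \<and> b \<in> S}" using assms by (intro wo_plus) auto
  show "hsupp (coef x b *\<^sub>R Q b) \<subseteq> {a + b |a b. a \<in> hsupp x \<and> b \<in> S}" for b
    using assms(2)[of b] by (force simp: in_hsupp)
  have "hsummable (\<lambda>_::unit. x)" by (rule hsummableI[OF wo_hsupp[of x]]) auto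
  from kernel_summable(2)[OF assms this]
  show "finite {b. coef (coef x b *\<^sub>R Q b) m \<noteq> 0}" for m by simp
qed

lemma strong_kernel:
  assumes "wo S" "\<And>b. hsupp (Q b) \<subseteq> (+) b ` S"
  defines "T \<equiv> \<lambda>x. hsum (\<lambda>b. coef x b *\<^sub>R Q b)"
  shows "strong T" and "T (hmon b) = Q b"
proof -
  have T: "T (hmon b) = Q b" for b
  proof (rule hahn_eqI)
    fix m
    have "(\<lambda>c. coef (coef (hmon b) c *\<^sub>R Q c) m) = (\<lambda>c. if c = b then coef (Q c) m else 0)"
      by (auto simp: coef_hmon)
    then show "coef (T (hmon b)) m = coef (Q b) m"
      unfolding T_def by (simp only: coef_hsum[OF kernel_hsummable[OF assms(1,2)]] Sum_any.delta)
  qed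
  then show "T (hmon b) = Q b" .
  show "strong T" unfolding strong_def T using assms by auto
qed

lemma strong_summable:
  assumes "strong T" shows "hsummable (\<lambda>b. coef x b *\<^sub>R T (hmon b))"
  using assms kernel_hsummable[of _ "\<lambda>b. T (hmon b)"] unfolding strong_def by blast

lemma strong_expand:
  assumes "strong T" shows "T x = hsum (\<lambda>b. coef x b *\<^sub>R T (hmon b))"
  using assms unfolding strong_def by blast

lemma strong_ext:
  assumes "strong T" "strong T'" "\<And>b. T (hmon b) = T' (hmon b)"
  shows "T x = T' x"
  unfolding strong_expand[OF assms(1), of x] strong_expand[OF assms(2), of x] by (simp only: assms(3))

lemma strong_hsum:
  fixes F :: "'i \<Rightarrow> 'a::linordered_ab_group_add hahn"
  assumes "strong T" "hsummable F"
  shows "hsummable (\<lambda>i. T (F i))" "T (hsum F) = hsum (\<lambda>i. T (F i))"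
proof -
  define Q where "Q b = T (hmon b)" for b
  from assms obtain S where S: "wo S" "\<And>b. hsupp (Q b) \<subseteq> (+) b ` S" and T: "\<And>x. T x = hsum (\<lambda>b. coef x b *\<^sub>R Q b)"
    unfolding strong_def Q_def by blast
  note sm = kernel_hsummable[OF S]
  note fin = kernel_summable[OF S assms(2)]
  have cT: "coef (T x) m = Sum_any (\<lambda>b. coef x b * coef (Q b) m)" for x m
    by (simp only: T coef_hsum[OF sm] coef_scaleR)
  show s: "hsummable (\<lambda>i. T (F i))"
  proof (rule hsummableI)
    show "wo {a + b |a b. a \<in> (\<Union>i. hsupp (F i)) \<and> b \<in> S}"
      using S assms(2) by (intro wo_plus) (auto simp: hsummable_def)
    show "hsupp (T (F i)) \<subseteq> {a + b |a b. a \<in> (\<Union>i. hsupp (F i)) \<and> b \<in> S}" for i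
    proof -
      have "hsupp (T (F i)) \<subseteq> (\<Union>b. hsupp (coef (F i) b *\<^sub>R Q b))" unfolding T by (rule hsupp_hsum[OF sm])
      moreover have "hsupp (coef (F i) b *\<^sub>R Q b) \<subseteq> {a + b |a b. a \<in> (\<Union>i. hsupp (F i)) \<and> b \<in> S}" for b
        using S(2)[of b] by (force simp: in_hsupp)
      ultimately show ?thesis by blast
    qed
    show "finite {i. coef (T (F i)) m \<noteq> 0}" for m
    proof (rule finite_subset[OF _ fin(1)[of m]], clarify)
      fix i assume "coef (T (F i)) m \<noteq> 0"
      then have "Sum_any (\<lambda>b. coef (F i) b * coef (Q b) m) \<noteq> 0" by (simp only: cT not_False_eq_True)
      then show "\<exists>b. coef (F i) b * coef (Q b) m \<noteq> 0" by (rule Sum_any.not_neutral_obtains_not_neutral) blast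
    qed
  qed
  show "T (hsum F) = hsum (\<lambda>i. T (F i))"
  proof (rule hahn_eqI)
    fix m
    have fi: "finite {i. coef (F i) b \<noteq> 0}" for b using assms(2) by (simp add: hsummable_def)
    have "coef (T (hsum F)) m = Sum_any (\<lambda>b. Sum_any (\<lambda>i. coef (F i) b * coef (Q b) m))"
      unfolding cT coef_hsum[OF assms(2)] by (subst Sum_any_left_distrib[OF fi]) (rule refl)
    also have "\<dots> = Sum_any (\<lambda>i. Sum_any (\<lambda>b. coef (F i) b * coef (Q b) m))"
      by (rule Sum_any.swap[OF finite_cartesian_product[OF fin(2)[of m] fin(1)[of m]]]) auto
    also have "\<dots> = coef (hsum (\<lambda>i. T (F i))) m"
      by (simp only: coef_hsum[OF s] cT)
    finally show "coef (T (hsum F)) m = coef (hsum (\<lambda>i. T (F i))) m" .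
  qed
qed

lemma strong_scaleR:
  assumes "strong T" shows "T (c *\<^sub>R x) = c *\<^sub>R T x"
proof (rule hahn_eqI)
  fix m
  note sm = strong_summable[OF assms]
  have T: "\<And>x. T x = hsum (\<lambda>b. coef x b *\<^sub>R T (hmon b))" by (rule strong_expand[OF assms])
  have "finite {b. coef (coef x b *\<^sub>R T (hmon b)) m \<noteq> 0}" using sm[of x] by (simp add: hsummable_def)
  then have "Sum_any (\<lambda>b. c * coef (coef x b *\<^sub>R T (hmon b)) m) = c * Sum_any (\<lambda>b. coef (coef x b *\<^sub>R T (hmon b)) m)"
    by (rule Sum_any_right_distrib[symmetric])
  then show "coef (T (c *\<^sub>R x)) m = coef (c *\<^sub>R T x) m"
    unfolding T[of "c *\<^sub>R x"] T[of x] coef_scaleR coef_hsum[OF sm] coef_hsum[OF sm, of "c *\<^sub>R x", unfolded coef_scaleR]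
    by (simp only: mult.assoc)
qed

lemma strong_diff:
  assumes "strong T" shows "T (x - y) = T x - T y"
proof -
  have T: "\<And>x. T x = hsum (\<lambda>b. coef x b *\<^sub>R T (hmon b))" by (rule strong_expand[OF assms])
  show ?thesis
    unfolding T[of "x - y"] T[of x] T[of y] coef_diff scaleR_left_diff_distrib
    by (rule hsummable_diff[OF strong_summable[OF assms] strong_summable[OF assms]])
qed

lemma strong_zero: "strong T \<Longrightarrow> T 0 = 0"
  using strong_diff[of T 0 0] by simp

lemma strong_minus: "strong T \<Longrightarrow> T (- x) = - T x"
  using strong_diff[of T 0 x] by (simp add: strong_zero)

lemma strong_add: "strong T \<Longrightarrow> T (x + y) = T x + T y"
  using strong_diff[of T x "- y"] by (simp add: strong_minus)

lemma strong_sum: "strong T \<Longrightarrow> T (sum f I) = (\<Sum>i\<in>I. T (f i))"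
  by (induction I rule: infinite_finite_induct) (simp_all add: strong_zero strong_add)

lemma hsum_monomials: "hsummable (\<lambda>b. coef x b *\<^sub>R hmon b)" "hsum (\<lambda>b. coef x b *\<^sub>R hmon b) = x"
proof -
  show s: "hsummable (\<lambda>b. coef x b *\<^sub>R hmon b)"
    by (rule kernel_hsummable[of "{0}"]) auto
  show "hsum (\<lambda>b. coef x b *\<^sub>R hmon b) = x"
  proof (rule hahn_eqI)
    fix m
    have "(\<lambda>b. coef (coef x b *\<^sub>R hmon b) m) = (\<lambda>b. if b = m then coef x b else 0)" by (auto simp: coef_hmon)
    then show "coef (hsum (\<lambda>b. coef x b *\<^sub>R hmon b)) m = coef x m"
      by (simp only: coef_hsum[OF s] Sum_any.delta)
  qed
qed

lemma strong_id: "strong (\<lambda>x. x)"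
  unfolding strong_def hsum_monomials by (auto intro: exI[of _ "{0}"])

lemma strong_mult_right: "strong (\<lambda>x. x * y)"
proof -
  have sub: "hsupp (hmon b * y) \<subseteq> (+) b ` hsupp y" for b
    using hsupp_mult[of "hmon b" y] by auto
  have "x * y = hsum (\<lambda>b. coef x b *\<^sub>R (hmon b * y))" for x
  proof (rule hahn_eqI)
    fix m show "coef (x * y) m = coef (hsum (\<lambda>b. coef x b *\<^sub>R (hmon b * y))) m"
      by (simp only: coef_hsum[OF kernel_hsummable[OF wo_hsupp[of y] sub]] coef_scaleR coef_hmon_mult coef_mult[of x])
  qed
  then show ?thesis unfolding strong_def using sub wo_hsupp[of y] by blast
qed

lemma strong_mult_left: "strong (\<lambda>x. y * x)"
  using strong_mult_right[of y] by (simp only: mult.commute)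

lemma strong_compose:
  assumes "strong T" "strong U" shows "strong (\<lambda>x. T (U x))"
proof -
  from assms obtain S where S: "wo S" "\<And>b. hsupp (T (hmon b)) \<subseteq> (+) b ` S" unfolding strong_def by blast
  from assms obtain R where R: "wo R" "\<And>b. hsupp (U (hmon b)) \<subseteq> (+) b ` R" unfolding strong_def by blast
  have "hsupp (T (U (hmon b))) \<subseteq> (+) b ` {a + b |a b. a \<in> R \<and> b \<in> S}" for b
  proof
    fix m assume "m \<in> hsupp (T (U (hmon b)))"
    moreover have "T (U (hmon b)) = hsum (\<lambda>c. coef (U (hmon b)) c *\<^sub>R T (hmon c))"
      by (rule strong_expand[OF assms(1)])
    ultimately obtain c where c: "m \<in> hsupp (coef (U (hmon b)) c *\<^sub>R T (hmon c))"
      using hsupp_hsum[OF strong_summable[OF assms(1)]] by fastforce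
    then have "c \<in> hsupp (U (hmon b))" "m \<in> hsupp (T (hmon c))" by (auto simp: in_hsupp)
    then obtain r s where "c = b + r" "r \<in> R" "m = c + s" "s \<in> S" using S(2) R(2) by blast
    then show "m \<in> (+) b ` {a + b |a b. a \<in> R \<and> b \<in> S}" by (auto simp: add.assoc)
  qed
  moreover have "wo {a + b |a b. a \<in> R \<and> b \<in> S}" using R S by (intro wo_plus)
  moreover have "T (U x) = hsum (\<lambda>b. coef x b *\<^sub>R T (U (hmon b)))" for x
  proof -
    have "T (U x) = T (hsum (\<lambda>b. coef x b *\<^sub>R U (hmon b)))"
      by (subst strong_expand[OF assms(2), of x]) (rule refl)
    also have "\<dots> = hsum (\<lambda>b. T (coef x b *\<^sub>R U (hmon b)))"
      by (rule strong_hsum[OF assms(1) strong_summable[OF assms(2)]])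
    finally show ?thesis by (simp only: strong_scaleR[OF assms(1)])
  qed
  ultimately show ?thesis unfolding strong_def by blast
qed

text \<open>Both sides are strongly linear in each factor, so the identity passes from monomials to
  series one factor at a time.\<close>

lemma strong_mult_hom:
  assumes T: "strong T" and "\<And>a b. T (hmon (a + b)) = T (hmon a) * T (hmon b)"
  shows "T (x * y) = T x * T y"
proof -
  have *: "T (x * hmon b) = T x * T (hmon b)" for x b
    by (rule strong_ext[OF strong_compose[OF T strong_mult_right] strong_compose[OF strong_mult_right T]])
      (simp add: assms(2) hmon_add[symmetric])
  show ?thesis
    by (rule strong_ext[OF strong_compose[OF T strong_mult_left] strong_compose[OF strong_mult_left T]])
      (rule *)
qed

lemma strong_hsupp:
  assumes "strong T" "m \<in> hsupp (T x)"
  obtains b where "b \<in> hsupp x" "m \<in> hsupp (T (hmon b))"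
proof -
  have "T x = hsum (\<lambda>b. coef x b *\<^sub>R T (hmon b))" by (rule strong_expand[OF assms(1)])
  then obtain b where "m \<in> hsupp (coef x b *\<^sub>R T (hmon b))"
    using hsupp_hsum[OF strong_summable[OF assms(1)], of x] assms(2) by fastforce
  then show ?thesis using that[of b] by (auto simp: in_hsupp)
qed

lemma strong_minus_op:
  assumes "strong T" "strong U" shows "strong (\<lambda>x. T x - U x)"
proof -
  from assms obtain S where S: "wo S" "\<And>b. hsupp (T (hmon b)) \<subseteq> (+) b ` S" unfolding strong_def by blast
  from assms obtain R where R: "wo R" "\<And>b. hsupp (U (hmon b)) \<subseteq> (+) b ` R" unfolding strong_def by blast
  have "hsupp (T (hmon b) - U (hmon b)) \<subseteq> (+) b ` (S \<union> R)" for b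
    using S(2)[of b] R(2)[of b] by (intro hsupp_diff) auto
  moreover have "wo (S \<union> R)" using S R by (intro wo_Un)
  moreover have "T x - U x = hsum (\<lambda>b. coef x b *\<^sub>R (T (hmon b) - U (hmon b)))" for x
  proof -
    have "T x - U x = hsum (\<lambda>b. coef x b *\<^sub>R T (hmon b)) - hsum (\<lambda>b. coef x b *\<^sub>R U (hmon b))"
      unfolding strong_expand[OF assms(1), of x] strong_expand[OF assms(2), of x] by (rule refl)
    also have "\<dots> = hsum (\<lambda>b. coef x b *\<^sub>R T (hmon b) - coef x b *\<^sub>R U (hmon b))"
      by (rule hsummable_diff(2)[symmetric]; rule strong_summable; rule assms)
    finally show ?thesis by (simp only: scaleR_right_diff_distrib)
  qed
  ultimately show ?thesis unfolding strong_def by blast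
qed

section \<open>Completeness and Neumann's lemma\<close>

text \<open>Approximate zeros x of E are ordered by the order of E x. A chain of them has an upper bound, obtained
  by gluing the coefficients that no longer change, and a maximal one cannot be improved.\<close>
lemma hahn_zero_by_approximation:
  fixes E :: "'a::linordered_ab_group_add hahn \<Rightarrow> 'a hahn" and \<tau> :: "'a \<Rightarrow> 'a" and A :: "'a \<Rightarrow> real set"
  defines "X \<equiv> {x. \<forall>m. coef x m \<in> A m}"
  assumes A0: "\<And>m. 0 \<in> A m"
    and mono: "\<And>a b. a \<in> B \<Longrightarrow> b \<in> B \<Longrightarrow> a < b \<Longrightarrow> \<tau> a < \<tau> b"
    and lip: "\<And>x y b. x \<in> X \<Longrightarrow> y \<in> X \<Longrightarrow> b \<in> B \<Longrightarrow> hsupp (x - y) \<subseteq> {b..} \<Longrightarrow> hsupp (E x - E y) \<subseteq> {\<tau> b..}"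
    and improve: "\<And>x. x \<in> X \<Longrightarrow> E x \<noteq> 0 \<Longrightarrow>
      \<exists>b\<in>B. \<exists>y\<in>X. coef (E x) (\<tau> b) \<noteq> 0 \<and> hsupp (y - x) \<subseteq> {b..} \<and> hsupp (E y) \<subseteq> {\<tau> b<..}"
  shows "\<exists>x\<in>X. E x = 0"
proof -
  \<comment> \<open>\<open>K x b\<close> says that the order of \<open>E x\<close> is
    \<open>\<tau> b\<close>; \<open>L x y b\<close> says in addition that \<open>y\<close> agrees
    with \<open>x\<close> below \<open>b\<close> and has a residual of larger order.\<close>
  define K where "K x b \<longleftrightarrow> b \<in> B \<and> coef (E x) (\<tau> b) \<noteq> 0 \<and> hsupp (E x) \<subseteq> {\<tau> b..}" for x b
  define L where "L x y b \<longleftrightarrow> K x b \<and> hsupp (y - x) \<subseteq> {b..} \<and> hsupp (E y) \<subseteq> {\<tau> b<..}" for x y b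
  define P where "P x y \<longleftrightarrow> x = y \<or> (\<exists>b. L x y b)" for x y
  have mono': "a < b" if "\<tau> a < \<tau> b" "a \<in> B" "b \<in> B" for a b
    using that mono[of b a] by (metis less_asym less_irrefl not_less_iff_gr_or_eq)
  have K_uniq: "b = c" if "K x b" "K x c" for x b c
  proof -
    have "\<tau> b \<le> \<tau> c" "\<tau> c \<le> \<tau> b" using that unfolding K_def by (auto simp: in_hsupp[symmetric])
    then show ?thesis using mono[of b c] mono[of c b] that unfolding K_def
      by (metis linorder_neqE order.strict_iff_not)
  qed
  \<comment> \<open>The order of \<open>E x\<close> cannot lie below \<open>\<tau> b\<close>, since
    both \<open>E y\<close> and, by \<open>lip\<close>, the change \<open>E y - E x\<close> vanish
    there.\<close>
  have LI: "L x y b" if "x \<in> X" "y \<in> X" "b \<in> B" "coef (E x) (\<tau> b) \<noteq> 0" "hsupp (y - x) \<subseteq> {b..}"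
    "hsupp (E y) \<subseteq> {\<tau> b<..}" for x y b
  proof -
    have "hsupp (E y) \<subseteq> {\<tau> b..}" using that(6) by auto
    moreover have "hsupp (E y - E x) \<subseteq> {\<tau> b..}" using lip that by blast
    ultimately have "hsupp (E y - (E y - E x)) \<subseteq> {\<tau> b..}" by (rule hsupp_diff)
    then show ?thesis using that by (simp add: L_def K_def)
  qed
  have L_step: "b < c" if "L x y b" "K y c" for x y b c
  proof -
    have "\<tau> b < \<tau> c" using that by (auto simp: L_def K_def in_hsupp[symmetric])
    then show ?thesis using that mono' by (auto simp: L_def K_def)
  qed
  have L_trans: "L x z b" if "L x y b" "L y z c" for x y z b c
  proof -
    have bc: "b < c" using L_step[OF that(1)] that(2) unfolding L_def by blast
    have "\<tau> b < \<tau> c" using bc mono that by (auto simp: L_def K_def)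
    have "hsupp (z - y) \<subseteq> {b..}" using that(2) bc by (auto simp: L_def)
    then have "hsupp ((z - y) + (y - x)) \<subseteq> {b..}" using that(1) by (intro hsupp_add) (auto simp: L_def)
    then show ?thesis using that \<open>\<tau> b < \<tau> c\<close> by (auto simp: L_def)
  qed
  have L_anti: False if "L x y b" "L y x c" for x y b c
  proof -
    have "b < c" using L_step[OF that(1)] that(2) unfolding L_def by blast
    moreover have "c < b" using L_step[OF that(2)] that(1) unfolding L_def by blast
    ultimately show False by simp
  qed
  have "\<exists>m\<in>X. \<forall>a\<in>X. P m a \<longrightarrow> a = m"
  proof (rule predicate_Zorn)
    show "partial_order_on X (relation_of P X)"
    proof (rule partial_order_on_relation_ofI)
      show "P a a" for a by (simp add: P_def)
      show "P a c" if "P a b" "P b c" for a b c using that L_trans unfolding P_def by blast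
      show "a = b" if "P a b" "P b a" for a b using that L_anti unfolding P_def by blast
    qed
    fix C assume "C \<in> Chains (relation_of P X)"
    then have CX: "C \<subseteq> X" and chain: "\<And>x y. x \<in> C \<Longrightarrow> y \<in> C \<Longrightarrow> P x y \<or> P y x"
      unfolding Chains_def relation_of_def by auto
    show "\<exists>u\<in>X. \<forall>a\<in>C. P a u"
    \<comment> \<open>A chain with a last element is bounded by it. Otherwise every member has a
      strict successor and a limit must be glued; for the empty chain this limit is 0.\<close>
    proof (cases "\<exists>x\<in>C. \<not> (\<exists>y\<in>C. \<exists>b. L x y b)")
      case True
      then obtain x where x: "x \<in> C" "\<not> (\<exists>y\<in>C. \<exists>b. L x y b)" by blast
      then have "\<forall>a\<in>C. P a x" using chain unfolding P_def by blast
      then show ?thesis using x CX by blast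
    next
      case False
      then have next_ex: "\<And>x. x \<in> C \<Longrightarrow> \<exists>y\<in>C. \<exists>b. L x y b" by blast
      \<comment> \<open>\<open>W m x\<close> marks the coefficient of \<open>x\<close> at
        \<open>m\<close> as final: later members of the chain differ from \<open>x\<close> only from
        an index \<open>b > m\<close> on.\<close>
      define W where "W m x \<longleftrightarrow> x \<in> C \<and> (\<exists>b. K x b \<and> m < b)" for m x
      define G where "G m = (if \<exists>x. W m x then coef (SOME x. W m x) m else 0)" for m
      have agree: "coef x m = coef y m" if "K x b" "m < b" "L x y c" for x y b c m
      proof -
        have "c = b" using K_uniq that by (auto simp: L_def)
        then have "m \<notin> hsupp (y - x)" using that by (auto simp: L_def)
        then show ?thesis by (simp add: in_hsupp)
      qed
      have G: "G m = coef x m" if "W m x" for m x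
      proof -
        define x' where "x' = (SOME x. W m x)"
        have x': "W m x'" unfolding x'_def using that by (rule someI)
        have "P x x' \<or> P x' x" using that x' chain by (simp add: W_def)
        then have "coef x m = coef x' m"
          using agree that x' unfolding P_def W_def by metis
        moreover have "G m = coef x' m" using that unfolding G_def x'_def by auto
        ultimately show ?thesis by simp
      qed
      have "wo {m. G m \<noteq> 0}"
        unfolding wo_def
      proof (intro allI impI)
        fix T assume T: "T \<subseteq> {m. G m \<noteq> 0}" "T \<noteq> {}"
        then obtain t where t: "t \<in> T" by blast
        then obtain x b where x: "x \<in> C" "K x b" "t < b" using T unfolding G_def W_def by (auto split: if_splits)
        \<comment> \<open>Up to a given exponent \<open>t\<close> a single member already has all
          final coefficients, so well-ordering is inherited from its support.\<close>
        have "T \<inter> {..t} \<subseteq> hsupp x"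
        proof
          fix m assume m: "m \<in> T \<inter> {..t}"
          then have "W m x" using x by (auto simp: W_def)
          then show "m \<in> hsupp x" using G m T by (auto simp: in_hsupp)
        qed
        then have "wo (T \<inter> {..t})" by (rule wo_subset[OF wo_hsupp])
        then obtain a where a: "a \<in> T \<inter> {..t}" "\<And>y. y \<in> T \<inter> {..t} \<Longrightarrow> a \<le> y"
          by (rule wo_min[of _ t]) (use t in auto)
        have "\<forall>y\<in>T. a \<le> y"
        proof
          fix y assume "y \<in> T"
          then show "a \<le> y" using a by (cases "y \<le> t") auto
        qed
        then show "\<exists>x\<in>T. \<forall>y\<in>T. x \<le> y" using a(1) by blast
      qed
      then have cG: "coef (Abs_hahn G) = G" by (rule coef_Abs)
      have "coef (Abs_hahn G) m \<in> A m" for m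
      proof (cases "\<exists>x. W m x")
        case True
        then obtain x where "W m x" by blast
        moreover from this have "x \<in> X" using CX by (auto simp: W_def)
        ultimately show ?thesis using G by (auto simp: cG X_def)
      qed (simp add: cG G_def A0)
      then have GX: "Abs_hahn G \<in> X" by (simp add: X_def)
      have near: "hsupp (Abs_hahn G - x) \<subseteq> {b..}" if "x \<in> C" "K x b" for x b
      proof
        fix m assume "m \<in> hsupp (Abs_hahn G - x)"
        then have "G m \<noteq> coef x m" by (simp add: in_hsupp cG)
        then have "\<not> W m x" using G by blast
        then show "m \<in> {b..}" using that by (auto simp: W_def not_less)
      qed
      have "P x (Abs_hahn G)" if x: "x \<in> C" for x
      proof -
        \<comment> \<open>Closeness of the limit to \<open>x\<close> alone only bounds its residual
          by \<open>\<tau> b\<close>. Comparison with the successor \<open>y\<close>, whose index is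
          \<open>c > b\<close>, gives the strict improvement.\<close>
        obtain y b where y: "y \<in> C" "L x y b" using next_ex[OF x] by blast
        obtain z c where z: "z \<in> C" "L y z c" using next_ex[OF y(1)] by blast
        have Kx: "K x b" and Ky: "K y c" using y z by (auto simp: L_def)
        have bc: "b < c" using L_step[OF y(2) Ky] .
        have "hsupp (E (Abs_hahn G) - E y) \<subseteq> {\<tau> c..}"
          using lip[OF GX _ _ near[OF y(1) Ky]] CX y(1) Ky by (auto simp: K_def)
        then have "hsupp (E (Abs_hahn G) - E y + E y) \<subseteq> {\<tau> c..}"
          by (rule hsupp_add) (use Ky in \<open>simp add: K_def\<close>)
        moreover have "\<tau> b < \<tau> c" using mono bc Kx Ky by (auto simp: K_def)
        ultimately have "hsupp (E (Abs_hahn G)) \<subseteq> {\<tau> b<..}" by auto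
        then have "L x (Abs_hahn G) b" using Kx near[OF x Kx] by (simp add: L_def)
        then show ?thesis unfolding P_def by blast
      qed
      then show ?thesis using GX by blast
    qed
  qed
  then obtain x where x: "x \<in> X" "\<And>a. a \<in> X \<Longrightarrow> P x a \<Longrightarrow> a = x" by blast
  have "E x = 0"
  proof (rule ccontr)
    assume "E x \<noteq> 0"
    then obtain b y where b: "b \<in> B" "y \<in> X" "coef (E x) (\<tau> b) \<noteq> 0" "hsupp (y - x) \<subseteq> {b..}" "hsupp (E y) \<subseteq> {\<tau> b<..}"
      using improve[OF x(1)] by blast
    then have "L x y b" using LI x(1) by blast
    then have "y = x" using x(2) b(2) unfolding P_def by blast
    then show False using b by (auto simp: in_hsupp[symmetric])
  qed
  then show ?thesis using x(1) by blast
qed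

lemma hsupp_min:
  assumes "x \<noteq> 0"
  obtains b where "coef x b \<noteq> 0" "hsupp x \<subseteq> {b..}"
proof -
  obtain a where "a \<in> hsupp x" using assms by (metis coef_zero hahn_eqI in_hsupp)
  then obtain b where "b \<in> hsupp x" "\<And>y. y \<in> hsupp x \<Longrightarrow> b \<le> y"
    by (rule wo_min[OF wo_hsupp]) auto
  then have "coef x b \<noteq> 0" "hsupp x \<subseteq> {b..}" by (auto simp: in_hsupp)
  then show ?thesis by (rule that)
qed

section \<open>Products without cancellation and Neumann's lemma\<close>

lemma coef_mult_nonneg:
  assumes "\<And>m. coef x m \<ge> 0" "\<And>m. coef y m \<ge> 0"
  shows "coef (x * y) m \<ge> 0"
  unfolding coef_mult Sum_any.expand_set using assms by (intro sum_nonneg) simp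

text \<open>Nonnegative terms cannot cancel, so every sum of two exponents survives in the product.
  The gap between 0 and 1 is what later allows terms to be counted.\<close>

lemma coef_mult_ge_1:
  assumes x: "\<And>m. coef x m = 0 \<or> coef x m \<ge> 1" and y: "\<And>m. coef y m = 0 \<or> coef y m \<ge> 1"
    and "coef x a \<noteq> 0" "coef y b \<noteq> 0"
  shows "coef (x * y) (a + b) \<ge> 1"
proof -
  let ?A = "{c. coef x c * coef y (a + b - c) \<noteq> 0}"
  have nn: "coef x c \<ge> 0" "coef y c \<ge> 0" for c using x[of c] y[of c] by auto
  have "1 * 1 \<le> coef x a * coef y b" using x[of a] y[of b] assms(3,4) by (intro mult_mono) auto
  also have "\<dots> \<le> (\<Sum>c\<in>?A. coef x c * coef y (a + b - c))"
    using assms(3,4) nn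
      member_le_sum[OF _ _ finite_mult_index, of a x y "a + b" "\<lambda>c. coef x c * coef y (a + b - c)"] by simp
  finally show ?thesis by (simp add: coef_mult Sum_any.expand_set)
qed

lemma coef_mult_0_or_ge_1:
  assumes x: "\<And>m. coef x m = 0 \<or> coef x m \<ge> 1" and y: "\<And>m. coef y m = 0 \<or> coef y m \<ge> 1"
  shows "coef (x * y) m = 0 \<or> coef (x * y) m \<ge> 1"
proof (cases "m \<in> hsupp (x * y)")
  case True
  then obtain a b where "m = a + b" "coef x a \<noteq> 0" "coef y b \<noteq> 0"
    using hsupp_mult[of x y] by (auto simp: in_hsupp)
  then show ?thesis using coef_mult_ge_1[OF x y] by blast
qed (simp add: in_hsupp)

text \<open>Neumann's lemma. With p the indicator series of P, completeness yields a series y with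
  nonnegative coefficients and y = 1 + p y; it dominates every power of p, so its support contains
  all sums of elements of P and its coefficients bound the number of lengths of such sums.\<close>

lemma neumann:
  fixes P :: "'a::linordered_ab_group_add set"
  assumes "wo P" "P \<subseteq> {0<..}"
  obtains S and N :: "'a \<Rightarrow> nat" where "wo S"
    "\<And>x y i j. hsupp x \<subseteq> P \<Longrightarrow> hsupp y \<subseteq> P \<Longrightarrow> hsupp (x ^ i * y ^ j) \<subseteq> S"
    "\<And>x y i j m. hsupp x \<subseteq> P \<Longrightarrow> hsupp y \<subseteq> P \<Longrightarrow> coef (x ^ i * y ^ j) m \<noteq> 0 \<Longrightarrow> i + j \<le> N m"
proof -
  define p where "p = Abs_hahn (\<lambda>m. if m \<in> P then 1 else 0)"
  have cp: "coef p m = (if m \<in> P then 1 else 0)" for m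
  proof -
    have "{m. (if m \<in> P then 1 else (0::real)) \<noteq> 0} = P" by auto
    then show ?thesis unfolding p_def using assms(1) by (subst coef_Abs) simp_all
  qed
  have sp: "hsupp p = P" by (auto simp: in_hsupp cp split: if_splits)
  have pos: "hsupp (p * x) \<subseteq> {b<..}" if "hsupp x \<subseteq> {b..}" for x b
    by (rule hsupp_mult_subset[OF _ that, of _ "{0<..}"])
      (use sp assms(2) in \<open>auto intro: add_strict_increasing\<close>)
  have "\<exists>y\<in>{y. \<forall>m. coef y m \<in> {0..}}. y - (1 + p * y) = 0"
  proof (rule hahn_zero_by_approximation[where B = UNIV and \<tau> = "\<lambda>b. b"])
    fix x y :: "'a hahn" and b
    assume "hsupp (x - y) \<subseteq> {b..}"
    then have "hsupp ((x - y) - p * (x - y)) \<subseteq> {b..}" by (rule hsupp_diff) (use pos[of "x - y" b] \<open>hsupp (x - y) \<subseteq> {b..}\<close> in auto)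
    then show "hsupp (x - (1 + p * x) - (y - (1 + p * y))) \<subseteq> {b..}" by (simp add: algebra_simps)
  next
    \<comment> \<open>The improved approximation is \<open>1 + p * x\<close>: its residual is
      \<open>p\<close> times the old one, hence of larger order, and its coefficients remain
      nonnegative.\<close>
    fix x assume x: "x \<in> {y. \<forall>m. coef y m \<in> {0..}}" and nz: "x - (1 + p * x) \<noteq> 0"
    obtain b where b: "coef (x - (1 + p * x)) b \<noteq> 0" "hsupp (x - (1 + p * x)) \<subseteq> {b..}" using hsupp_min[OF nz] by blast
    have "coef (p * x) m \<ge> 0" for m by (rule coef_mult_nonneg) (use x cp in auto)
    then have "1 + p * x \<in> {y. \<forall>m. coef y m \<in> {0..}}" by (simp add: coef_one)
    moreover have "hsupp (1 + p * x - x) \<subseteq> {b..}"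
      using b(2) hsupp_minus[of "x - (1 + p * x)"] by simp
    moreover have "hsupp (1 + p * x - (1 + p * (1 + p * x))) \<subseteq> {b<..}"
      using pos[OF b(2)] by (simp add: algebra_simps)
    ultimately show "\<exists>b\<in>UNIV. \<exists>y\<in>{y. \<forall>m. coef y m \<in> {0..}}. coef (x - (1 + p * x)) b \<noteq> 0 \<and>
        hsupp (y - x) \<subseteq> {b..} \<and> hsupp (y - (1 + p * y)) \<subseteq> {b<..}"
      using b(1) by blast
  qed auto
  then obtain y where y0: "\<And>m. coef y m \<ge> 0" and y: "y = 1 + p * y" by auto
  have pp: "coef (p ^ i) m = 0 \<or> coef (p ^ i) m \<ge> 1" for i m
  proof (induction i arbitrary: m)
    case (Suc i)
    have "coef p m = 0 \<or> coef p m \<ge> 1" for m by (simp add: cp)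
    from coef_mult_0_or_ge_1[OF this Suc] show ?case by simp
  qed (simp add: coef_one)
  have pp0: "coef (p ^ i) m \<ge> 0" for i m using pp[of i m] by auto
  \<comment> \<open>Unfolding the fixed point equation \<open>n\<close> times isolates the first
    \<open>n\<close> powers of \<open>p\<close>; the remainder has nonnegative coefficients, so
    \<open>y\<close> dominates their sum.\<close>
  have ysum: "y = (\<Sum>i<n. p ^ i) + p ^ n * y" for n
  proof (induction n)
    case (Suc n)
    have "y = (\<Sum>i<n. p ^ i) + p ^ n * (1 + p * y)" using Suc y by metis
    then show ?case by (simp add: algebra_simps)
  qed simp
  have csum: "coef (\<Sum>i\<in>I. p ^ i) m = (\<Sum>i\<in>I. coef (p ^ i) m)" for I :: "nat set" and m
    by (induction I rule: infinite_finite_induct) simp_all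
  have ybound: "(\<Sum>i<n. coef (p ^ i) m) \<le> coef y m" for n m
  proof -
    have "coef y m = (\<Sum>i<n. coef (p ^ i) m) + coef (p ^ n * y) m"
      by (subst ysum[of n]) (simp add: csum)
    then show ?thesis using coef_mult_nonneg[OF pp0 y0] by simp
  qed
  have sub: "hsupp (p ^ n) \<subseteq> hsupp y" for n
  proof
    fix m assume "m \<in> hsupp (p ^ n)"
    then have "1 \<le> coef (p ^ n) m" using pp by (auto simp: in_hsupp)
    also have "\<dots> \<le> (\<Sum>i<Suc n. coef (p ^ i) m)" using pp0 by (intro member_le_sum) auto
    also have "\<dots> \<le> coef y m" by (rule ybound)
    finally show "m \<in> hsupp y" by (simp add: in_hsupp)
  qed
  \<comment> \<open>Every power of \<open>p\<close> that reaches \<open>m\<close> contributes at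
    least 1 to the coefficient of \<open>y\<close> there, so this coefficient bounds their
    number.\<close>
  have fin: "finite {n. coef (p ^ n) m \<noteq> 0}" for m
  proof (rule ccontr)
    assume "infinite {n. coef (p ^ n) m \<noteq> 0}"
    then obtain T where T: "T \<subseteq> {n. coef (p ^ n) m \<noteq> 0}" "finite T" "card T = Suc (nat \<lceil>coef y m\<rceil>)"
      using infinite_arbitrarily_large by blast
    obtain n where n: "T \<subseteq> {..<n}" using T(2) finite_nat_set_iff_bounded by fastforce
    have "real (card T) = (\<Sum>i\<in>T. 1)" by simp
    also have "\<dots> \<le> (\<Sum>i\<in>T. coef (p ^ i) m)" using T(1) pp by (intro sum_mono) auto
    also have "\<dots> \<le> (\<Sum>i<n. coef (p ^ i) m)" using n pp0 by (intro sum_mono2) auto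
    also have "\<dots> \<le> coef y m" by (rule ybound)
    finally have "real (Suc (nat \<lceil>coef y m\<rceil>)) \<le> coef y m" using T(3) by simp
    then show False by linarith
  qed
  define N where "N m = Max {n. coef (p ^ n) m \<noteq> 0}" for m
  have mult_sub: "hsupp (x * z) \<subseteq> hsupp (p ^ (i + j))" if "hsupp x \<subseteq> hsupp (p ^ i)" "hsupp z \<subseteq> hsupp (p ^ j)" for x z i j
  proof
    fix m assume "m \<in> hsupp (x * z)"
    then obtain a b where ab: "m = a + b" "a \<in> hsupp x" "b \<in> hsupp z" using hsupp_mult[of x z] by blast
    then have "coef (p ^ i * p ^ j) (a + b) \<ge> 1" using that by (intro coef_mult_ge_1 pp) (auto simp: in_hsupp)
    then show "m \<in> hsupp (p ^ (i + j))" by (simp add: ab in_hsupp power_add)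
  qed
  have pow_sub: "hsupp (x ^ i) \<subseteq> hsupp (p ^ i)" if "hsupp x \<subseteq> P" for x i
  proof (induction i)
    case (Suc i)
    have "hsupp x \<subseteq> hsupp (p ^ 1)" using that sp by simp
    from mult_sub[OF this Suc] show ?case by simp
  qed simp
  have prod_sub: "hsupp (x ^ i * z ^ j) \<subseteq> hsupp (p ^ (i + j))" if "hsupp x \<subseteq> P" "hsupp z \<subseteq> P" for x z i j
    using that by (intro mult_sub pow_sub)
  show ?thesis
  proof (rule that[of "hsupp y" N])
    show "wo (hsupp y)" by simp
    show "hsupp (x ^ i * z ^ j) \<subseteq> hsupp y" if "hsupp x \<subseteq> P" "hsupp z \<subseteq> P" for x z i j
      using prod_sub[OF that] sub by blast
    show "i + j \<le> N m" if "hsupp x \<subseteq> P" "hsupp z \<subseteq> P" "coef (x ^ i * z ^ j) m \<noteq> 0" for x z i j m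
    proof -
      have "m \<in> hsupp (p ^ (i + j))" using prod_sub[OF that(1,2)] that(3) by (meson in_hsupp subsetD)
      then show ?thesis unfolding N_def by (intro Max_ge fin) (simp add: in_hsupp)
    qed
  qed
qed

section \<open>Substitution into power series\<close>

definition infinitesimal :: "'a::linordered_ab_group_add hahn \<Rightarrow> bool" where
  "infinitesimal x \<longleftrightarrow> hsupp x \<subseteq> {0<..}"

lemma infinitesimal_closure [simp, intro]:
  "infinitesimal 0" "infinitesimal x \<Longrightarrow> infinitesimal (- x)"
  "infinitesimal x \<Longrightarrow> infinitesimal y \<Longrightarrow> infinitesimal (x + y)"
  "infinitesimal x \<Longrightarrow> infinitesimal y \<Longrightarrow> infinitesimal (x - y)"
  "infinitesimal x \<Longrightarrow> infinitesimal (c *\<^sub>R x)"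
  by (simp_all add: infinitesimal_def hsupp_add hsupp_diff hsupp_scaleR)

lemma infinitesimal_sum: "(\<And>i. i \<in> I \<Longrightarrow> infinitesimal (f i)) \<Longrightarrow> infinitesimal (sum f I)"
  by (simp add: infinitesimal_def hsupp_sum)

lemma infinitesimal_coef_0: "infinitesimal x \<Longrightarrow> coef x 0 = 0"
  unfolding infinitesimal_def using in_hsupp[of 0 x] by blast

lemma coef_sum: "coef (\<Sum>i\<in>I. f i) m = (\<Sum>i\<in>I. coef (f i) m)"
  by (induction I rule: infinite_finite_induct) simp_all

text \<open>Bounding the total degree in two infinitesimals prepares products of two power series:
  coefficient identities become finite sums over a triangle.\<close>

lemma power_length_bound:
  assumes "infinitesimal x" "infinitesimal y"
  obtains N where "\<forall>i j. N < i + j \<longrightarrow> coef (x ^ i * y ^ j) m = 0"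
proof -
  have "wo (hsupp x \<union> hsupp y)" "hsupp x \<union> hsupp y \<subseteq> {0<..}"
    using assms by (auto simp: infinitesimal_def intro: wo_Un)
  then show ?thesis
  proof (rule neumann)
    fix N :: "'a \<Rightarrow> nat"
    assume N: "\<And>x' y' i j m. hsupp x' \<subseteq> hsupp x \<union> hsupp y \<Longrightarrow> hsupp y' \<subseteq> hsupp x \<union> hsupp y \<Longrightarrow>
       coef (x' ^ i * y' ^ j) m \<noteq> 0 \<Longrightarrow> i + j \<le> N m"
    have "\<forall>i j. N m < i + j \<longrightarrow> coef (x ^ i * y ^ j) m = 0" using N[of x y _ _ m] by (metis Un_upper1 Un_upper2 not_le)
    then show thesis by (rule that)
  qed
qed

lemma power_bound:
  assumes "infinitesimal x" obtains N where "\<forall>i>N. coef (x ^ i) m = 0"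
proof -
  obtain N where N: "\<forall>i j. N < i + j \<longrightarrow> coef (x ^ i * x ^ j) m = 0"
    by (rule power_length_bound[OF assms assms])
  have "\<forall>i>N. coef (x ^ i) m = 0" using N[rule_format, of _ 0] by simp
  then show ?thesis by (rule that)
qed

lemma power_summable:
  assumes "infinitesimal x" shows "hsummable (\<lambda>i. c i *\<^sub>R x ^ i)"
proof -
  obtain S where S: "wo S" "\<And>y z i j. hsupp y \<subseteq> hsupp x \<Longrightarrow> hsupp z \<subseteq> hsupp x \<Longrightarrow> hsupp (y ^ i * z ^ j) \<subseteq> S"
    by (rule neumann[OF wo_hsupp[of x]]) (use assms in \<open>auto simp: infinitesimal_def\<close>)
  show ?thesis
  proof (rule hsummableI[OF S(1)])
    show "hsupp (c i *\<^sub>R x ^ i) \<subseteq> S" for i using S(2)[of x x i 0] by (simp add: hsupp_scaleR)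
    fix m
    obtain N where "\<forall>i>N. coef (x ^ i) m = 0" by (rule power_bound[OF assms])
    then have "{i. coef (c i *\<^sub>R x ^ i) m \<noteq> 0} \<subseteq> {..N}" by (auto simp: not_less[symmetric])
    then show "finite {i. coef (c i *\<^sub>R x ^ i) m \<noteq> 0}" by (rule finite_subset) simp
  qed
qed

definition fsub :: "real fps \<Rightarrow> 'a::linordered_ab_group_add hahn \<Rightarrow> 'a hahn" where
  "fsub F x = hsum (\<lambda>i. fps_nth F i *\<^sub>R x ^ i)"

lemma coef_fsub:
  assumes "infinitesimal x" "\<forall>i>N. coef (x ^ i) m = 0"
  shows "coef (fsub F x) m = (\<Sum>i\<le>N. fps_nth F i * coef (x ^ i) m)"
proof -
  have "coef (fsub F x) m = Sum_any (\<lambda>i. fps_nth F i * coef (x ^ i) m)"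
    by (simp only: fsub_def coef_hsum[OF power_summable[OF assms(1)]] coef_scaleR)
  also have "\<dots> = (\<Sum>i\<le>N. fps_nth F i * coef (x ^ i) m)"
    by (rule Sum_any.expand_superset) (use assms(2) in \<open>auto simp: not_less[symmetric]\<close>)
  finally show ?thesis .
qed

lemma fsub_linear:
  assumes "infinitesimal x"
  shows "fsub (F + G) x = fsub F x + fsub G x" "fsub (F - G) x = fsub F x - fsub G x"
    "fsub (fps_const c * F) x = c *\<^sub>R fsub F x" "fsub 1 x = 1" "fsub fps_X x = x"
proof -
  note c = coef_fsub[OF assms]
  show "fsub (F + G) x = fsub F x + fsub G x"
  proof (rule hahn_eqI)
    fix m obtain N where N: "\<forall>i>N. coef (x ^ i) m = 0" by (rule power_bound[OF assms])
    then show "coef (fsub (F + G) x) m = coef (fsub F x + fsub G x) m"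
      by (simp add: c[OF N] sum.distrib algebra_simps)
  qed
  show "fsub (F - G) x = fsub F x - fsub G x"
  proof (rule hahn_eqI)
    fix m obtain N where N: "\<forall>i>N. coef (x ^ i) m = 0" by (rule power_bound[OF assms])
    then show "coef (fsub (F - G) x) m = coef (fsub F x - fsub G x) m"
      by (simp add: c[OF N] sum_subtractf algebra_simps)
  qed
  show "fsub (fps_const c * F) x = c *\<^sub>R fsub F x"
  proof (rule hahn_eqI)
    fix m obtain N where N: "\<forall>i>N. coef (x ^ i) m = 0" by (rule power_bound[OF assms])
    then show "coef (fsub (fps_const c * F) x) m = coef (c *\<^sub>R fsub F x) m"
      by (simp add: c[OF N] sum_distrib_left algebra_simps)
  qed
  show "fsub 1 x = 1"
  proof (rule hahn_eqI)
    fix m obtain N where N: "\<forall>i>N. coef (x ^ i) m = 0" by (rule power_bound[OF assms])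
    have "(\<Sum>i\<le>N. fps_nth 1 i * coef (x ^ i) m) = (\<Sum>i\<le>N. if i = 0 then coef 1 m else 0)"
      by (intro sum.cong refl) auto
    then show "coef (fsub 1 x) m = coef 1 m" by (simp add: c[OF N])
  qed
  show "fsub fps_X x = x"
  proof (rule hahn_eqI)
    fix m obtain N where N: "\<forall>i>N. coef (x ^ i) m = 0" by (rule power_bound[OF assms])
    then have N': "\<forall>i>Suc N. coef (x ^ i) m = 0" by simp
    have "(\<Sum>i\<le>Suc N. fps_nth fps_X i * coef (x ^ i) m) = (\<Sum>i\<le>Suc N. if i = 1 then coef x m else 0)"
      by (intro sum.cong refl) auto
    also have "\<dots> = coef x m" by (subst sum.delta) auto
    finally show "coef (fsub fps_X x) m = coef x m" by (simp only: c[OF N'])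
  qed
qed

lemma sum_square_triangle:
  fixes N :: nat
  assumes "\<And>i j. i + j > N \<Longrightarrow> g i j = (0::real)"
  shows "(\<Sum>i\<le>N. \<Sum>j\<le>N. g i j) = (\<Sum>n\<le>N. \<Sum>i\<le>n. g i (n - i))"
proof -
  have "(\<Sum>i\<le>N. \<Sum>j\<le>N. g i j) = (\<Sum>(i,j)\<in>{..N} \<times> {..N}. g i j)"
    by (rule sum.cartesian_product)
  also have "\<dots> = (\<Sum>(i,j)\<in>{(i,j). i + j \<le> N}. g i j)"
    by (rule sum.mono_neutral_right) (use assms in \<open>auto simp: not_less[symmetric]\<close>)
  also have "\<dots> = (\<Sum>n\<le>N. \<Sum>i\<le>n. g i (n - i))" by (rule sum.triangle_reindex_eq)
  finally show ?thesis .
qed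

lemma coef_fsub_mult:
  assumes "infinitesimal x" "infinitesimal y" "\<forall>i j. N < i + j \<longrightarrow> coef (x ^ i * y ^ j) m = 0"
  shows "coef (fsub F x * fsub G y) m = (\<Sum>i\<le>N. \<Sum>j\<le>N. fps_nth F i * fps_nth G j * coef (x ^ i * y ^ j) m)"
proof -
  have s1: "hsummable (\<lambda>j. fps_nth G j *\<^sub>R (x ^ i * y ^ j))" and e1: "x ^ i * fsub G y = hsum (\<lambda>j. fps_nth G j *\<^sub>R (x ^ i * y ^ j))" for i
    using strong_hsum[OF strong_mult_left[of "x ^ i"] power_summable[OF assms(2), of "fps_nth G"]]
    by (simp_all add: fsub_def)
  have c1: "coef (x ^ i * fsub G y) m = (\<Sum>j\<le>N. fps_nth G j * coef (x ^ i * y ^ j) m)" for i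
  proof -
    have "coef (x ^ i * fsub G y) m = Sum_any (\<lambda>j. fps_nth G j * coef (x ^ i * y ^ j) m)"
      by (simp only: e1 coef_hsum[OF s1] coef_scaleR)
    also have "\<dots> = (\<Sum>j\<le>N. fps_nth G j * coef (x ^ i * y ^ j) m)"
      by (rule Sum_any.expand_superset) (use assms(3) in \<open>auto simp: not_less[symmetric]\<close>)
    finally show ?thesis .
  qed
  have s2: "hsummable (\<lambda>i. fps_nth F i *\<^sub>R (x ^ i * fsub G y))" and e2: "fsub F x * fsub G y = hsum (\<lambda>i. fps_nth F i *\<^sub>R (x ^ i * fsub G y))"
    using strong_hsum[OF strong_mult_right[of "fsub G y"] power_summable[OF assms(1), of "fps_nth F"]]
    by (simp_all add: fsub_def[of F])
  have "coef (fsub F x * fsub G y) m = Sum_any (\<lambda>i. fps_nth F i * coef (x ^ i * fsub G y) m)"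
    by (simp only: e2 coef_hsum[OF s2] coef_scaleR)
  also have "\<dots> = (\<Sum>i\<le>N. fps_nth F i * coef (x ^ i * fsub G y) m)"
  proof (rule Sum_any.expand_superset)
    show "{i. fps_nth F i * coef (x ^ i * fsub G y) m \<noteq> 0} \<subseteq> {..N}"
    proof
      fix i assume i: "i \<in> {i. fps_nth F i * coef (x ^ i * fsub G y) m \<noteq> 0}"
      show "i \<in> {..N}"
      proof (rule ccontr)
        assume "i \<notin> {..N}"
        then have "coef (x ^ i * fsub G y) m = 0" using assms(3) by (simp add: c1)
        then show False using i by simp
      qed
    qed
  qed simp
  finally show ?thesis by (simp add: c1 sum_distrib_left mult.assoc)
qed

lemma fsub_mult:
  assumes "infinitesimal x" shows "fsub (F * G) x = fsub F x * fsub G x"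
proof (rule hahn_eqI)
  fix m
  obtain N where N: "\<forall>i j. N < i + j \<longrightarrow> coef (x ^ i * x ^ j) m = 0"
    by (rule power_length_bound[OF assms assms])
  have N1: "\<forall>i>N. coef (x ^ i) m = 0" using N[rule_format, of _ 0] by simp
  have z: "coef (x ^ (i + j)) m = 0" if "i + j > N" for i j using N1 that by auto
  have "coef (fsub F x * fsub G x) m = (\<Sum>i\<le>N. \<Sum>j\<le>N. fps_nth F i * fps_nth G j * coef (x ^ (i + j)) m)"
    by (simp add: coef_fsub_mult[OF assms assms N] power_add)
  also have "\<dots> = (\<Sum>n\<le>N. \<Sum>i\<le>n. fps_nth F i * fps_nth G (n - i) * coef (x ^ (i + (n - i))) m)"
    by (rule sum_square_triangle) (simp add: z)
  also have "\<dots> = (\<Sum>n\<le>N. fps_nth (F * G) n * coef (x ^ n) m)"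
    by (intro sum.cong refl) (simp add: fps_mult_nth sum_distrib_right atMost_atLeast0)
  also have "\<dots> = coef (fsub (F * G) x) m" by (simp add: coef_fsub[OF assms N1])
  finally show "coef (fsub (F * G) x) m = coef (fsub F x * fsub G x) m" by simp
qed

lemma fsub_power:
  assumes "infinitesimal x" shows "fsub (F ^ n) x = fsub F x ^ n"
  by (induction n) (simp_all add: fsub_linear[OF assms] fsub_mult[OF assms])

lemma hsupp_fsub_closed:
  assumes "infinitesimal x" "hsupp x \<subseteq> A" "0 \<in> A" "\<And>a b. a \<in> A \<Longrightarrow> b \<in> A \<Longrightarrow> a + b \<in> A"
  shows "hsupp (fsub F x) \<subseteq> A"
proof -
  have "hsupp (fps_nth F i *\<^sub>R x ^ i) \<subseteq> A" for i
    by (intro hsupp_scaleR hsupp_power_subset assms)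
  then show ?thesis using hsupp_hsum[OF power_summable[OF assms(1), of "fps_nth F"]] unfolding fsub_def by blast
qed

lemma hsupp_fsub_subset:
  assumes "infinitesimal x" "fps_nth F 0 = 0" "hsupp x \<subseteq> A" "\<And>a b. a \<in> A \<Longrightarrow> b \<in> A \<Longrightarrow> a + b \<in> A"
  shows "hsupp (fsub F x) \<subseteq> A"
proof -
  have "hsupp (x ^ Suc i) \<subseteq> A" for i
  proof (induction i)
    case (Suc i)
    show ?case unfolding power_Suc[of x "Suc i"] by (rule hsupp_mult_subset[OF assms(3) Suc assms(4)])
  qed (use assms(3) in simp)
  then have "hsupp (fps_nth F i *\<^sub>R x ^ i) \<subseteq> A" for i
    by (cases i) (simp_all add: assms(2) hsupp_scaleR del: power_Suc)
  then show ?thesis using hsupp_hsum[OF power_summable[OF assms(1), of "fps_nth F"]] unfolding fsub_def by blast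
qed

lemma infinitesimal_fsub:
  assumes "infinitesimal x" "fps_nth F 0 = 0" shows "infinitesimal (fsub F x)"
  unfolding infinitesimal_def
  by (rule hsupp_fsub_subset[OF assms]) (use assms(1) in \<open>auto simp: infinitesimal_def intro: add_pos_pos\<close>)

text \<open>The recursion \<open>x ^ Suc i - y ^ Suc i = (x ^ i - y ^ i) * x + (x - y) * y ^
  i\<close> keeps every difference of powers in \<open>U\<close>, which absorbs nonnegative
  exponents.\<close>

lemma fsub_lipschitz:
  assumes "infinitesimal x" "infinitesimal y" "hsupp (x - y) \<subseteq> U" "\<And>a b. a \<in> U \<Longrightarrow> 0 \<le> b \<Longrightarrow> a + b \<in> U"
  shows "hsupp (fsub F x - fsub F y) \<subseteq> U"
proof -
  have pw: "hsupp (z ^ i) \<subseteq> {0..}" if "infinitesimal z" for z :: "'a hahn" and i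
    by (rule hsupp_power_subset) (use that in \<open>auto simp: infinitesimal_def\<close>)
  have "hsupp (x ^ i - y ^ i) \<subseteq> U" for i
  proof (induction i)
    case (Suc i)
    have "hsupp ((x ^ i - y ^ i) * x) \<subseteq> U"
      by (rule hsupp_mult_subset[OF Suc, of _ "{0..}"]) (use assms in \<open>auto simp: infinitesimal_def\<close>)
    moreover have "hsupp ((x - y) * y ^ i) \<subseteq> U"
      by (rule hsupp_mult_subset[OF assms(3) pw[OF assms(2)]]) (use assms(4) in auto)
    ultimately have "hsupp ((x ^ i - y ^ i) * x + (x - y) * y ^ i) \<subseteq> U" by (rule hsupp_add)
    then show ?case by (simp add: algebra_simps)
  qed simp
  then have "hsupp (fps_nth F i *\<^sub>R x ^ i - fps_nth F i *\<^sub>R y ^ i) \<subseteq> U" for i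
    by (simp only: scaleR_right_diff_distrib[symmetric] hsupp_scaleR)
  moreover note d = hsummable_diff[OF power_summable[OF assms(1), of "fps_nth F"] power_summable[OF assms(2), of "fps_nth F"]]
  ultimately show ?thesis using hsupp_hsum[OF d(1)] unfolding fsub_def d(2) by blast
qed

text \<open>Once the linear term is removed only powers of degree at least two remain, and
  \<open>c > 0\<close> pushes these strictly beyond \<open>c\<close>.\<close>

lemma fsub_leading:
  assumes "hsupp x \<subseteq> {c..}" "c > 0" "fps_nth F 0 = 0"
  shows "hsupp (fsub F x - fps_nth F 1 *\<^sub>R x) \<subseteq> {c<..}"
proof -
  define G where "G = F - fps_const (fps_nth F 1) * fps_X"
  have x: "infinitesimal x" using assms by (auto simp: infinitesimal_def)
  have eq: "fsub F x - fps_nth F 1 *\<^sub>R x = fsub G x" by (simp only: G_def fsub_linear[OF x])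
  have p: "hsupp (x ^ Suc i) \<subseteq> {c..}" for i
  proof (induction i)
    case (Suc i)
    show ?case unfolding power_Suc[of x "Suc i"]
      by (rule hsupp_mult_subset[OF assms(1) Suc]) (use assms(2) in \<open>auto intro: add_increasing2\<close>)
  qed (use assms(1) in simp)
  have p2: "hsupp (x ^ Suc (Suc i)) \<subseteq> {c<..}" for i
    unfolding power_Suc[of x "Suc i"]
  proof (rule hsupp_mult_subset[OF assms(1) p])
    fix a b assume "a \<in> {c..}" "b \<in> {c..}"
    then show "a + b \<in> {c<..}" using add_strict_increasing[of b c a] assms(2) by (auto simp: add.commute)
  qed
  have "hsupp (fps_nth G i *\<^sub>R x ^ i) \<subseteq> {c<..}" for i
  proof -
    consider "i = 0" | "i = 1" | j where "i = Suc (Suc j)" by (metis One_nat_def not0_implies_Suc)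
    then show ?thesis
    proof cases
      case 3 then show ?thesis using p2[of j] by (simp only: hsupp_scaleR)
    qed (simp_all add: G_def assms(3))
  qed
  then show ?thesis using hsupp_hsum[OF power_summable[OF x, of "fps_nth G"]] unfolding eq by (simp only: fsub_def) blast
qed

lemma fsub_compose:
  assumes "infinitesimal x" "fps_nth G 0 = 0"
  shows "fsub F (fsub G x) = fsub (F oo G) x"
proof (rule hahn_eqI)
  fix m
  note y = infinitesimal_fsub[OF assms]
  obtain N where N: "\<forall>i>N. coef (x ^ i) m = 0" by (rule power_bound[OF assms(1)])
  obtain M where M: "\<forall>i>M. coef (fsub G x ^ i) m = 0" by (rule power_bound[OF y])
  \<comment> \<open>The maximum with \<open>N\<close> ensures that the truncated outer sum contains
    every \<open>i \<le> n \<le> N\<close> occurring in the composed power series.\<close>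
  have M': "\<forall>i>max M N. coef (fsub G x ^ i) m = 0" using M by simp
  have G0: "fps_nth (G ^ i) n = 0" if "n < i" for i n using startsby_zero_power_prefix[OF assms(2)] that by auto
  have "coef (fsub F (fsub G x)) m = (\<Sum>i\<le>max M N. fps_nth F i * coef (fsub (G ^ i) x) m)"
    by (simp only: coef_fsub[OF y M'] fsub_power[OF assms(1)])
  also have "\<dots> = (\<Sum>i\<le>max M N. \<Sum>n\<le>N. fps_nth F i * fps_nth (G ^ i) n * coef (x ^ n) m)"
    by (simp add: coef_fsub[OF assms(1) N] sum_distrib_left mult.assoc)
  also have "\<dots> = (\<Sum>n\<le>N. \<Sum>i\<le>max M N. fps_nth F i * fps_nth (G ^ i) n * coef (x ^ n) m)"
    by (rule sum.swap)
  also have "\<dots> = (\<Sum>n\<le>N. \<Sum>i\<le>n. fps_nth F i * fps_nth (G ^ i) n * coef (x ^ n) m)"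
    by (intro sum.cong refl sum.mono_neutral_right) (auto simp: G0)
  also have "\<dots> = coef (fsub (F oo G) x) m"
    by (simp add: coef_fsub[OF assms(1) N] fps_compose_nth sum_distrib_right atMost_atLeast0)
  finally show "coef (fsub F (fsub G x)) m = coef (fsub (F oo G) x) m" .
qed

lemma strong_fsub:
  assumes T: "strong T" and "\<And>x y. T (x * y) = T x * T y" "T 1 = 1" "infinitesimal x"
  shows "T (fsub F x) = fsub F (T x)"
proof -
  have "T (x ^ i) = T x ^ i" for i by (induction i) (simp_all add: assms)
  then show ?thesis
    unfolding fsub_def by (simp only: strong_hsum(2)[OF T power_summable[OF assms(4)]] strong_scaleR[OF T])
qed

section \<open>Exponential, logarithm and binomial series\<close>

definition hexp :: "'a::linordered_ab_group_add hahn \<Rightarrow> 'a hahn" where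
  "hexp x = fsub (fps_exp 1) x"

text \<open>The series of log (1 + x), as opposed to log x.\<close>
definition hlog :: "'a::linordered_ab_group_add hahn \<Rightarrow> 'a hahn" where
  "hlog x = fsub (fps_ln 1) x"

text \<open>With two unrelated infinitesimals this is not an identity between power series in one
  variable; each power of the sum is expanded binomially and the terms are regrouped by total
  degree.\<close>

lemma hexp_add:
  assumes "infinitesimal x" "infinitesimal y" shows "hexp (x + y) = hexp x * hexp y"
proof (rule hahn_eqI)
  fix m
  obtain N where N: "\<forall>i j. N < i + j \<longrightarrow> coef (x ^ i * y ^ j) m = 0"
    by (rule power_length_bound[OF assms])
  have cb: "coef ((x + y) ^ n) m = (\<Sum>k\<le>n. real (n choose k) * coef (x ^ k * y ^ (n - k)) m)" for n
  proof -
    have "(x + y) ^ n = (\<Sum>k\<le>n. real (n choose k) *\<^sub>R (x ^ k * y ^ (n - k)))"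
      unfolding binomial_ring by (simp add: scaleR_conv_of_real mult.assoc)
    then show ?thesis by (simp add: coef_sum)
  qed
  have N1: "\<forall>n>N. coef ((x + y) ^ n) m = 0" using N by (simp add: cb)
  have "coef (hexp x * hexp y) m = (\<Sum>i\<le>N. \<Sum>j\<le>N. 1 / fact i * (1 / fact j) * coef (x ^ i * y ^ j) m)"
    by (simp add: hexp_def coef_fsub_mult[OF assms N])
  also have "\<dots> = (\<Sum>n\<le>N. \<Sum>i\<le>n. 1 / fact i * (1 / fact (n - i)) * coef (x ^ i * y ^ (n - i)) m)"
    by (rule sum_square_triangle) (simp add: N)
  also have "\<dots> = (\<Sum>n\<le>N. 1 / fact n * coef ((x + y) ^ n) m)"
    by (intro sum.cong refl) (simp add: cb sum_distrib_left binomial_fact divide_simps)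
  also have "\<dots> = coef (hexp (x + y)) m"
    by (simp add: hexp_def coef_fsub[OF infinitesimal_closure(3)[OF assms] N1])
  finally show "coef (hexp (x + y)) m = coef (hexp x * hexp y) m" by simp
qed

lemma fps_exp_oo_ln: "fps_exp 1 oo fps_ln 1 = (1 + fps_X :: real fps)"
proof -
  have "(fps_exp 1 - 1) oo fps_inv (fps_exp 1 - 1) = (fps_X :: real fps)" by (rule fps_inv_right) auto
  then have "(fps_exp 1 - 1) oo fps_ln 1 = (fps_X :: real fps)" by (simp add: fps_ln_fps_exp_inv)
  then show ?thesis by (simp add: fps_compose_sub_distrib algebra_simps)
qed

lemma hexp_0 [simp]: "hexp 0 = 1"
proof (rule hahn_eqI)
  fix m :: 'a
  have "coef (hexp 0) m = (\<Sum>i\<le>0. fps_nth (fps_exp (1::real)) i * coef (0 ^ i) m)"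
    unfolding hexp_def by (rule coef_fsub) (auto simp: zero_power)
  then show "coef (hexp 0) m = coef 1 m" by simp
qed

lemma hexp_hlog: "infinitesimal x \<Longrightarrow> hexp (hlog x) = 1 + x"
  by (simp add: hexp_def hlog_def fsub_compose fps_exp_oo_ln fsub_linear)

lemma hlog_hexp:
  assumes "infinitesimal x" shows "hlog (hexp x - 1) = x"
proof -
  have "fps_ln 1 oo (fps_exp 1 - 1) = (fps_X :: real fps)"
    unfolding fps_ln_fps_exp_inv[OF one_neq_zero] by (rule fps_inv) auto
  moreover have "hexp x - 1 = fsub (fps_exp 1 - 1) x" using assms by (simp add: hexp_def fsub_linear)
  ultimately show ?thesis
    using assms fsub_compose[of x "fps_exp 1 - 1" "fps_ln 1"] by (simp only: hlog_def fsub_linear) simp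
qed

lemma infinitesimal_hlog [simp]: "infinitesimal x \<Longrightarrow> infinitesimal (hlog x)"
  unfolding hlog_def by (rule infinitesimal_fsub) auto

lemma infinitesimal_hexp_minus_1: 
  assumes "infinitesimal x" shows "infinitesimal (hexp x - 1)"
proof -
  have "hexp x - 1 = fsub (fps_exp 1 - 1) x" using assms by (simp add: hexp_def fsub_linear)
  then show ?thesis using infinitesimal_fsub[OF assms, of "fps_exp 1 - 1"] by simp
qed

lemma hlog_mult:
  assumes "infinitesimal x" "infinitesimal y" "1 + w = (1 + x) * (1 + y)"
  shows "hlog w = hlog x + hlog y"
proof -
  have "w = hexp (hlog x + hlog y) - 1"
    using assms by (simp add: hexp_add hexp_hlog algebra_simps)
  then show ?thesis using hlog_hexp[of "hlog x + hlog y"] assms(1,2) by simp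
qed

text \<open>The composite solves \<open>(1 + X) h' = a h\<close> with constant term 1, the initial
  value problem that characterises the binomial series.\<close>

lemma fps_binomial_exp_ln: "fps_binomial a = fps_exp 1 oo (fps_const a * fps_ln (1::real))"
proof -
  let ?g = "fps_const a * fps_ln (1::real)"
  let ?h = "fps_exp 1 oo ?g"
  have "fps_deriv ?h = (fps_deriv (fps_exp 1) oo ?g) * fps_deriv ?g" by (rule fps_compose_deriv) simp
  also have "\<dots> = fps_const a * ?h / (1 + fps_X)"
    by (simp add: fps_ln_deriv fps_divide_unit mult_ac)
  finally have "?h = fps_binomial a" using fps_binomial_ODE_unique'[of ?h a] by simp
  then show ?thesis by simp
qed

lemma fsub_binomial: "infinitesimal x \<Longrightarrow> fsub (fps_binomial a) x = hexp (a *\<^sub>R hlog x)"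
  by (simp add: hexp_def hlog_def fps_binomial_exp_ln fsub_compose[symmetric] fsub_linear)

section \<open>Logarithmic monomials and composition\<close>

text \<open>A type of its own, because class instances attach to type constructors and
  \<open>mon\<close> is a product. It carries the lexicographic order and the addition of
  exponents.\<close>

typedef lmon = "UNIV :: mon set" morphisms mexp Mon by simp

definition zdeg :: "lmon \<Rightarrow> real" where "zdeg a = fst (mexp a)"
definition ldeg :: "lmon \<Rightarrow> nat \<Rightarrow> int" where "ldeg a = snd (mexp a)"

lemma mexp_Mon [simp]: "mexp (Mon m) = m"
  by (simp add: Mon_inverse)

lemma Mon_mexp [simp]: "Mon (mexp a) = a"
  by (rule mexp_inverse)

lemma zdeg_Mon [simp]: "zdeg (Mon m) = fst m" and ldeg_Mon [simp]: "ldeg (Mon m) = snd m"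
  by (simp_all add: zdeg_def ldeg_def)

lemma Mon_inject' [simp]: "Mon a = Mon b \<longleftrightarrow> a = b"
  by (metis mexp_Mon)

lemma lmon_eqI: "zdeg a = zdeg b \<Longrightarrow> (\<And>i. ldeg a i = ldeg b i) \<Longrightarrow> a = b"
  by (metis Mon_mexp ext ldeg_def prod_eqI zdeg_def)

lemma lexless_irrefl: "\<not> lexless n n"
  by (simp add: lexless_def)

lemma lexless_trans:
  assumes "lexless a b" "lexless b c" shows "lexless a c"
proof -
  obtain i j where i: "\<forall>l<i. a l = b l" "a i < b i" and j: "\<forall>l<j. b l = c l" "b j < c j"
    using assms by (auto simp: lexless_def)
  have "(\<forall>l<min i j. a l = c l) \<and> a (min i j) < c (min i j)"
    using i j by (cases i j rule: linorder_cases) (auto simp: min_def)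
  then show ?thesis unfolding lexless_def by blast
qed

lemma lexless_linear: "lexless a b \<or> a = b \<or> lexless b a"
proof (cases "a = b")
  case False
  then have ex: "\<exists>i. a i \<noteq> b i" by (simp add: fun_eq_iff)
  define i where "i = (LEAST i. a i \<noteq> b i)"
  have "a i \<noteq> b i" "\<forall>j<i. a j = b j"
    unfolding i_def using LeastI_ex[OF ex] not_less_Least by auto
  then show ?thesis unfolding lexless_def by (metis linorder_neqE)
qed simp

instantiation lmon :: linordered_ab_group_add
begin

definition "0 = Mon (0, \<lambda>_. 0)"
definition "a + b = Mon (zdeg a + zdeg b, \<lambda>i. ldeg a i + ldeg b i)"
definition "a - b = Mon (zdeg a - zdeg b, \<lambda>i. ldeg a i - ldeg b i)"
definition "- a = Mon (- zdeg a, \<lambda>i. - ldeg a i)"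
definition "a < b \<longleftrightarrow> mless (mexp a) (mexp b)"
definition "a \<le> b \<longleftrightarrow> a = b \<or> mless (mexp a) (mexp b)"

lemma less_lmon_iff: "a < b \<longleftrightarrow> zdeg a < zdeg b \<or> zdeg a = zdeg b \<and> lexless (ldeg a) (ldeg b)"
  by (simp add: less_lmon_def mless_def zdeg_def ldeg_def)

lemma lmon_degs [simp]:
  "zdeg (a + b) = zdeg a + zdeg b" "ldeg (a + b) i = ldeg a i + ldeg b i"
  "zdeg (a - b) = zdeg a - zdeg b" "ldeg (a - b) i = ldeg a i - ldeg b i"
  "zdeg (- a) = - zdeg a" "ldeg (- a) i = - ldeg a i"
  "zdeg 0 = 0" "ldeg 0 i = 0"
  by (simp_all add: plus_lmon_def minus_lmon_def uminus_lmon_def zero_lmon_def)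

instance
proof
  fix a b c :: lmon
  have le: "a \<le> b \<longleftrightarrow> a = b \<or> a < b" for a b :: lmon by (simp add: less_lmon_def less_eq_lmon_def)
  have irr: "\<not> a < a" for a :: lmon by (simp add: less_lmon_iff lexless_irrefl)
  have tr: "a < b \<Longrightarrow> b < c \<Longrightarrow> a < c" for a b c :: lmon
    by (auto simp: less_lmon_iff intro: lexless_trans)
  show "a < b \<longleftrightarrow> a \<le> b \<and> \<not> b \<le> a" unfolding le using irr[of a] tr[of a b a] by auto
  show "a \<le> a" unfolding le by simp
  show "a \<le> b \<Longrightarrow> b \<le> c \<Longrightarrow> a \<le> c" unfolding le using tr[of a b c] by auto
  show "a \<le> b \<Longrightarrow> b \<le> a \<Longrightarrow> a = b" unfolding le using irr[of a] tr[of a b a] by auto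
  show "a \<le> b \<or> b \<le> a"
    unfolding le less_lmon_iff using lexless_linear[of "ldeg a" "ldeg b"] lmon_eqI[of a b] by force
  show "a + b + c = a + (b + c)" "a + b = b + a" "0 + a = a" "- a + a = 0" "a - b = a + - b"
    by (rule lmon_eqI; simp)+
  show "c + a \<le> c + b" if "a \<le> b"
  proof -
    have "c + a < c + b" if "a < b"
      using that by (auto simp: less_lmon_iff lexless_def)
    then show ?thesis using that unfolding le by auto
  qed
qed

end

text \<open>The factor z is kept apart: \<open>lones k\<close> is the exponent of l_1 ... l_k, so
  the bound of the theorem is \<open>lz + lones k\<close>. Indices are shifted,
  \<open>lell j\<close> belonging to l_(j+1).\<close>

definition lz :: lmon where "lz = Mon (1, \<lambda>_. 0)"
definition lell :: "nat \<Rightarrow> lmon" where "lell j = Mon (0, \<lambda>i. if i = j then 1 else 0)"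
definition lones :: "nat \<Rightarrow> lmon" where "lones k = Mon (0, \<lambda>i. if i < k then 1 else 0)"

lemma lmon_consts [simp]: "zdeg lz = 1" "ldeg lz i = 0" "zdeg (lell j) = 0" "ldeg (lell j) i = (if i = j then 1 else 0)"
  "zdeg (lones k) = 0" "ldeg (lones k) i = (if i < k then 1 else 0)"
  by (simp_all add: lz_def lell_def lones_def)

lemma lones_0 [simp]: "lones 0 = 0" and lones_Suc: "lones (Suc j) = lell j + lones j"
  by (rule lmon_eqI; simp)+

lemma lones_strict_mono: "i < j \<Longrightarrow> lones i < lones j"
  unfolding less_lmon_iff lexless_def by (intro disjI2 conjI exI[of _ i]) auto

lemma lones_mono: "i \<le> j \<Longrightarrow> lones i \<le> lones j"
  using lones_strict_mono[of i j] by (cases "i = j") auto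

lemma lones_nonneg [simp]: "0 \<le> lones j" using lones_mono[of 0 j] by simp
lemma lones_Suc_pos [simp]: "0 < lones (Suc j)" using lones_strict_mono[of 0 "Suc j"] by simp

text \<open>For g = c z exp(w) and l_0 = z this is log((l_j o g) / l_j), obtained from l_(j+1) = -1
  / log l_j. A constant term, \<open>ln c\<close>, occurs only at index 0; for infinitesimal w all
  later entries are infinitesimal.\<close>

fun hlam :: "real \<Rightarrow> lmon hahn \<Rightarrow> nat \<Rightarrow> lmon hahn" where
  "hlam c w 0 = ln c *\<^sub>R 1 + w"
| "hlam c w (Suc j) = - hlog (- (hmon (lell j) * hlam c w j))"

declare hlam.simps(2) [simp del]

text \<open>The logarithm of (b o g) / (c^a b) with a = \<open>zdeg b\<close>, cut off after
  \<open>K\<close> logarithms. Its additivity in \<open>b\<close> is what makes composition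
  multiplicative.\<close>

definition texp :: "nat \<Rightarrow> real \<Rightarrow> lmon hahn \<Rightarrow> lmon \<Rightarrow> lmon hahn" where
  "texp K c w b = zdeg b *\<^sub>R w + (\<Sum>j<K. real_of_int (ldeg b j) *\<^sub>R hlam c w (Suc j))"

definition qker :: "nat \<Rightarrow> real \<Rightarrow> lmon hahn \<Rightarrow> lmon \<Rightarrow> lmon hahn" where
  "qker K c w b = (c powr zdeg b) *\<^sub>R (hmon b * hexp (texp K c w b))"

text \<open>\<^term>\<open>cmp K c w x\<close> is x composed with c z exp(w), where the logarithms beyond the K-th are
  treated as constants; this agrees with composition on series of depth at most K.\<close>
definition cmp :: "nat \<Rightarrow> real \<Rightarrow> lmon hahn \<Rightarrow> lmon hahn \<Rightarrow> lmon hahn" where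
  "cmp K c w x = hsum (\<lambda>b. coef x b *\<^sub>R qker K c w b)"

section \<open>Strong linearity and multiplicativity of composition\<close>

lemma hsupp_hmon_mult: "hsupp x \<subseteq> {a..} \<Longrightarrow> hsupp (hmon b * x) \<subseteq> {b + a..}"
  by (rule hsupp_mult_subset[of _ "{b}"]) auto

lemma hsupp_lell_mult: "hsupp x \<subseteq> {lones j + d..} \<Longrightarrow> hsupp (hmon (lell j) * x) \<subseteq> {lones (Suc j) + d..}"
  using hsupp_hmon_mult[of x "lones j + d" "lell j"] by (simp add: lones_Suc add.assoc)

lemma hsupp_const_add: "infinitesimal w \<Longrightarrow> hsupp (c *\<^sub>R 1 + w) \<subseteq> {0..}"
  by (rule hsupp_add) (auto simp: infinitesimal_def in_hsupp coef_one split: if_splits)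

text \<open>Each recursion step contributes a factor l_(j+1), and \<open>hlog\<close> does not lower
  the order. The same bound makes the argument of the next logarithm infinitesimal.\<close>

lemma hsupp_hlam:
  assumes "infinitesimal w" shows "hsupp (hlam c w j) \<subseteq> {lones j..}"
    and infinitesimal_lell_hlam: "infinitesimal (hmon (lell j) * hlam c w j)"
proof -
  have inf: "infinitesimal (hmon (lell j) * x)" if "hsupp x \<subseteq> {lones j..}" for x j
    using hsupp_lell_mult[of x j 0] that lones_Suc_pos[of j] unfolding infinitesimal_def
    by (auto simp del: lones_Suc_pos intro: less_le_trans)
  show s: "hsupp (hlam c w j) \<subseteq> {lones j..}" for j
  proof (induction j)
    case (Suc j)
    let ?y = "- (hmon (lell j) * hlam c w j)"
    have "hsupp (hlog ?y) \<subseteq> {lones (Suc j)..}"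
      unfolding hlog_def
      by (rule hsupp_fsub_subset) (use inf[OF Suc] hsupp_lell_mult[of _ j 0] Suc in \<open>auto intro: add_increasing2 order_trans[OF lones_nonneg]\<close>)
    then show ?case by (simp add: hlam.simps(2))
  qed (use assms in \<open>simp add: hsupp_const_add\<close>)
  show "infinitesimal (hmon (lell j) * hlam c w j)" by (rule inf[OF s])
qed

lemma infinitesimal_hlam: "infinitesimal w \<Longrightarrow> infinitesimal (hlam c w (Suc j))"
  by (simp add: hlam.simps(2) infinitesimal_lell_hlam infinitesimal_closure(2) infinitesimal_hlog)

lemma infinitesimal_texp: "infinitesimal w \<Longrightarrow> infinitesimal (texp K c w b)"
  unfolding texp_def by (intro infinitesimal_closure infinitesimal_sum infinitesimal_hlam)

lemma hsupp_hexp: "infinitesimal x \<Longrightarrow> hsupp (hexp x) \<subseteq> {0..}"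
  unfolding hexp_def by (rule hsupp_fsub_closed) (auto simp: infinitesimal_def)

lemma hsupp_qker: "infinitesimal w \<Longrightarrow> hsupp (qker K c w b) \<subseteq> {b..}"
  unfolding qker_def using hsupp_hmon_mult[OF hsupp_hexp[OF infinitesimal_texp], of w b K c b]
  by (simp add: hsupp_scaleR)

lemma texp_add: "texp K c w (a + b) = texp K c w a + texp K c w b"
  by (simp add: texp_def scaleR_left_distrib sum.distrib)

lemma qker_add:
  assumes "infinitesimal w" "c > 0"
  shows "qker K c w (a + b) = qker K c w a * qker K c w b"
  using assms by (simp add: qker_def texp_add hexp_add infinitesimal_texp hmon_add powr_add mult_ac)

text \<open>All the series \<open>texp K c w b\<close> are linear combinations of the same finitely
  many ones. Neumann's lemma for the union \<open>P\<close> of their supports therefore bounds all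
  exponentials by one set \<open>S\<close>, independent of \<open>b\<close>.\<close>

lemma strong_cmp:
  assumes "infinitesimal w"
  shows "strong (cmp K c w)" "cmp K c w (hmon b) = qker K c w b"
proof -
  define P where "P = hsupp w \<union> (\<Union>j<K. hsupp (hlam c w (Suc j)))"
  have "wo P" unfolding P_def by (intro wo_Un wo_UN_finite wo_hsupp) auto
  moreover have "P \<subseteq> {0<..}"
    using assms infinitesimal_hlam[OF assms, of c] unfolding P_def infinitesimal_def by blast
  ultimately obtain S where S: "wo S"
    "\<And>x y i j. hsupp x \<subseteq> P \<Longrightarrow> hsupp y \<subseteq> P \<Longrightarrow> hsupp (x ^ i * y ^ j) \<subseteq> S"
    by (rule neumann) auto
  have "hsupp (texp K c w b) \<subseteq> P" for b
    unfolding texp_def by (intro hsupp_add hsupp_scaleR hsupp_sum) (auto simp: P_def)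
  then have "hsupp (fps_nth (fps_exp 1) i *\<^sub>R texp K c w b ^ i) \<subseteq> S" for b i
    using S(2)[of "texp K c w b" "texp K c w b" i 0] by (simp only: power_0 mult_1_right hsupp_scaleR)
  then have "hsupp (hexp (texp K c w b)) \<subseteq> S" for b
    using hsupp_hsum[OF power_summable[OF infinitesimal_texp[OF assms, of K c b], of "fps_nth (fps_exp 1)"]]
    unfolding hexp_def fsub_def by blast
  then have "hsupp (qker K c w b) \<subseteq> (+) b ` S" for b
    unfolding qker_def by (intro hsupp_scaleR hsupp_mult_subset[of "hmon b" "{b}"]) auto
  from strong_kernel[OF S(1) this]
  show "strong (cmp K c w)" "cmp K c w (hmon b) = qker K c w b" by (simp_all add: cmp_def[abs_def])
qed

lemma cmp_mult:
  assumes "infinitesimal w" "c > 0" shows "cmp K c w (x * y) = cmp K c w x * cmp K c w y"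
  by (rule strong_mult_hom[OF strong_cmp(1)[OF assms(1)]]) (simp add: strong_cmp(2) qker_add assms)

lemma texp_0 [simp]: "texp K c w 0 = 0"
  by (simp add: texp_def)

lemma cmp_1:
  assumes "infinitesimal w" "c > 0" shows "cmp K c w 1 = 1"
  using strong_cmp(2)[OF assms(1), of K c 0] assms(2) by (simp add: qker_def)

lemma cmp_fsub:
  assumes "infinitesimal w" "c > 0" "infinitesimal x"
  shows "cmp K c w (fsub F x) = fsub F (cmp K c w x)"
  by (rule strong_fsub[OF strong_cmp(1)[OF assms(1)] cmp_mult[OF assms(1,2)] cmp_1[OF assms(1,2)] assms(3)])

lemma hsupp_cmp:
  assumes "infinitesimal w" "hsupp x \<subseteq> U" "\<And>a b. a \<in> U \<Longrightarrow> a \<le> b \<Longrightarrow> b \<in> U"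
  shows "hsupp (cmp K c w x) \<subseteq> U"
proof
  fix m assume "m \<in> hsupp (cmp K c w x)"
  then obtain b where "b \<in> hsupp x" "m \<in> hsupp (cmp K c w (hmon b))"
    by (rule strong_hsupp[OF strong_cmp(1)[OF assms(1)]])
  then show "m \<in> U" using assms hsupp_qker[OF assms(1), of K c b] by (auto simp: strong_cmp(2))
qed

lemma infinitesimal_cmp: "infinitesimal w \<Longrightarrow> infinitesimal x \<Longrightarrow> infinitesimal (cmp K c w x)"
  unfolding infinitesimal_def[of x] infinitesimal_def[of "cmp K c w x"] by (rule hsupp_cmp) auto

section \<open>Chain rule and associativity of composition\<close>

lemma hlog_0 [simp]: "hlog 0 = 0"
  using hlog_hexp[of 0] by simp

lemma hlam_1_0 [simp]: "hlam 1 0 j = 0"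
  by (induction j) (simp_all add: hlam.simps(2))

lemma qker_1_0 [simp]: "qker K 1 0 b = hmon b"
  by (simp add: qker_def texp_def)

lemma cmp_1_0 [simp]: "cmp K 1 0 x = x"
  by (simp add: cmp_def hsum_monomials)

text \<open>With inner series c' z exp(w'), C for composition with it, and L, L' for the two
  logarithms at l_j, the factorization 1 - l_(j+1) (L' + C(L)) = (1 - l_(j+1) L') (1 - C(l_(j+1))
  C(L)) turns into a sum under the logarithm. The bound \<open>j \<le> K\<close> reflects that
  \<open>cmp K\<close> freezes later logarithms.\<close>

lemma hlam_chain:
  assumes w: "infinitesimal w" "infinitesimal w'" "c > 0" "c' > 0" and "j \<le> K"
  shows "hlam (c * c') (w' + cmp K c' w' w) j = hlam c' w' j + cmp K c' w' (hlam c w j)"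
  using assms(5)
proof (induction j)
  case 0
  show ?case using w
    by (simp add: strong_add[OF strong_cmp(1)] strong_scaleR[OF strong_cmp(1)] cmp_1 ln_mult scaleR_left_distrib)
next
  case (Suc j)
  let ?C = "cmp K c' w'" and ?e = "hmon (lell j)"
  let ?L = "hlam c w j" and ?L' = "hlam c' w' j"
  let ?w = "w' + ?C w"
  note S = strong_cmp(1)[OF w(2), of K c']
  have iw: "infinitesimal ?w" using w by (intro infinitesimal_closure infinitesimal_cmp)
  have i1: "infinitesimal (- (?e * ?L))" and i2: "infinitesimal (- (?e * ?L'))"
    using w by (auto intro: infinitesimal_lell_hlam)
  have t: "texp K c' w' (lell j) = hlam c' w' (Suc j)"
  proof -
    have "(\<Sum>i<K. real_of_int (ldeg (lell j) i) *\<^sub>R hlam c' w' (Suc i)) = (\<Sum>i<K. if i = j then hlam c' w' (Suc i) else 0)"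
      by (intro sum.cong refl) simp
    also have "\<dots> = hlam c' w' (Suc j)" using Suc.prems by (subst sum.delta) auto
    finally show ?thesis by (simp only: texp_def lmon_consts scaleR_zero_left add_0_left)
  qed
  have Ce: "?C ?e = ?e * hexp (- hlog (- (?e * ?L')))"
    using w t by (simp add: strong_cmp(2) qker_def hlam.simps(2))
  have "hexp (- hlog (- (?e * ?L'))) * (1 - ?e * ?L') = 1"
  proof -
    have "1 - ?e * ?L' = hexp (hlog (- (?e * ?L')))" using hexp_hlog[OF i2] by simp
    then show ?thesis using hexp_add[of "- hlog (- (?e * ?L'))" "hlog (- (?e * ?L'))"] i2 by simp
  qed
  \<comment> \<open>This is the closed form C(l_(j+1)) = l_(j+1) / (1 - l_(j+1) L').\<close>
  then have Ce': "?C ?e * (1 - ?e * ?L') = ?e" unfolding Ce by (simp add: mult.assoc)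
  have "?C (hlam c w (Suc j)) = - hlog (- (?C ?e * ?C ?L))"
    using w i1 by (simp add: hlam.simps(2) strong_minus[OF S] hlog_def cmp_fsub cmp_mult)
  moreover have "hlog (- (?e * (?L' + ?C ?L))) = hlog (- (?e * ?L')) + hlog (- (?C ?e * ?C ?L))"
  proof (rule hlog_mult[OF i2])
    have "infinitesimal (?C (- (?e * ?L)))" using w i1 by (intro infinitesimal_cmp)
    then show "infinitesimal (- (?C ?e * ?C ?L))" using w by (simp add: strong_minus[OF S] cmp_mult)
    have "(1 + - (?e * ?L')) * (1 + - (?C ?e * ?C ?L)) = 1 - ?e * ?L' - (?C ?e * (1 - ?e * ?L')) * ?C ?L"
      by (simp add: algebra_simps)
    then show "1 + - (?e * (?L' + ?C ?L)) = (1 + - (?e * ?L')) * (1 + - (?C ?e * ?C ?L))"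
      unfolding Ce' by (simp add: algebra_simps)
  qed
  ultimately show ?case using Suc by (simp add: hlam.simps(2))
qed

lemma texp_chain:
  assumes w: "infinitesimal w" "infinitesimal w'" "c > 0" "c' > 0"
  shows "texp K (c * c') (w' + cmp K c' w' w) b = texp K c' w' b + cmp K c' w' (texp K c w b)"
proof -
  note S = strong_cmp(1)[OF w(2), of K c']
  have "(\<Sum>j<K. real_of_int (ldeg b j) *\<^sub>R hlam (c * c') (w' + cmp K c' w' w) (Suc j)) =
    (\<Sum>j<K. real_of_int (ldeg b j) *\<^sub>R hlam c' w' (Suc j) + real_of_int (ldeg b j) *\<^sub>R cmp K c' w' (hlam c w (Suc j)))"
    by (intro sum.cong refl) (subst hlam_chain[OF w], auto simp: scaleR_right_distrib)
  then show ?thesis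
    unfolding texp_def
    by (simp add: strong_add[OF S] strong_sum[OF S] strong_scaleR[OF S] scaleR_right_distrib sum.distrib)
qed

text \<open>On monomials the logarithms add by \<open>texp_chain\<close>, and strong linearity does
  the rest. This is associativity of composition, \<open>w' + cmp K c' w' w\<close> being the
  logarithmic coordinate of the composite.\<close>

lemma cmp_cmp:
  assumes w: "infinitesimal w" "infinitesimal w'" "c > 0" "c' > 0"
  shows "cmp K c' w' (cmp K c w x) = cmp K (c * c') (w' + cmp K c' w' w) x"
proof (rule strong_ext[of "\<lambda>x. cmp K c' w' (cmp K c w x)"])
  note S = strong_cmp(1)[OF w(2), of K c']
  have iw: "infinitesimal (w' + cmp K c' w' w)" using w by (intro infinitesimal_closure(3) infinitesimal_cmp)
  show "strong (\<lambda>x. cmp K c' w' (cmp K c w x))" "strong (cmp K (c * c') (w' + cmp K c' w' w))"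
    by (rule strong_compose[OF S strong_cmp(1)[OF w(1)]], rule strong_cmp(1)[OF iw])
  fix b
  let ?t = "texp K c w b" and ?t' = "texp K c' w' b"
  have i: "infinitesimal ?t" "infinitesimal ?t'" "infinitesimal (cmp K c' w' ?t)"
    using w by (auto intro: infinitesimal_texp infinitesimal_cmp)
  have "cmp K c' w' (qker K c w b) = (c powr zdeg b) *\<^sub>R (qker K c' w' b * hexp (cmp K c' w' ?t))"
    unfolding qker_def[of K c] using w i
    by (simp add: strong_scaleR[OF S] cmp_mult strong_cmp(2) hexp_def cmp_fsub)
  also have "\<dots> = qker K (c * c') (w' + cmp K c' w' w) b"
    using w i by (simp add: qker_def texp_chain hexp_add powr_mult mult_ac)
  finally show "cmp K c' w' (cmp K c w (hmon b)) = cmp K (c * c') (w' + cmp K c' w' w) (hmon b)"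
    using w iw by (simp add: strong_cmp(2))
qed

definition tser :: "real \<Rightarrow> lmon hahn \<Rightarrow> lmon hahn" where
  "tser c w = c *\<^sub>R (hmon lz * hexp w)"

lemma cmp_tser:
  assumes w: "infinitesimal w" "infinitesimal w'" "c > 0" "c' > 0"
  shows "cmp K c' w' (tser c w) = tser (c * c') (w' + cmp K c' w' w)"
proof -
  note S = strong_cmp(1)[OF w(2), of K c']
  have "texp K c' w' lz = w'" by (simp add: texp_def)
  then show ?thesis
    using w by (simp add: tser_def strong_scaleR[OF S] cmp_mult strong_cmp(2) qker_def hexp_add infinitesimal_cmp)
      (simp add: hexp_def cmp_fsub mult_ac)
qed

section \<open>Order estimates\<close>

definition lfirst :: "lmon \<Rightarrow> nat" where "lfirst b = (LEAST j. ldeg b j \<noteq> 0)"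

text \<open>The leading exponent of b o g - b when g = c z + ...: composition with a dilation changes a
  power of z by a factor, whereas a logarithmic monomial gains the factor l_1 ... l_(j+1) with l_(j+1)
  its first logarithm, as in z d/dz.\<close>
definition ltau :: "lmon \<Rightarrow> lmon" where
  "ltau b = (if zdeg b \<noteq> 0 then b else b + lones (Suc (lfirst b)))"

lemma lfirst:
  assumes "zdeg b = 0" "b \<noteq> 0"
  shows "ldeg b (lfirst b) \<noteq> 0" "\<And>j. j < lfirst b \<Longrightarrow> ldeg b j = 0"
proof -
  have "\<exists>j. ldeg b j \<noteq> 0" using assms lmon_eqI[of b 0] by auto
  from LeastI_ex[OF this] show "ldeg b (lfirst b) \<noteq> 0" by (simp add: lfirst_def)
  show "\<And>j. j < lfirst b \<Longrightarrow> ldeg b j = 0" unfolding lfirst_def using not_less_Least by blast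
qed

lemma lmon_pos_cases:
  assumes "0 < b"
  obtains "zdeg b > 0" | "zdeg b = 0" "ldeg b (lfirst b) > 0" "\<And>j. j < lfirst b \<Longrightarrow> ldeg b j = 0"
proof (cases "zdeg b > 0")
  case False
  then have z: "zdeg b = 0" and l: "lexless (ldeg 0) (ldeg b)" using assms by (auto simp: less_lmon_iff)
  obtain i where i: "\<forall>j<i. ldeg b j = 0" "0 < ldeg b i" using l by (auto simp: lexless_def)
  note f = lfirst[OF z] 
  have "b \<noteq> 0" using assms by simp
  then have "lfirst b = i" using f i by (metis less_irrefl linorder_neqE_nat)
  then show ?thesis using that(2) z i by auto
qed (use that in auto)

text \<open>For pure logarithms, \<open>a < b\<close> rules out that \<open>b\<close> starts at a
  later logarithm than \<open>a\<close>. With equal first logarithms the shifts agree; if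
  \<open>b\<close> starts earlier, its exponent there is at least 2 after the shift, that of
  \<open>a\<close> only 1.\<close>

lemma ltau_strict_mono:
  assumes "0 < a" "a < b" shows "ltau a < ltau b"
proof -
  have b0: "0 < b" using assms by simp
  from b0 show ?thesis
  proof (cases rule: lmon_pos_cases)
    case 1
    from assms(1) show ?thesis
      by (cases rule: lmon_pos_cases) (use 1 assms in \<open>auto simp: ltau_def less_lmon_iff\<close>)
  next
    case 2
    note B = 2
    from assms(1) show ?thesis
    proof (cases rule: lmon_pos_cases)
      case 1
      then show ?thesis using assms B by (auto simp: less_lmon_iff)
    next
      case 2
      note A = 2
      have l: "lexless (ldeg a) (ldeg b)" using assms(2) A B by (auto simp: less_lmon_iff)
      consider "lfirst a = lfirst b" | "lfirst b < lfirst a" | "lfirst a < lfirst b" by linarith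
      then show ?thesis
      proof cases
        case 1
        then show ?thesis using A B assms(2) by (simp add: ltau_def)
      next
        case 2
        have "lexless (ldeg (a + lones (Suc (lfirst a)))) (ldeg (b + lones (Suc (lfirst b))))"
          unfolding lexless_def by (rule exI[of _ "lfirst b"]) (use A B 2 in auto)
        then show ?thesis using A B by (simp add: ltau_def less_lmon_iff)
      next
        case 3
        obtain i where i: "\<forall>j<i. ldeg a j = ldeg b j" "ldeg a i < ldeg b i" using l by (auto simp: lexless_def)
        have "i \<le> lfirst a" using i A(2) B(3)[OF 3] by (metis less_irrefl not_le)
        then have "ldeg b i = 0" "ldeg a i \<ge> 0" using A B(3)[of i] 3 by (auto simp: le_less)
        then show ?thesis using i by simp
      qed
    qed
  qed
qed

lemma ltau_mono: "0 < a \<Longrightarrow> a \<le> b \<Longrightarrow> ltau a \<le> ltau b"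
  using ltau_strict_mono[of a b] by (auto simp: le_less)

text \<open>For pure logarithms the shifted exponents are 1 before the first logarithm of
  \<open>b\<close> and at least 2 at it, whereas those of \<open>lones k\<close> never exceed 1.
  Here \<open>k\<close> is unrelated to the depth of \<open>b\<close>, so the bound survives
  conjugation by deeper series.\<close>

lemma lones_less_ltau:
  assumes "0 < b" shows "lones k < ltau b"
  using assms
proof (cases rule: lmon_pos_cases)
  case 1
  then show ?thesis by (simp add: ltau_def less_lmon_iff)
next
  case 2
  show ?thesis
  proof (cases "lfirst b < k")
    case True
    have "lexless (ldeg (lones k)) (ldeg (b + lones (Suc (lfirst b))))"
      unfolding lexless_def by (rule exI[of _ "lfirst b"]) (use 2 True in auto)
    then show ?thesis using 2 by (simp add: ltau_def less_lmon_iff)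
  next
    case False
    have "lones k \<le> lones (Suc (lfirst b))" using False by (intro lones_mono) simp
    also have "\<dots> < b + lones (Suc (lfirst b))" using assms by simp
    finally show ?thesis using 2 by (simp add: ltau_def)
  qed
qed

section \<open>Exponents of bounded depth\<close>

definition dpt :: "nat \<Rightarrow> lmon set" where "dpt k = {m. \<forall>j\<ge>k. ldeg m j = 0}"

lemma dpt_closed [simp]: "0 \<in> dpt k" "a \<in> dpt k \<Longrightarrow> b \<in> dpt k \<Longrightarrow> a + b \<in> dpt k"
  "lz \<in> dpt k" "j < k \<Longrightarrow> lell j \<in> dpt k"
  by (auto simp: dpt_def)

lemma dpt_mono: "k \<le> l \<Longrightarrow> dpt k \<subseteq> dpt l"
  by (auto simp: dpt_def)

lemma lfirst_less:
  assumes "b \<in> dpt k" "zdeg b = 0" "b \<noteq> 0" shows "lfirst b < k"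
  using lfirst(1)[OF assms(2,3)] assms(1) by (auto simp: dpt_def not_less[symmetric])

text \<open>The upper counterpart of \<open>lones_less_ltau\<close>: together they place the
  nonlinear errors of the conjugacy equation beyond the linear response.\<close>

lemma ltau_le:
  assumes "0 < b" "b \<in> dpt k" shows "ltau b \<le> b + lones k"
proof (cases "zdeg b = 0")
  case True
  have "lones (Suc (lfirst b)) \<le> lones k"
    using lfirst_less[OF assms(2) True] assms(1) by (intro lones_mono Suc_leI) simp
  then show ?thesis using True by (simp add: ltau_def)
qed (simp add: ltau_def)

lemma ltau_surj:
  assumes "m \<in> dpt k" "lones k < m"
  obtains b where "0 < b" "b \<in> dpt k" "ltau b = m"
proof (cases "zdeg m = 0")
  case False
  then have "zdeg m > 0" using assms(2) by (auto simp: less_lmon_iff)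
  then show ?thesis using that[of m] assms(1) by (simp add: ltau_def less_lmon_iff)
next
  case True
  then have "lexless (ldeg (lones k)) (ldeg m)" using assms(2) by (simp add: less_lmon_iff)
  then obtain i where i: "\<forall>j<i. ldeg (lones k) j = ldeg m j" "ldeg (lones k) i < ldeg m i"
    unfolding lexless_def by blast
  have ik: "i < k"
  proof (rule ccontr)
    assume "\<not> i < k"
    then have "ldeg m i = 0" using assms(1) by (simp add: dpt_def)
    then show False using i(2) \<open>\<not> i < k\<close> by simp
  qed
  \<comment> \<open>In \<open>m\<close> the exponents before index \<open>i\<close> equal 1 and the
    one at \<open>i\<close> exceeds 1. Removing l_1 ... l_(i+1) thus leaves a positive exponent
    whose first logarithm is l_(i+1).\<close>
  define b where "b = m - lones (Suc i)"
  have z: "zdeg b = 0" and d0: "\<And>j. j < i \<Longrightarrow> ldeg b j = 0" and di: "ldeg b i > 0"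
    using True i ik by (auto simp: b_def)
  have pos: "0 < b" unfolding less_lmon_iff lexless_def using z d0 di by (auto intro!: exI[of _ i])
  have "lfirst b = i" using lfirst[OF z] d0 di pos by (metis less_irrefl linorder_neqE_nat)
  then have "ltau b = m" using z by (simp add: ltau_def b_def)
  moreover have "b \<in> dpt k" using assms(1) ik by (auto simp: b_def dpt_def)
  ultimately show ?thesis using that pos by blast
qed

section \<open>Order of the effect of composition on monomials\<close>

lemma hsupp_hlam_diff:
  assumes "infinitesimal w" "infinitesimal w'" "0 \<le> d" "hsupp (hlam c w 0 - hlam c' w' 0) \<subseteq> {d..}"
  shows "hsupp (hlam c w j - hlam c' w' j) \<subseteq> {lones j + d..}"
proof (induction j)
  case (Suc j)
  let ?x = "- (hmon (lell j) * hlam c w j)" and ?y = "- (hmon (lell j) * hlam c' w' j)"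
  have "hsupp (hmon (lell j) * (hlam c w j - hlam c' w' j)) \<subseteq> {lones (Suc j) + d..}"
    by (rule hsupp_lell_mult[OF Suc])
  then have "hsupp (- (hmon (lell j) * (hlam c w j - hlam c' w' j))) \<subseteq> {lones (Suc j) + d..}" by simp
  then have d: "hsupp (?x - ?y) \<subseteq> {lones (Suc j) + d..}" by (simp add: algebra_simps)
  have "hsupp (hlog ?x - hlog ?y) \<subseteq> {lones (Suc j) + d..}"
    unfolding hlog_def using d
    by (rule fsub_lipschitz[rotated 2])
      (use assms in \<open>auto intro: infinitesimal_lell_hlam add_increasing2\<close>)
  then show ?case by (simp add: hlam.simps(2) hsupp_diff_commute[of "hlog ?y"])
qed (use assms in simp)

text \<open>To first order log(1 + y) is y, so the two minus signs of the recursion cancel and the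
  constant \<open>ln c\<close> is carried along with one more factor l_(j+1).\<close>

lemma coef_hlam_lones:
  assumes "infinitesimal w" shows "coef (hlam c w j) (lones j) = ln c"
proof (induction j)
  case 0
  show ?case using infinitesimal_coef_0[OF assms] by (simp add: coef_one)
next
  case (Suc j)
  let ?y = "- (hmon (lell j) * hlam c w j)"
  have "hsupp ?y \<subseteq> {lones (Suc j)..}"
    using hsupp_lell_mult[of "hlam c w j" j 0] hsupp_hlam[OF assms] by simp
  then have "hsupp (hlog ?y - fps_nth (fps_ln 1) 1 *\<^sub>R ?y) \<subseteq> {lones (Suc j)<..}"
    unfolding hlog_def by (rule fsub_leading) auto
  then have "lones (Suc j) \<notin> hsupp (hlog ?y - fps_nth (fps_ln 1) 1 *\<^sub>R ?y)" by auto
  then have "coef (hlog ?y) (lones (Suc j)) = coef ?y (lones (Suc j))" by (simp add: in_hsupp fps_ln_nth)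
  also have "\<dots> = - ln c" using Suc by (simp add: coef_hmon_mult lones_Suc)
  finally show ?case by (simp add: hlam.simps(2))
qed

text \<open>The number of factors gained depends on where the difference enters: through the first
  logarithm of \<open>b\<close> for a pure logarithm, directly for a power of z. With
  \<open>d = 0\<close> this compares composition with the identity; with \<open>d > 0\<close> it
  measures the dependence on w.\<close>

lemma hsupp_qker_diff:
  assumes w: "infinitesimal w" "infinitesimal w'" and c: "c > 0" "c' > 0" and d: "0 \<le> d"
    and h: "hsupp (hlam c w 0 - hlam c' w' 0) \<subseteq> {d..}" and b: "b \<noteq> 0"
  shows "hsupp (qker K c w b - qker K c' w' b) \<subseteq> {ltau b + d..}"
proof (cases "zdeg b = 0")
  case True
  note f = lfirst[OF True b]
  let ?l = "lones (Suc (lfirst b))"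
  have "texp K c w b - texp K c' w' b = (\<Sum>j<K. real_of_int (ldeg b j) *\<^sub>R (hlam c w (Suc j) - hlam c' w' (Suc j)))"
    using True by (simp add: texp_def scaleR_right_diff_distrib sum_subtractf)
  moreover have "hsupp (real_of_int (ldeg b j) *\<^sub>R (hlam c w (Suc j) - hlam c' w' (Suc j))) \<subseteq> {?l + d..}" for j
  proof (cases "j < lfirst b")
    case False
    have "hsupp (hlam c w (Suc j) - hlam c' w' (Suc j)) \<subseteq> {lones (Suc j) + d..}"
      by (rule hsupp_hlam_diff[OF w d h])
    also have "\<dots> \<subseteq> {?l + d..}" using False lones_mono[of "Suc (lfirst b)" "Suc j"] by simp
    finally show ?thesis by (rule hsupp_scaleR)
  qed (simp add: f)
  ultimately have t: "hsupp (texp K c w b - texp K c' w' b) \<subseteq> {?l + d..}" by (simp add: hsupp_sum)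
  have "hsupp (hexp (texp K c w b) - hexp (texp K c' w' b)) \<subseteq> {?l + d..}"
    unfolding hexp_def by (rule fsub_lipschitz[OF infinitesimal_texp infinitesimal_texp t])
      (use w in \<open>auto intro: add_increasing2\<close>)
  then have "hsupp (hmon b * (hexp (texp K c w b) - hexp (texp K c' w' b))) \<subseteq> {b + (?l + d)..}"
    by (rule hsupp_hmon_mult)
  then show ?thesis using True c by (simp add: qker_def ltau_def algebra_simps)
next
  case False
  then have tau: "ltau b = b" by (simp add: ltau_def)
  show ?thesis
  \<comment> \<open>For \<open>d = 0\<close> the multipliers may differ and each term is bounded
    separately; \<open>d > 0\<close> forces them to agree.\<close>
  proof (cases "d = 0")
    case True
    then show ?thesis using hsupp_diff[OF hsupp_qker hsupp_qker] w by (simp add: tau)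
  next
    case False
    then have d0: "0 < d" using d by simp
    have "coef w 0 = 0" "coef w' 0 = 0" using w by (simp_all add: infinitesimal_coef_0)
    moreover have "coef (hlam c w 0 - hlam c' w' 0) 0 = 0"
      using h d0 in_hsupp[of 0 "hlam c w 0 - hlam c' w' 0"] by force
    ultimately have cc: "c = c'" using c by (simp add: coef_one)
    have dw: "hsupp (w - w') \<subseteq> {d..}" using h cc by simp
    have "texp K c w b - texp K c' w' b =
      zdeg b *\<^sub>R (w - w') + (\<Sum>j<K. real_of_int (ldeg b j) *\<^sub>R (hlam c w (Suc j) - hlam c' w' (Suc j)))"
      by (simp add: texp_def scaleR_right_diff_distrib sum_subtractf)
    moreover have "hsupp (hlam c w (Suc j) - hlam c' w' (Suc j)) \<subseteq> {d..}" for j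
    proof -
      have "hsupp (hlam c w (Suc j) - hlam c' w' (Suc j)) \<subseteq> {lones (Suc j) + d..}"
        by (rule hsupp_hlam_diff[OF w d h])
      also have "\<dots> \<subseteq> {d..}" by (simp add: add_increasing)
      finally show ?thesis .
    qed
    ultimately have t: "hsupp (texp K c w b - texp K c' w' b) \<subseteq> {d..}"
      using dw by (simp add: hsupp_add hsupp_scaleR hsupp_sum)
    have "hsupp (hexp (texp K c w b) - hexp (texp K c' w' b)) \<subseteq> {d..}"
      unfolding hexp_def by (rule fsub_lipschitz[OF infinitesimal_texp infinitesimal_texp t])
        (use w in \<open>auto intro: add_increasing2\<close>)
    then have "hsupp (hmon b * (hexp (texp K c w b) - hexp (texp K c' w' b))) \<subseteq> {b + d..}"
      by (rule hsupp_hmon_mult)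
    then have "hsupp ((c powr zdeg b) *\<^sub>R (hmon b * (hexp (texp K c w b) - hexp (texp K c' w' b)))) \<subseteq> {b + d..}"
      by (rule hsupp_scaleR)
    then show ?thesis using cc tau by (simp add: qker_def algebra_simps)
  qed
qed

lemma hsupp_qker_minus_hmon:
  assumes "infinitesimal w" "c > 0" "b \<noteq> 0"
  shows "hsupp (qker K c w b - hmon b) \<subseteq> {ltau b..}"
  using hsupp_qker_diff[of w 0 c 1 0 b K] assms hsupp_const_add[of w "ln c"] by simp

text \<open>With multiplier 1 the monomial keeps its coefficient, and what remains is the
  exponential of an infinitesimal minus 1. This is the estimate behind compositional
  inverses.\<close>

lemma hsupp_qker_parabolic:
  assumes "infinitesimal w"
  shows "hsupp (qker K 1 w b - hmon b) \<subseteq> {b<..}"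
proof -
  have "qker K 1 w b - hmon b = hmon b * (hexp (texp K 1 w b) - 1)" by (simp add: qker_def algebra_simps)
  moreover have "hsupp (hmon b * (hexp (texp K 1 w b) - 1)) \<subseteq> {b<..}"
    using infinitesimal_hexp_minus_1[OF infinitesimal_texp[OF assms]]
    by (intro hsupp_mult_subset[of _ "{b}" _ "{0<..}"]) (auto simp: infinitesimal_def)
  ultimately show ?thesis by simp
qed

text \<open>The coefficient is c^a - 1 if \<open>b\<close> contains z^a with a nonzero, and n
  \<open>ln c\<close> if \<open>b\<close> is purely logarithmic with first exponent n. Both are
  nonzero since 0 < c < 1, whereas for c = 1 both would vanish.\<close>

lemma coef_qker_ltau:
  assumes w: "infinitesimal w" and c: "0 < c" "c < 1" and b: "0 < b" "b \<in> dpt K"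
  shows "coef (qker K c w b - hmon b) (ltau b) \<noteq> 0"
proof (cases "zdeg b = 0")
  case False
  have "0 \<notin> hsupp (hexp (texp K c w b) - 1)"
    using infinitesimal_hexp_minus_1[OF infinitesimal_texp[OF w]] by (auto simp: infinitesimal_def)
  then have "coef (hexp (texp K c w b)) 0 = 1" by (simp add: in_hsupp coef_one)
  then have "coef (qker K c w b - hmon b) b = c powr zdeg b - 1"
    by (simp add: qker_def coef_hmon_mult coef_hmon)
  moreover have "c powr zdeg b \<noteq> 1" using c False by (simp add: powr_eq_one_iff_gen)
  ultimately show ?thesis using False by (simp add: ltau_def)
next
  case True
  have b0: "b \<noteq> 0" using b by simp
  note f = lfirst[OF True b0]
  let ?i = "lfirst b" let ?l = "lones (Suc ?i)" let ?t = "texp K c w b"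
  have iK: "?i < K" by (rule lfirst_less[OF b(2) True b0])
  have hl: "hsupp (hlam c w (Suc j)) \<subseteq> {?l..}" if "?i \<le> j" for j
    using hsupp_hlam[OF w, where c = c and j = "Suc j"] lones_mono[of "Suc ?i" "Suc j"] that by auto
  have t: "?t = (\<Sum>j<K. real_of_int (ldeg b j) *\<^sub>R hlam c w (Suc j))" using True by (simp add: texp_def)
  have "hsupp (real_of_int (ldeg b j) *\<^sub>R hlam c w (Suc j)) \<subseteq> {?l..}" for j
    by (cases "j < ?i") (simp_all add: f hl hsupp_scaleR)
  then have "hsupp ?t \<subseteq> {?l..}" unfolding t by (rule hsupp_sum)
  then have "hsupp (fsub (fps_exp 1 - 1) ?t - fps_nth (fps_exp 1 - 1) 1 *\<^sub>R ?t) \<subseteq> {?l<..}"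
    by (rule fsub_leading) auto
  then have "?l \<notin> hsupp (fsub (fps_exp 1 - 1) ?t - fps_nth (fps_exp 1 - 1) 1 *\<^sub>R ?t)" by auto
  then have e: "coef (hexp ?t - 1) ?l = coef ?t ?l"
    using infinitesimal_texp[OF w, of K c b] by (simp add: in_hsupp hexp_def fsub_linear)
  have "real_of_int (ldeg b j) * coef (hlam c w (Suc j)) ?l = (if j = ?i then real_of_int (ldeg b ?i) * ln c else 0)" for j
  proof -
    consider "j < ?i" | "j = ?i" | "?i < j" by linarith
    then show ?thesis
    proof cases
      case 3
      then have "?l < lones (Suc j)" by (intro lones_strict_mono) simp
      then have "?l \<notin> hsupp (hlam c w (Suc j))" using hsupp_hlam[OF w, where c = c and j = "Suc j"] by auto
      then show ?thesis using 3 by (simp add: in_hsupp)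
    qed (use f coef_hlam_lones[OF w, of c "Suc ?i"] in auto)
  qed
  then have "coef ?t ?l = real_of_int (ldeg b ?i) * ln c"
    using iK by (simp add: t coef_sum)
  moreover have "ln c \<noteq> 0" using c by simp
  ultimately have "coef (hexp ?t - 1) ?l \<noteq> 0" using e f(1) by simp
  moreover have "coef (qker K c w b - hmon b) (ltau b) = coef (hexp ?t - 1) ?l"
    using True c by (simp add: qker_def ltau_def coef_hmon_mult coef_hmon coef_one)
  ultimately show ?thesis by simp
qed

lemma hsupp_cmp_minus_id:
  assumes "infinitesimal w" "c > 0" "infinitesimal x" "\<And>b. b \<in> hsupp x \<Longrightarrow> {ltau b..} \<subseteq> U"
  shows "hsupp (cmp K c w x - x) \<subseteq> U"
proof
  fix m assume "m \<in> hsupp (cmp K c w x - x)"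
  then obtain b where b: "b \<in> hsupp x" "m \<in> hsupp (cmp K c w (hmon b) - hmon b)"
    by (rule strong_hsupp[OF strong_minus_op[OF strong_cmp(1)[OF assms(1)] strong_id]])
  then have "b \<noteq> 0" using assms(3) by (auto simp: infinitesimal_def)
  then show "m \<in> U"
    using b assms(4)[OF b(1)] hsupp_qker_minus_hmon[OF assms(1,2), of b K] by (auto simp: strong_cmp(2)[OF assms(1)])
qed

lemma hsupp_cmp_minus_id_lones:
  assumes "infinitesimal w" "c > 0" "infinitesimal x"
  shows "hsupp (cmp K c w x - x) \<subseteq> {lones k<..}"
  using assms
proof (rule hsupp_cmp_minus_id)
  fix b assume "b \<in> hsupp x"
  then have "lones k < ltau b" using assms(3) by (intro lones_less_ltau) (auto simp: infinitesimal_def)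
  then show "{ltau b..} \<subseteq> {lones k<..}" by auto
qed

section \<open>Preservation of depth\<close>

lemma hsupp_hlam_dpt:
  assumes "infinitesimal w" "hsupp w \<subseteq> dpt K" "j \<le> K" shows "hsupp (hlam c w j) \<subseteq> dpt K"
  using assms(3)
proof (induction j)
  case 0
  have "hsupp (ln c *\<^sub>R 1) \<subseteq> dpt K" by (rule hsupp_scaleR) simp
  then show ?case using assms(2) by (simp add: hsupp_add)
next
  case (Suc j)
  then have s: "hsupp (hmon (lell j) * hlam c w j) \<subseteq> dpt K"
    by (intro hsupp_mult_subset[of _ "{lell j}" _ "dpt K"]) auto
  have "hsupp (hlog (- (hmon (lell j) * hlam c w j))) \<subseteq> dpt K"
    unfolding hlog_def
    by (rule hsupp_fsub_closed) (use s infinitesimal_lell_hlam[OF assms(1)] in auto)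
  then show ?case by (simp add: hlam.simps(2))
qed

lemma hsupp_hexp_dpt: "infinitesimal w \<Longrightarrow> hsupp w \<subseteq> dpt K \<Longrightarrow> hsupp (hexp w) \<subseteq> dpt K"
  unfolding hexp_def by (rule hsupp_fsub_closed) auto

lemma hsupp_cmp_dpt:
  assumes "infinitesimal w" "hsupp w \<subseteq> dpt K" "hsupp x \<subseteq> dpt K"
  shows "hsupp (cmp K c w x) \<subseteq> dpt K"
proof
  fix m assume "m \<in> hsupp (cmp K c w x)"
  then obtain b where b: "b \<in> hsupp x" "m \<in> hsupp (qker K c w b)"
    by (rule strong_hsupp[OF strong_cmp(1)[OF assms(1)]]) (simp add: strong_cmp(2)[OF assms(1)])
  have "hsupp (texp K c w b) \<subseteq> dpt K"
    unfolding texp_def using assms by (intro hsupp_add hsupp_scaleR hsupp_sum hsupp_hlam_dpt) auto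
  then have "hsupp (hexp (texp K c w b)) \<subseteq> dpt K"
    using assms by (intro hsupp_hexp_dpt infinitesimal_texp)
  then have "hsupp (qker K c w b) \<subseteq> dpt K"
    unfolding qker_def using b(1) assms(3) by (intro hsupp_scaleR hsupp_mult_subset[of _ "{b}" _ "dpt K"]) auto
  then show "m \<in> dpt K" using b(2) by blast
qed

section \<open>Normalization in logarithmic coordinates\<close>

definition lpos :: "nat \<Rightarrow> lmon set" where "lpos k = {b. 0 < b \<and> b \<in> dpt k}"

lemma lposD: "hsupp w \<subseteq> lpos k \<Longrightarrow> infinitesimal w" "hsupp w \<subseteq> lpos k \<Longrightarrow> hsupp w \<subseteq> dpt k"
  by (auto simp: lpos_def infinitesimal_def)

lemma lposI: "infinitesimal w \<Longrightarrow> hsupp w \<subseteq> dpt k \<Longrightarrow> hsupp w \<subseteq> lpos k"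
  by (auto simp: lpos_def infinitesimal_def)

lemma lpos_mono: "k \<le> l \<Longrightarrow> lpos k \<subseteq> lpos l"
  using dpt_mono[of k l] by (auto simp: lpos_def)

lemma hsupp_cmp_lpos:
  assumes "hsupp w \<subseteq> lpos k" "hsupp x \<subseteq> lpos k" shows "hsupp (cmp k c w x) \<subseteq> lpos k"
  using lposI[OF infinitesimal_cmp[OF lposD(1)[OF assms(1)] lposD(1)[OF assms(2)]]
      hsupp_cmp_dpt[OF lposD(1,2)[OF assms(1)] lposD(2)[OF assms(2)]]] .

text \<open>Puts a support condition into the coefficientwise form that
  \<open>hahn_zero_by_approximation\<close> accepts.\<close>

lemma hsupp_subset_coef: "{x. \<forall>m. coef x m \<in> (if m \<in> B then UNIV else {0})} = {x. hsupp x \<subseteq> B}"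
  by (auto simp: hsupp_def split: if_splits)

text \<open>The equation is (z exp(u)) o (z exp(s)) = z in logarithmic form. Subtracting the
  residual is a sufficient correction, because composition with z exp(s) is the identity to leading
  order.\<close>

lemma parabolic_left_inverse:
  assumes s: "hsupp s \<subseteq> lpos k"
  obtains u where "hsupp u \<subseteq> lpos k" "s + cmp k 1 s u = 0"
proof -
  let ?C = "cmp k 1 s"
  note i = lposD(1)[OF s] note S = strong_cmp(1)[OF i, of k 1]
  have "\<exists>u\<in>{x. \<forall>m. coef x m \<in> (if m \<in> lpos k then UNIV else {0})}. s + ?C u = 0"
  proof (rule hahn_zero_by_approximation[where B = "lpos k" and \<tau> = "\<lambda>b. b"], unfold hsupp_subset_coef)
    fix x y :: "lmon hahn" and b assume "hsupp (x - y) \<subseteq> {b..}"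
    then have "hsupp (?C (x - y)) \<subseteq> {b..}" by (rule hsupp_cmp[OF i]) auto
    then show "hsupp (s + ?C x - (s + ?C y)) \<subseteq> {b..}" by (simp add: strong_diff[OF S])
  next
    fix x assume "x \<in> {x. hsupp x \<subseteq> lpos k}" and nz: "s + ?C x \<noteq> 0"
    then have x: "hsupp x \<subseteq> lpos k" by simp
    have E: "hsupp (s + ?C x) \<subseteq> lpos k" by (rule hsupp_add[OF s hsupp_cmp_lpos[OF s x]])
    obtain b where b: "coef (s + ?C x) b \<noteq> 0" "hsupp (s + ?C x) \<subseteq> {b..}" using hsupp_min[OF nz] by blast
    define y where "y = x - (s + ?C x)"
    have "hsupp y \<subseteq> lpos k" unfolding y_def by (rule hsupp_diff[OF x E])
    moreover have "b \<in> lpos k" using b(1) E in_hsupp by blast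
    moreover have "hsupp (y - x) \<subseteq> {b..}" using b(2) hsupp_diff_commute[of y x] by (simp add: y_def)
    moreover have "hsupp (s + ?C y) \<subseteq> {b<..}"
    proof -
      have "hsupp (?C (s + ?C x) - (s + ?C x)) \<subseteq> {b<..}"
      proof
        fix m assume "m \<in> hsupp (?C (s + ?C x) - (s + ?C x))"
        then obtain a where "a \<in> hsupp (s + ?C x)" "m \<in> hsupp (?C (hmon a) - hmon a)"
          by (rule strong_hsupp[OF strong_minus_op[OF S strong_id]])
        then have "a < m" "b \<le> a" using hsupp_qker_parabolic[OF i, of k a] b(2) by (auto simp: strong_cmp(2)[OF i])
        then show "m \<in> {b<..}" by simp
      qed
      moreover have "s + ?C y = (s + ?C x) - ?C (s + ?C x)" by (simp add: y_def strong_diff[OF S])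
      ultimately show ?thesis by (simp only: hsupp_diff_commute)
    qed
    ultimately show "\<exists>b\<in>lpos k. \<exists>y\<in>{x. hsupp x \<subseteq> lpos k}. coef (s + ?C x) b \<noteq> 0 \<and>
        hsupp (y - x) \<subseteq> {b..} \<and> hsupp (s + ?C y) \<subseteq> {b<..}"
      using b(1) by blast
  qed auto
  then show ?thesis using that unfolding hsupp_subset_coef by blast
qed

text \<open>The monoid argument: a left inverse v of u must equal s by associativity, so the
  one-sided inverse u of s is two-sided.\<close>

lemma parabolic_inverse:
  assumes s: "hsupp s \<subseteq> lpos k"
  obtains u where "hsupp u \<subseteq> lpos k" "s + cmp k 1 s u = 0" "u + cmp k 1 u s = 0"
proof -
  obtain u where u: "hsupp u \<subseteq> lpos k" "s + cmp k 1 s u = 0" by (rule parabolic_left_inverse[OF s])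
  obtain v where v: "hsupp v \<subseteq> lpos k" "u + cmp k 1 u v = 0" by (rule parabolic_left_inverse[OF u(1)])
  note i = lposD(1)[OF s] lposD(1)[OF u(1)] note S = strong_cmp(1)[OF i(1), of k 1]
  have "cmp k 1 s (cmp k 1 u v) = cmp k 1 0 v"
    using cmp_cmp[OF i(2,1), of 1 1 k v] u(2) by simp
  moreover have "cmp k 1 s (u + cmp k 1 u v) = 0" by (simp only: v(2) strong_zero[OF S])
  ultimately have "cmp k 1 s u + v = 0" by (simp add: strong_add[OF S])
  then have "v = s" using u(2) by (metis add.commute add_left_cancel)
  then show ?thesis using that u v by blast
qed

text \<open>With phi = z exp(s) the equation says f o phi = phi o f_0. Its linear part
  \<open>T\<close> moves the leading exponent by \<open>ltau\<close> with nonzero coefficient, and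
  the nonlinear part reacts to a change of order \<open>b\<close> only beyond \<open>ltau b\<close>;
  so one leading monomial can be corrected at a time.\<close>

lemma normalization_exists:
  assumes lam: "0 < lam" "lam < 1" and w: "hsupp w \<subseteq> lpos k" "hsupp w0 \<subseteq> lpos k"
    and ww: "hsupp (w - w0) \<subseteq> {lones k<..}"
  obtains s where "hsupp s \<subseteq> lpos k" "s + cmp k 1 s w = w0 + cmp k lam w0 s"
proof -
  define T where "T x = cmp k lam w0 x - x" for x
  define E where "E x = T x - (cmp k 1 x w - w0)" for x
  note i = lposD(1)[OF w(1)] lposD(1)[OF w(2)]
  have S: "strong T" unfolding T_def[abs_def] by (rule strong_minus_op[OF strong_cmp(1)[OF i(2)] strong_id])
  have T_hmon: "T (hmon b) = qker k lam w0 b - hmon b" for b by (simp add: T_def strong_cmp(2)[OF i(2)])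
  have T_lip: "hsupp (T x) \<subseteq> {ltau b..}" if "hsupp x \<subseteq> lpos k" "hsupp x \<subseteq> {b..}" "0 < b" for x b
    unfolding T_def
  proof (rule hsupp_cmp_minus_id[OF i(2) lam(1) lposD(1)[OF that(1)]])
    fix a assume "a \<in> hsupp x"
    then have "ltau b \<le> ltau a" using that by (intro ltau_mono) auto
    then show "{ltau a..} \<subseteq> {ltau b..}" by auto
  qed
  have N_lip: "hsupp (cmp k 1 x w - cmp k 1 y w) \<subseteq> {ltau b<..}"
    if x: "hsupp x \<subseteq> lpos k" "hsupp y \<subseteq> lpos k" "hsupp (x - y) \<subseteq> {b..}" and b: "b \<in> lpos k" for x y b
  proof
    note ix = lposD(1)[OF x(1)] lposD(1)[OF x(2)]
    fix m assume "m \<in> hsupp (cmp k 1 x w - cmp k 1 y w)"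
    then obtain a where a: "a \<in> hsupp w" "m \<in> hsupp (cmp k 1 x (hmon a) - cmp k 1 y (hmon a))"
      by (rule strong_hsupp[OF strong_minus_op[OF strong_cmp(1)[OF ix(1)] strong_cmp(1)[OF ix(2)]]])
    have a0: "0 < a" using a(1) w(1) by (auto simp: lpos_def)
    have "hsupp (qker k 1 x a - qker k 1 y a) \<subseteq> {ltau a + b..}"
      by (rule hsupp_qker_diff[OF ix]) (use x b a0 in \<open>auto simp: lpos_def\<close>)
    then have "ltau a + b \<le> m" using a(2) by (auto simp: strong_cmp(2)[OF ix(1)] strong_cmp(2)[OF ix(2)])
    have "ltau b \<le> b + lones k" using b by (intro ltau_le) (auto simp: lpos_def)
    also have "\<dots> < b + ltau a" using lones_less_ltau[OF a0] by simp
    also have "\<dots> \<le> m" using \<open>ltau a + b \<le> m\<close> by (simp add: add.commute)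
    finally show "m \<in> {ltau b<..}" by simp
  qed
  have lip: "hsupp (E x - E y) \<subseteq> {ltau b..}"
    if x: "hsupp x \<subseteq> lpos k" "hsupp y \<subseteq> lpos k" "hsupp (x - y) \<subseteq> {b..}" and b: "b \<in> lpos k" for x y b
  proof -
    have "hsupp (T (x - y)) \<subseteq> {ltau b..}"
      using T_lip[OF hsupp_diff[OF x(1,2)] x(3)] b by (simp add: lpos_def)
    moreover have "hsupp (cmp k 1 x w - cmp k 1 y w) \<subseteq> {ltau b..}"
      using N_lip[OF x b] by auto
    ultimately have "hsupp (T (x - y) - (cmp k 1 x w - cmp k 1 y w)) \<subseteq> {ltau b..}" by (rule hsupp_diff)
    then show ?thesis by (simp add: E_def strong_diff[OF S] algebra_simps)
  qed
  have "\<exists>x\<in>{x. \<forall>m. coef x m \<in> (if m \<in> lpos k then UNIV else {0})}. E x = 0"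
  proof (rule hahn_zero_by_approximation[where B = "lpos k" and \<tau> = ltau], unfold hsupp_subset_coef)
    fix x assume "x \<in> {x. hsupp x \<subseteq> lpos k}" and nz: "E x \<noteq> 0"
    then have x: "hsupp x \<subseteq> lpos k" by simp
    note ix = lposD(1)[OF x]
    obtain m where m: "coef (E x) m \<noteq> 0" "hsupp (E x) \<subseteq> {m..}" using hsupp_min[OF nz] by blast
    \<comment> \<open>\<open>E x\<close> lies beyond \<open>lones k\<close>: composition differences
      always do, and \<open>w - w0\<close> does by assumption. Its leading exponent is therefore a
      value of \<open>ltau\<close>.\<close>
    have "hsupp ((cmp k 1 x w - w) + (w - w0)) \<subseteq> {lones k<..}"
      by (rule hsupp_add[OF _ ww]) (simp add: hsupp_cmp_minus_id_lones ix i)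
    moreover have "hsupp (T x) \<subseteq> {lones k<..}"
      unfolding T_def by (rule hsupp_cmp_minus_id_lones[OF i(2) lam(1) ix])
    ultimately have "hsupp (T x - ((cmp k 1 x w - w) + (w - w0))) \<subseteq> {lones k<..}" by (rule hsupp_diff[rotated])
    then have "hsupp (E x) \<subseteq> {lones k<..}" by (simp add: E_def)
    moreover have "hsupp (E x) \<subseteq> dpt k"
      unfolding E_def T_def using lposD[OF x] lposD[OF w(1)] lposD[OF w(2)] by (intro hsupp_diff hsupp_cmp_dpt) auto
    moreover have "m \<in> hsupp (E x)" using m(1) by (simp add: in_hsupp)
    ultimately have "m \<in> dpt k" "lones k < m" by auto
    then obtain b where b: "0 < b" "b \<in> dpt k" and mb: "ltau b = m" by (rule ltau_surj)
    then have bl: "b \<in> lpos k" by (simp add: lpos_def)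
    define cb where "cb = coef (qker k lam w0 b - hmon b) (ltau b)"
    have cb: "cb \<noteq> 0" unfolding cb_def by (rule coef_qker_ltau[OF i(2) lam b])
    \<comment> \<open>The multiple of \<open>b\<close> makes the change of \<open>T\<close> cancel
      the leading term of \<open>E x\<close>; the nonlinear part does not reach
      \<open>m\<close>.\<close>
    define y where "y = x - (coef (E x) m / cb) *\<^sub>R hmon b"
    have hb: "hsupp (a *\<^sub>R hmon b) \<subseteq> {b}" for a by (rule hsupp_scaleR) simp
    have y: "hsupp y \<subseteq> lpos k" unfolding y_def using hb bl by (intro hsupp_diff[OF x]) blast
    have yx: "hsupp (y - x) \<subseteq> {b..}" unfolding y_def using hb by auto
    have "hsupp (E y - E x + E x) \<subseteq> {m..}"
      by (rule hsupp_add[OF lip[OF y x yx bl, unfolded mb] m(2)])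
    then have Ey: "hsupp (E y) \<subseteq> {m..}" by simp
    have "m \<notin> hsupp (cmp k 1 y w - cmp k 1 x w)" using N_lip[OF y x yx bl] mb by auto
    then have N0: "coef (cmp k 1 y w) m = coef (cmp k 1 x w) m" by (simp add: in_hsupp)
    have "T y = T x - (coef (E x) m / cb) *\<^sub>R (qker k lam w0 b - hmon b)"
      by (simp only: y_def strong_diff[OF S] strong_scaleR[OF S] T_hmon)
    then have "coef (T y) m = coef (T x) m - coef (E x) m / cb * cb"
      by (simp only: coef_diff[of "T x"] coef_scaleR cb_def mb)
    then have "coef (T y) m = coef (T x) m - coef (E x) m" using cb by simp
    then have "coef (E y) m = 0" using N0 by (simp add: E_def)
    then have "m \<notin> hsupp (E y)" by (simp add: in_hsupp)
    then have "hsupp (E y) \<subseteq> {m<..}" using Ey by (force simp: less_le)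
    then show "\<exists>b\<in>lpos k. \<exists>y\<in>{x. hsupp x \<subseteq> lpos k}. coef (E x) (ltau b) \<noteq> 0 \<and>
        hsupp (y - x) \<subseteq> {b..} \<and> hsupp (E y) \<subseteq> {ltau b<..}"
      using bl y yx m(1) mb by blast
  qed (use lip ltau_strict_mono in \<open>auto simp: lpos_def\<close>)
  then obtain s where s: "hsupp s \<subseteq> lpos k" "E s = 0" unfolding hsupp_subset_coef by blast
  then have "s + cmp k 1 s w = w0 + cmp k lam w0 s" by (simp add: E_def T_def algebra_simps)
  then show ?thesis using that s(1) by blast
qed

text \<open>\<open>v + cmp K lam v u\<close> is the logarithm of the conjugate of f, up to the
  factor lam z. Its difference from \<open>w\<close> splits into three composition differences
  beyond \<open>lones k\<close> and the term \<open>s + cmp K 1 s u\<close>, which vanishes for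
  inverse series.\<close>

lemma conjugate_log_invariant:
  assumes i: "infinitesimal s" "infinitesimal u" "infinitesimal w" and "0 < lam" and inv: "s + cmp K 1 s u = 0"
  defines "v \<equiv> s + cmp K 1 s w"
  shows "hsupp (v + cmp K lam v u - w) \<subseteq> {lones k<..}"
proof -
  have iv: "infinitesimal v" unfolding v_def using i by (intro infinitesimal_closure infinitesimal_cmp)
  have "v + cmp K lam v u - w = (cmp K 1 s w - w) + (cmp K lam v u - u) - (cmp K 1 s u - u) + (s + cmp K 1 s u)"
    by (simp add: v_def)
  also have "\<dots> = (cmp K 1 s w - w) + (cmp K lam v u - u) - (cmp K 1 s u - u)" by (simp only: inv add_0_right)
  also have "hsupp \<dots> \<subseteq> {lones k<..}"
    by (rule hsupp_diff[OF hsupp_add], insert i iv assms(4)) (simp_all add: hsupp_cmp_minus_id_lones)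
  finally show ?thesis .
qed

section \<open>Comparing series through their logarithms\<close>

lemma hexp_inject:
  assumes "infinitesimal w" "infinitesimal w'" "hexp w = hexp w'" shows "w = w'"
  using hlog_hexp[OF assms(1)] hlog_hexp[OF assms(2)] unfolding assms(3) by (rule trans[OF sym])

lemma tser_inject:
  assumes "infinitesimal w" "infinitesimal w'" "c \<noteq> 0" "tser c w = tser c w'" shows "w = w'"
proof (rule hexp_inject[OF assms(1,2)])
  have "hmon (- lz) * tser c w = hmon (- lz) * tser c w'" using assms(4) by simp
  then show "hexp w = hexp w'" using assms(3)
    by (simp add: tser_def mult.assoc[symmetric] hmon_add[symmetric])
qed

text \<open>\<open>hexp\<close> and \<open>hlog\<close> are both Lipschitz for the order, so taking
  logarithms preserves the order of differences; the factor z accounts for the shift by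
  \<open>lz\<close>.\<close>

lemma hsupp_tser_diff:
  assumes "infinitesimal w" "infinitesimal w'" "c \<noteq> 0"
  shows "hsupp (tser c w - tser c w') \<subseteq> {lz + a<..} \<longleftrightarrow> hsupp (w - w') \<subseteq> {a<..}"
proof -
  have up: "p + q \<in> {a<..}" if "p \<in> {a<..}" "0 \<le> q" for p q :: lmon
    using that add_strict_increasing2[of q a p] by (simp add: add.commute)
  have d: "tser c w - tser c w' = c *\<^sub>R (hmon lz * (hexp w - hexp w'))"
    by (simp add: tser_def algebra_simps)
  have e: "hsupp (w - w') \<subseteq> {a<..} \<longleftrightarrow> hsupp (hexp w - hexp w') \<subseteq> {a<..}"
  proof
    assume "hsupp (w - w') \<subseteq> {a<..}"
    then show "hsupp (hexp w - hexp w') \<subseteq> {a<..}" unfolding hexp_def by (rule fsub_lipschitz[OF assms(1,2) _ up])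
  next
    assume "hsupp (hexp w - hexp w') \<subseteq> {a<..}"
    then have "hsupp ((hexp w - 1) - (hexp w' - 1)) \<subseteq> {a<..}" by simp
    then have "hsupp (hlog (hexp w - 1) - hlog (hexp w' - 1)) \<subseteq> {a<..}"
      unfolding hlog_def by (rule fsub_lipschitz[OF infinitesimal_hexp_minus_1[OF assms(1)] infinitesimal_hexp_minus_1[OF assms(2)] _ up])
    then show "hsupp (w - w') \<subseteq> {a<..}" using assms by (simp add: hlog_hexp)
  qed
  have "m \<in> hsupp (tser c w - tser c w') \<longleftrightarrow> m - lz \<in> hsupp (hexp w - hexp w')" for m
    unfolding d using assms(3) by (simp only: in_hsupp coef_scaleR coef_hmon_mult) simp
  then have "hsupp (tser c w - tser c w') = (\<lambda>m. lz + m) ` hsupp (hexp w - hexp w')"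
    by (force simp: image_iff algebra_simps)
  then show ?thesis unfolding e by auto
qed

section \<open>Transseries as coefficient functions\<close>

definition tsof :: "lmon hahn \<Rightarrow> ts" where "tsof x = (\<lambda>m. coef x (Mon m))"

lemma tsof_apply: "tsof x m = coef x (Mon m)"
  by (simp add: tsof_def)

lemma tsof_inject: "tsof x = tsof y \<Longrightarrow> x = y"
  by (rule hahn_eqI) (metis tsof_def Mon_mexp)

lemma in_supp_tsof: "m \<in> supp (tsof x) \<longleftrightarrow> Mon m \<in> hsupp x"
  by (simp add: supp_def tsof_def in_hsupp)

lemma mless_iff: "mless a b \<longleftrightarrow> Mon a < Mon b"
  by (simp add: less_lmon_def)

lemma well_ordered_mon_iff: "well_ordered_mon S \<longleftrightarrow> wo (Mon ` S)"
proof -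
  have "(\<exists>x\<in>T. \<forall>y\<in>T. \<not> mless y x) \<longleftrightarrow> (\<exists>x\<in>Mon ` T. \<forall>y\<in>Mon ` T. x \<le> y)" for T
    by (simp add: mless_iff not_less)
  then show ?thesis unfolding well_ordered_mon_def wo_def by (simp add: all_subset_image)
qed

lemma wo_supp_tsof: "well_ordered_mon (supp (tsof x))"
  unfolding well_ordered_mon_iff by (rule wo_subset[OF wo_hsupp[of x]]) (auto simp: in_supp_tsof)

lemma tsof_surj:
  assumes "well_ordered_mon (supp f)" obtains x where "f = tsof x"
proof -
  have "{a. f (mexp a) \<noteq> 0} = Mon ` supp f"
    by (force simp: supp_def image_iff)
  then have "coef (Abs_hahn (\<lambda>a. f (mexp a))) = (\<lambda>a. f (mexp a))"
    using assms by (intro coef_Abs) (simp add: well_ordered_mon_iff)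
  then have "f = tsof (Abs_hahn (\<lambda>a. f (mexp a)))" by (simp add: tsof_def)
  then show ?thesis by (rule that)
qed

lemma tsof_ops:
  "tadd (tsof x) (tsof y) = tsof (x + y)" "tsub (tsof x) (tsof y) = tsof (x - y)"
  "tneg (tsof x) = tsof (- x)" "tscale c (tsof x) = tsof (c *\<^sub>R x)"
  "monom m c = tsof (c *\<^sub>R hmon (Mon m))"
  by (auto simp: tadd_def tsub_def tneg_def tscale_def monom_def tsof_def coef_hmon)

lemma Mon_zero [simp]: "Mon (0, zero_exp) = 0" and Mon_zmon [simp]: "Mon zmon = lz" "Mon (1, zero_exp) = lz"
  by (simp_all add: zero_lmon_def zero_exp_def zmon_def lz_def)

lemma Mon_ones_mon: "Mon (ones_mon k) = lz + lones k"
  by (rule lmon_eqI) (simp_all add: ones_mon_def ones_exp_def)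

lemma tone_tsof: "tone = tsof 1" and tz_tsof: "tz = tsof (hmon lz)"
  and ell_tsof: "ell (Suc j) = tsof (hmon (lell j))"
  by (simp_all add: tone_def tsof_ops lell_def)

lemma tmul_tsof: "tmul (tsof x) (tsof y) = tsof (x * y)"
proof
  fix m
  let ?A = "{a. coef x a * coef y (Mon m - a) \<noteq> 0}"
  have e: "mmul p q = m \<longleftrightarrow> q = mexp (Mon m - Mon p)" for p q
  proof -
    have "Mon (mmul p q) = Mon p + Mon q" by (rule lmon_eqI) (simp_all add: mmul_def)
    moreover have "mmul p q = m \<longleftrightarrow> Mon (mmul p q) = Mon m" by simp
    moreover have "q = mexp (Mon m - Mon p) \<longleftrightarrow> Mon q = Mon m - Mon p" by (metis mexp_Mon Mon_mexp)
    ultimately show ?thesis by (auto simp: algebra_simps)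
  qed
  have "tmul (tsof x) (tsof y) m = (\<Sum>a\<in>?A. coef x a * coef y (Mon m - a))"
    unfolding tmul_def
    by (rule sum.reindex_bij_witness[of _ "\<lambda>a. (mexp a, mexp (Mon m - a))" "\<lambda>p. Mon (fst p)"])
      (auto simp: in_supp_tsof in_hsupp e tsof_apply)
  then show "tmul (tsof x) (tsof y) m = tsof (x * y) m"
    by (simp only: tsof_def coef_mult Sum_any.expand_set)
qed

lemma tpow_tsof: "tpow (tsof x) i = tsof (x ^ i)"
  unfolding tpow_def by (induction i) (simp_all add: tone_tsof tmul_tsof)

lemma tsumN_tsof:
  assumes "hsummable G" shows "tsumN (\<lambda>i. tsof (G i)) = tsof (hsum G)"
  unfolding tsumN_def tsof_def coef_hsum[OF assms] Sum_any.expand_set ..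

lemma binser_tsof:
  assumes "infinitesimal x" shows "binser a (tsof x) = tsof (hexp (a *\<^sub>R hlog x))"
proof -
  have "binser a (tsof x) = tsof (fsub (fps_binomial a) x)"
    unfolding binser_def fsub_def tsumN_tsof[OF power_summable[OF assms], symmetric]
    by (simp only: tpow_tsof tsof_ops fps_binomial_nth)
  then show ?thesis by (simp add: fsub_binomial[OF assms])
qed

lemma log1p_tsof:
  assumes "infinitesimal x" shows "log1p (tsof x) = tsof (hlog x)"
proof -
  have "(if i = 0 then (\<lambda>_. 0) else tscale ((-1) ^ (i + 1) / real i) (tpow (tsof x) i)) =
    tsof (fps_nth (fps_ln 1) i *\<^sub>R x ^ i)" for i
    by (cases i) (simp_all add: tpow_tsof tsof_ops fps_ln_nth, simp add: tsof_def)
  then show ?thesis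
    unfolding log1p_def hlog_def fsub_def tsumN_tsof[OF power_summable[OF assms], symmetric] by simp
qed

section \<open>Composition of coefficient functions\<close>

lemma coef_tser: "coef (tser c w) m = c * coef (hexp w) (m - lz)"
  by (simp add: tser_def coef_hmon_mult)

lemma coef_hexp_0: "infinitesimal w \<Longrightarrow> coef (hexp w) 0 = 1"
  using infinitesimal_coef_0[OF infinitesimal_hexp_minus_1, of w] by (simp add: coef_one)

lemma tser_zmon: "infinitesimal w \<Longrightarrow> tsof (tser c w) zmon = c"
  by (simp add: tsof_def coef_tser coef_hexp_0)

lemma eps_tser:
  assumes "infinitesimal w" "c \<noteq> 0" shows "eps (tsof (tser c w)) = tsof (hexp w - 1)"
proof
  fix m
  have "Mon (fst m + 1, snd m) - lz = Mon m" by (rule lmon_eqI) simp_all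
  moreover have "m = (0, zero_exp) \<longleftrightarrow> Mon m = 0" by (metis Mon_zero Mon_inject')
  ultimately show "eps (tsof (tser c w)) m = tsof (hexp w - 1) m"
    using assms by (auto simp: eps_def tser_zmon coef_hexp_0 coef_one) (auto simp: tsof_def coef_tser coef_hexp_0 coef_one)
qed

lemma Lam_tser:
  assumes "infinitesimal w" "c > 0" shows "Lam (tsof (tser c w)) j = tsof (hlam c w j)"
proof (induction j)
  case 0
  show ?case using assms
    by (simp add: tser_zmon eps_tser log1p_tsof infinitesimal_hexp_minus_1 hlog_hexp tsof_ops)
next
  case (Suc j)
  have "infinitesimal (- (hmon (lell j) * hlam c w j))" using assms by (auto intro: infinitesimal_lell_hlam)
  then show ?case by (simp add: Suc ell_tsof tmul_tsof tsof_ops log1p_tsof hlam.simps(2) del: ell.simps)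
qed

text \<open>A factor (1 - l_(j+1) Lam)^(-n) is exp(n log((l_(j+1) o g) / l_(j+1))). The product in
  \<open>mon_comp\<close> stops at the exact depth of \<open>m\<close> while \<open>texp\<close>
  runs to \<open>K\<close>; the additional exponents are zero.\<close>

lemma mon_comp_tser:
  assumes w: "infinitesimal w" and c: "c > 0" and m: "Mon m \<in> dpt K"
  shows "mon_comp (tsof (tser c w)) m = tsof (qker K c w (Mon m))"
proof -
  let ?g = "tsof (tser c w)"
  let ?h = "\<lambda>j. real_of_int (snd m j) *\<^sub>R hlam c w (Suc j)"
  have fac: "binser (- of_int (snd m j)) (tneg (tmul (ell (Suc j)) (Lam ?g j))) = tsof (hexp (?h j))" for j
  proof -
    have "infinitesimal (- (hmon (lell j) * hlam c w j))" using w by (auto intro: infinitesimal_lell_hlam)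
    then show ?thesis
      by (simp add: Lam_tser[OF w c] ell_tsof tmul_tsof tsof_ops binser_tsof hlam.simps(2) del: ell.simps)
  qed
  have ih: "infinitesimal (\<Sum>j\<leftarrow>js. ?h j)" for js :: "nat list"
    by (induction js) (simp_all add: infinitesimal_closure infinitesimal_hlam[OF w])
  have "foldr (\<lambda>j acc. tmul (binser (- of_int (snd m j)) (tneg (tmul (ell (Suc j)) (Lam ?g j)))) acc) js tone =
    tsof (hexp (\<Sum>j\<leftarrow>js. ?h j))" for js
    unfolding fac
    by (induction js) (simp_all add: tone_tsof tmul_tsof hexp_add ih infinitesimal_closure infinitesimal_hlam[OF w])
  moreover have "(\<Sum>j\<leftarrow>[0..<depth_of m]. ?h j) = (\<Sum>j<K. ?h j)"
  proof -
    have K: "depth_le K m" using m by (simp add: dpt_def depth_le_def)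
    have d: "depth_le (depth_of m) m" unfolding depth_of_def using K by (rule LeastI)
    have dK: "depth_of m \<le> K" unfolding depth_of_def using K by (rule Least_le)
    have "(\<Sum>j\<leftarrow>[0..<depth_of m]. ?h j) = (\<Sum>j<depth_of m. ?h j)"
      by (simp add: sum_list_distinct_conv_sum_set atLeast0LessThan)
    also have "\<dots> = (\<Sum>j<K. ?h j)"
      by (rule sum.mono_neutral_left) (use d dK in \<open>auto simp: depth_le_def\<close>)
    finally show ?thesis .
  qed
  moreover have "binser (fst m) (eps ?g) = tsof (hexp (fst m *\<^sub>R w))"
    using w c by (simp add: eps_tser binser_tsof infinitesimal_hexp_minus_1 hlog_hexp)
  moreover have "infinitesimal (\<Sum>j<K. ?h j)" "infinitesimal (fst m *\<^sub>R w)"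
    using w by (auto intro: infinitesimal_sum infinitesimal_hlam)
  ultimately show ?thesis
    unfolding mon_comp_def by (simp add: tsof_ops tmul_tsof tser_zmon[OF w] qker_def texp_def hexp_add)
qed

text \<open>The depth bound concerns the outer series, whose logarithms are the ones substituted
  into. Strong linearity ensures that the sum in \<open>comp\<close> has a finite index set.\<close>

lemma comp_tser:
  assumes w: "infinitesimal w" and c: "c > 0" and x: "hsupp x \<subseteq> dpt K"
  shows "comp (tsof x) (tsof (tser c w)) = tsof (cmp K c w x)"
proof
  fix m
  let ?A = "{b. coef x b * coef (qker K c w b) (Mon m) \<noteq> 0}"
  have mc: "mon_comp (tsof (tser c w)) b = tsof (qker K c w (Mon b))" if "coef x (Mon b) \<noteq> 0" for b
    using that x by (intro mon_comp_tser[OF w c]) (auto simp: in_hsupp[symmetric])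
  have "comp (tsof x) (tsof (tser c w)) m = (\<Sum>b\<in>?A. coef x b * coef (qker K c w b) (Mon m))"
    unfolding comp_def
    by (rule sum.reindex_bij_witness[of _ mexp Mon]) (auto simp: in_supp_tsof in_hsupp mc tsof_apply)
  moreover have "hsummable (\<lambda>b. coef x b *\<^sub>R qker K c w b)"
    using strong_summable[OF strong_cmp(1)[OF w]] by (simp only: strong_cmp(2)[OF w])
  ultimately show "comp (tsof x) (tsof (tser c w)) m = tsof (cmp K c w x) m"
    by (simp only: tsof_def cmp_def coef_hsum coef_scaleR Sum_any.expand_set)
qed

lemma comp_tser_tser:
  assumes "hsupp w \<subseteq> lpos K" "infinitesimal w'" "c > 0" "c' > 0"
  shows "comp (tsof (tser c w)) (tsof (tser c' w')) = tsof (tser (c * c') (w' + cmp K c' w' w))"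
proof -
  have "hsupp (tser c w) \<subseteq> dpt K"
    unfolding tser_def using hsupp_hexp_dpt[OF lposD[OF assms(1)]]
    by (intro hsupp_scaleR hsupp_mult_subset[of _ "{lz}" _ "dpt K"]) auto
  then show ?thesis using assms lposD(1)[OF assms(1)] by (simp add: comp_tser cmp_tser)
qed

lemma Lk_tser:
  assumes "hsupp w \<subseteq> lpos k"
  shows "tsof (tser c w) \<in> Lk k" "leading (tsof (tser c w)) zmon c"
proof -
  have i: "infinitesimal w" and d: "hsupp w \<subseteq> dpt k" using lposD[OF assms] .
  have "hsupp (tser c w) \<subseteq> {lz + a |a. a \<in> dpt k \<and> 0 \<le> a}"
    unfolding tser_def using hsupp_hexp_dpt[OF i d] hsupp_hexp[OF i]
    by (intro hsupp_scaleR hsupp_mult_subset[of _ "{lz}" _ "dpt k \<inter> {0..}"]) auto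
  then have s: "\<exists>a. Mon m = lz + a \<and> a \<in> dpt k \<and> 0 \<le> a" if "m \<in> supp (tsof (tser c w))" for m
    using that by (auto simp: in_supp_tsof)
  have "fst m \<ge> 0 \<and> depth_le k m" if m: "m \<in> supp (tsof (tser c w))" for m
  proof -
    obtain a where a: "Mon m = lz + a" "a \<in> dpt k" "0 \<le> a" using s[OF m] by blast
    have "zdeg a \<ge> 0" using a(3) by (auto simp: le_less less_lmon_iff)
    moreover have "zdeg (Mon m) = 1 + zdeg a" using a(1) by simp
    moreover have "ldeg (Mon m) j = ldeg a j" for j using a(1) by simp
    ultimately show ?thesis using a(2) by (simp add: depth_le_def dpt_def)
  qed
  then show "tsof (tser c w) \<in> Lk k" by (simp add: Lk_def wo_supp_tsof)
  have "m = zmon \<or> mless zmon m" if "m \<in> supp (tsof (tser c w))" for m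
  proof -
    have "lz \<le> Mon m" using s[OF that] by auto
    then show ?thesis unfolding mless_iff Mon_zmon by (metis Mon_inject' Mon_zmon(1) le_less)
  qed
  then show "leading (tsof (tser c w)) zmon c" by (simp add: leading_def tser_zmon[OF i])
qed

text \<open>Here w = log(f / (c z)): division by the leading term leaves 1 + y with y infinitesimal,
  and the logarithm does not increase the depth.\<close>

lemma Lk_obtain_tser:
  assumes "f \<in> Lk k" "leading f zmon c" "c \<noteq> 0"
  obtains w where "f = tsof (tser c w)" "hsupp w \<subseteq> lpos k"
proof -
  obtain x where x: "f = tsof x" using tsof_surj assms(1) by (auto simp: Lk_def)
  have cx: "coef x lz = c" using assms(2) by (simp add: leading_def x tsof_def)
  have supp: "lz \<le> a \<and> a \<in> dpt k" if "a \<in> hsupp x" for a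
  proof -
    have m: "mexp a \<in> supp f" using that by (simp add: x in_supp_tsof)
    then have "depth_le k (mexp a)" using assms(1) by (auto simp: Lk_def)
    moreover have "mexp a = zmon \<or> mless zmon (mexp a)" using assms(2) m by (auto simp: leading_def)
    ultimately show ?thesis by (auto simp: mless_iff depth_le_def dpt_def ldeg_def) (metis Mon_mexp Mon_zmon(1) order_refl)
  qed
  define y where "y = (1 / c) *\<^sub>R (hmon (- lz) * x) - 1"
  have cy: "coef y m = coef x (m + lz) / c - (if m = 0 then 1 else 0)" for m
    by (simp add: y_def coef_hmon_mult coef_one)
  have "0 < m \<and> m \<in> dpt k" if "m \<in> hsupp y" for m
  proof (cases "m = 0")
    case True
    then show ?thesis using that assms(3) by (simp add: in_hsupp cy cx)
  next
    case False
    then have "m + lz \<in> hsupp x" using that by (auto simp: in_hsupp cy)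
    from supp[OF this] have "0 \<le> m" "m + lz \<in> dpt k" by auto
    then show ?thesis using False by (auto simp: dpt_def)
  qed
  then have "hsupp y \<subseteq> lpos k" by (auto simp: lpos_def)
  note y = lposD[OF this]
  have "hsupp (hlog y) \<subseteq> dpt k" unfolding hlog_def by (rule hsupp_fsub_closed[OF y]) auto
  then have w: "hsupp (hlog y) \<subseteq> lpos k" using y by (intro lposI infinitesimal_hlog)
  have "x = tser c (hlog y)"
  proof (rule hahn_eqI)
    fix m show "coef x m = coef (tser c (hlog y)) m"
      using assms(3) by (simp add: coef_tser hexp_hlog[OF y(1)] cy coef_one del: coef_minus)
  qed
  then show ?thesis using that w x by blast
qed

section \<open>Normal forms and conjugation of transseries\<close>

lemma ord_gt_tsof: "ord_gt (tsof x) (ones_mon k) \<longleftrightarrow> hsupp x \<subseteq> {lz + lones k<..}"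
proof
  assume o: "ord_gt (tsof x) (ones_mon k)"
  show "hsupp x \<subseteq> {lz + lones k<..}"
  proof
    fix a assume "a \<in> hsupp x"
    then have "mexp a \<in> supp (tsof x)" by (simp add: in_supp_tsof)
    then have "mless (ones_mon k) (mexp a)" using o by (auto simp: ord_gt_def)
    then show "a \<in> {lz + lones k<..}" by (simp add: mless_iff Mon_ones_mon)
  qed
qed (auto simp: ord_gt_def in_supp_tsof mless_iff Mon_ones_mon)

text \<open>The leading monomial z excludes everything below it, so whatever the normal form
  discards lies strictly beyond z l_1 ... l_k.\<close>

lemma ord_gt_normal_form:
  assumes "f \<in> Lk k" "leading f zmon lam"
  shows "ord_gt (tsub f (normal_form k f)) (ones_mon k)"
  unfolding ord_gt_def
proof
  fix m assume m: "m \<in> supp (tsub f (normal_form k f))"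
  let ?c = "fst m = 1 \<and> depth_le k m \<and> (snd m = zero_exp \<or> (lexless zero_exp (snd m) \<and>
    (snd m = ones_exp k \<or> lexless (snd m) (ones_exp k))))"
  have nc: "\<not> ?c" using m unfolding supp_def tsub_def normal_form_def by auto
  then have "m \<in> supp f" using m unfolding supp_def tsub_def normal_form_def by auto
  then have "depth_le k m" "m = zmon \<or> mless zmon m" using assms by (auto simp: Lk_def leading_def)
  then show "mless (ones_mon k) m" using nc lexless_linear[of "snd m" "ones_exp k"]
    by (auto simp: mless_def zmon_def ones_mon_def)
qed

lemma normal_form_support:
  assumes "m \<in> supp (normal_form k f)" shows "\<not> mless (ones_mon k) m"
proof -
  have c: "fst m = 1" "snd m = zero_exp \<or> (lexless zero_exp (snd m) \<and>
    (snd m = ones_exp k \<or> lexless (snd m) (ones_exp k)))"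
    using assms by (auto simp: supp_def normal_form_def split: if_splits)
  have z: "\<not> lexless (ones_exp k) zero_exp"
    by (auto simp: lexless_def ones_exp_def zero_exp_def split: if_splits)
  have "\<not> lexless (ones_exp k) (snd m)"
    using c(2) z lexless_trans[of "ones_exp k" "snd m" "ones_exp k"] lexless_irrefl by auto
  then show ?thesis using c by (simp add: mless_def ones_mon_def)
qed

lemma normal_form_Lk:
  assumes "f \<in> Lk k" "leading f zmon lam"
  shows "normal_form k f \<in> Lk k" "leading (normal_form k f) zmon lam"
proof -
  have sub: "supp (normal_form k f) \<subseteq> supp f" by (auto simp: supp_def normal_form_def split: if_splits)
  have "well_ordered_mon (supp (normal_form k f))"
    using assms(1) wo_subset[OF _ image_mono[OF sub, of Mon]] by (auto simp: Lk_def well_ordered_mon_iff)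
  then show "normal_form k f \<in> Lk k" using assms(1) sub by (auto simp: Lk_def)
  have "normal_form k f zmon = f zmon"
    by (simp add: normal_form_def zmon_def depth_le_def zero_exp_def)
  then show "leading (normal_form k f) zmon lam" using assms(2) sub by (auto simp: leading_def)
qed

lemma conjugate_to_normal_form:
  assumes f: "f \<in> Lk k" "leading f zmon lam" and lam: "0 < lam" "lam < 1"
  shows "\<exists>\<psi> \<phi>. \<psi> \<in> Lfrak0 \<and> \<phi> \<in> Lfrak0 \<and> inverse_pair \<psi> \<phi> \<and> comp \<psi> (comp f \<phi>) = normal_form k f"
proof -
  obtain w where w: "f = tsof (tser lam w)" "hsupp w \<subseteq> lpos k"
    using Lk_obtain_tser[OF f] lam by auto
  obtain w0 where w0: "normal_form k f = tsof (tser lam w0)" "hsupp w0 \<subseteq> lpos k"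
    using Lk_obtain_tser[OF normal_form_Lk[OF f]] lam by auto
  note iw = lposD(1)[OF w(2)] note iw0 = lposD(1)[OF w0(2)]
  have "hsupp (tser lam w - tser lam w0) \<subseteq> {lz + lones k<..}"
    using ord_gt_normal_form[OF f] unfolding w0(1) unfolding w(1) by (simp add: tsof_ops ord_gt_tsof)
  then have "hsupp (w - w0) \<subseteq> {lones k<..}" using lam by (simp add: hsupp_tser_diff[OF iw iw0])
  then obtain s where s: "hsupp s \<subseteq> lpos k" "s + cmp k 1 s w = w0 + cmp k lam w0 s"
    by (rule normalization_exists[OF lam w(2) w0(2)])
  obtain u where u: "hsupp u \<subseteq> lpos k" "s + cmp k 1 s u = 0" "u + cmp k 1 u s = 0"
    by (rule parabolic_inverse[OF s(1)])
  note si = lposD(1)[OF s(1)] note iu = lposD(1)[OF u(1)]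
  define \<psi> \<phi> where "\<psi> = tsof (tser 1 u)" and "\<phi> = tsof (tser 1 s)"
  have "\<psi> \<in> Lfrak0" "\<phi> \<in> Lfrak0"
    unfolding \<psi>_def \<phi>_def Lfrak0_def Lfrak_def using Lk_tser[OF u(1)] Lk_tser[OF s(1)] by auto
  moreover have "tser 1 0 = hmon lz" by (simp add: tser_def)
  then have "inverse_pair \<psi> \<phi>"
    unfolding inverse_pair_def \<psi>_def \<phi>_def
    using comp_tser_tser[OF u(1) si, of 1 1] comp_tser_tser[OF s(1) iu, of 1 1] u(2,3) by (simp only: tz_tsof) simp
  moreover have "comp \<psi> (comp f \<phi>) = normal_form k f"
  proof -
    let ?W = "w0 + cmp k lam w0 s"
    have iW: "infinitesimal ?W" using iw0 si by (intro infinitesimal_closure(3) infinitesimal_cmp)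
    have "comp f \<phi> = tsof (tser lam ?W)"
      unfolding w(1) \<phi>_def using comp_tser_tser[OF w(2) si, of lam 1] lam s(2) by simp
    then have "comp \<psi> (comp f \<phi>) = tsof (tser lam (?W + cmp k lam ?W u))"
      unfolding \<psi>_def using comp_tser_tser[OF u(1) iW, of 1 lam] lam by simp
    \<comment> \<open>Associativity turns composition with phi o f_0 into two successive
      compositions. As u is the inverse coordinate of s, the result is minus the term added to
      \<open>w0\<close> in \<open>?W\<close>.\<close>
    moreover have "cmp k lam ?W u = cmp k lam w0 (cmp k 1 s u)"
      using cmp_cmp[OF si iw0, of 1 lam k u] lam by simp
    moreover have "cmp k 1 s u = - s" using u(2) by (simp add: add_eq_0_iff)
    ultimately show ?thesis by (simp add: w0(1) strong_minus[OF strong_cmp(1)[OF iw0]])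
  qed
  ultimately show ?thesis by blast
qed

lemma ord_gt_conjugate:
  assumes f: "f \<in> Lk k" "leading f zmon lam" and lam: "0 < lam"
    and "\<psi> \<in> Lfrak0" "\<phi> \<in> Lfrak0" "inverse_pair \<psi> \<phi>"
  shows "ord_gt (tsub (comp \<psi> (comp f \<phi>)) f) (ones_mon k)"
proof -
  obtain a b where ab: "\<psi> \<in> Lk a" "\<phi> \<in> Lk b" "leading \<psi> zmon 1" "leading \<phi> zmon 1"
    using assms(4,5) by (auto simp: Lfrak0_def Lfrak_def)
  \<comment> \<open>The conjugating series have depths of their own: computation runs at the common
    depth \<open>K\<close>, while the estimate stays at \<open>k\<close>.\<close>
  define K where "K = max k (max a b)"
  obtain w where w: "f = tsof (tser lam w)" "hsupp w \<subseteq> lpos k" using Lk_obtain_tser[OF f] lam by auto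
  obtain u where u: "\<psi> = tsof (tser 1 u)" "hsupp u \<subseteq> lpos a" using Lk_obtain_tser[OF ab(1,3)] by auto
  obtain s where s: "\<phi> = tsof (tser 1 s)" "hsupp s \<subseteq> lpos b" using Lk_obtain_tser[OF ab(2,4)] by auto
  have K: "hsupp w \<subseteq> lpos K" "hsupp u \<subseteq> lpos K" "hsupp s \<subseteq> lpos K"
    by (rule order_trans[OF w(2)] order_trans[OF u(2)] order_trans[OF s(2)], rule lpos_mono, simp add: K_def)+
  note i = lposD(1)[OF K(1)] lposD(1)[OF K(2)] lposD(1)[OF K(3)]
  have "tser 1 (s + cmp K 1 s u) = tser 1 0"
    using assms(6) comp_tser_tser[OF K(2) i(3), of 1 1] unfolding inverse_pair_def u(1) s(1) tz_tsof
    by (intro tsof_inject) (simp add: tser_def)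
  then have inv: "s + cmp K 1 s u = 0"
    by (rule tser_inject[rotated 3]) (use i in \<open>auto intro: infinitesimal_cmp\<close>)
  let ?v = "s + cmp K 1 s w"
  have iv: "infinitesimal ?v" using i by (intro infinitesimal_closure(3) infinitesimal_cmp)
  have "comp f \<phi> = tsof (tser lam ?v)"
    unfolding w(1) s(1) using comp_tser_tser[OF K(1) i(3), of lam 1] lam by simp
  then have r: "comp \<psi> (comp f \<phi>) = tsof (tser lam (?v + cmp K lam ?v u))"
    unfolding u(1) using comp_tser_tser[OF K(2) iv, of 1 lam] lam by simp
  have "hsupp (?v + cmp K lam ?v u - w) \<subseteq> {lones k<..}"
    by (rule conjugate_log_invariant[OF i(3,2,1) lam inv])
  moreover have "infinitesimal (?v + cmp K lam ?v u)" using iv i by (intro infinitesimal_closure(3)[OF iv] infinitesimal_cmp)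
  ultimately have "hsupp (tser lam (?v + cmp K lam ?v u) - tser lam w) \<subseteq> {lz + lones k<..}"
    using i(1) lam by (simp only: hsupp_tser_diff)
  then show ?thesis unfolding r unfolding w(1) by (simp only: tsof_ops ord_gt_tsof)
qed

lemma ord_gt_trans: "ord_gt (tsub f g) m \<Longrightarrow> ord_gt (tsub g h) m \<Longrightarrow> ord_gt (tsub f h) m"
  by (force simp: ord_gt_def supp_def tsub_def)

theorem mainTheorem2:
  fixes k :: nat and f :: ts and lam :: real
  assumes "f \<in> Lk k" and "0 < lam" and "lam < 1" and "leading f zmon lam"
  shows "(\<exists>\<psi> \<phi>. \<psi> \<in> Lfrak0 \<and> \<phi> \<in> Lfrak0 \<and> inverse_pair \<psi> \<phi> \<and>
                 comp \<psi> (comp f \<phi>) = normal_form k f)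
    \<and> (\<forall>\<psi> \<phi>. \<psi> \<in> Lfrak0 \<longrightarrow> \<phi> \<in> Lfrak0 \<longrightarrow> inverse_pair \<psi> \<phi> \<longrightarrow>
          ord_gt (tsub (comp \<psi> (comp f \<phi>)) (normal_form k f)) (ones_mon k)
        \<and> supp (normal_form k f) \<subseteq> supp (comp \<psi> (comp f \<phi>))
        \<and> (\<forall>m\<in>supp (normal_form k f). comp \<psi> (comp f \<phi>) m = normal_form k f m))
    \<and> ((\<exists>\<psi> \<phi>. \<psi> \<in> Lfrak0 \<and> \<phi> \<in> Lfrak0 \<and> inverse_pair \<psi> \<phi> \<and>
                 comp \<psi> (comp f \<phi>) = tscale lam tz)
        \<longleftrightarrow> ord_gt (tsub f (tscale lam tz)) (ones_mon k))"
proof (intro conjI allI impI)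
  note f = assms(1,4) and lam = assms(2,3)
  let ?n = "normal_form k f"
  show ex: "\<exists>\<psi> \<phi>. \<psi> \<in> Lfrak0 \<and> \<phi> \<in> Lfrak0 \<and> inverse_pair \<psi> \<phi> \<and> comp \<psi> (comp f \<phi>) = ?n"
    by (rule conjugate_to_normal_form[OF f lam])
  have nf: "ord_gt (tsub f ?n) (ones_mon k)" by (rule ord_gt_normal_form[OF f])
  {
    fix \<psi> \<phi> assume \<psi>: "\<psi> \<in> Lfrak0" "\<phi> \<in> Lfrak0" "inverse_pair \<psi> \<phi>"
    let ?r = "comp \<psi> (comp f \<phi>)"
    show r: "ord_gt (tsub ?r ?n) (ones_mon k)"
      by (rule ord_gt_trans[OF ord_gt_conjugate[OF f lam(1) \<psi>] nf])
    \<comment> \<open>The difference has only monomials beyond \<open>ones_mon k\<close> and the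
      normal form has none of these, so both series agree on its support.\<close>
    show eq: "\<forall>m\<in>supp ?n. ?r m = ?n m"
    proof
      fix m assume "m \<in> supp ?n"
      then have "m \<notin> supp (tsub ?r ?n)" using r normal_form_support[of m k f] by (auto simp: ord_gt_def)
      then show "?r m = ?n m" by (simp add: supp_def tsub_def)
    qed
    then show "supp ?n \<subseteq> supp ?r" by (auto simp: supp_def)
  }
  show "(\<exists>\<psi> \<phi>. \<psi> \<in> Lfrak0 \<and> \<phi> \<in> Lfrak0 \<and> inverse_pair \<psi> \<phi> \<and> comp \<psi> (comp f \<phi>) = tscale lam tz)
      \<longleftrightarrow> ord_gt (tsub f (tscale lam tz)) (ones_mon k)" (is "?L \<longleftrightarrow> ?R")
  proof
    assume ?L
    \<comment> \<open>Here lam z is itself a conjugate of f, compared directly with f.\<close>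
    then have "ord_gt (tsub (tscale lam tz) f) (ones_mon k)" using ord_gt_conjugate[OF f lam(1)] by metis
    then show ?R by (auto simp: ord_gt_def supp_def tsub_def)
  next
    assume ?R
    then have "ord_gt (tsub (tscale lam tz) f) (ones_mon k)" by (auto simp: ord_gt_def supp_def tsub_def)
    then have o: "ord_gt (tsub (tscale lam tz) ?n) (ones_mon k)" using nf by (rule ord_gt_trans)
    \<comment> \<open>A disagreement could only occur beyond \<open>ones_mon k\<close>, where the
      normal form vanishes. Since it contains z, that monomial differs from z, and lam z vanishes
      there as well.\<close>
    have "?n m = tscale lam tz m" for m
    proof (rule ccontr)
      assume ne: "?n m \<noteq> tscale lam tz m"
      then have "m \<in> supp (tsub (tscale lam tz) ?n)" by (simp add: supp_def tsub_def del: ell.simps)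
      then have "mless (ones_mon k) m" using o unfolding ord_gt_def by blast
      then have "?n m = 0" using normal_form_support[of m k f] by (auto simp: supp_def)
      moreover have "?n zmon \<noteq> 0" using normal_form_Lk(2)[OF f] lam by (simp add: leading_def)
      ultimately have "?n m = 0" "m \<noteq> zmon" by auto
      then show False using ne by (simp add: tscale_def monom_def zmon_def)
    qed
    then show ?L using ex by (metis ext)
  qed
qed

end
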